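(* There exists an oracle $O\subseteq\{0,1\}^*$ such that, relative to $O$, all of the following hold: (i) $\mathrm{NP}^O\cap\mathrm{coNP}^O=\mathrm{P}^O$; (ii) no pair in $\mathrm{DisjNP}^O$ is $\leq_\mathrm{m}^{\mathrm{pp},O}$-hard for $\mathrm{DisjUP}^O$ (in particular, $\mathrm{DisjNP}^O$ has no $\leq_\mathrm{m}^{\mathrm{pp},O}$-complete pair); (iii) no language in $\mathrm{UP}^O$ is $\leq_\mathrm{m}^{\mathrm{p},O}$-complete for $\mathrm{UP}^O$; (iv) no pair in $\mathrm{DisjCoNP}^O$ is $\leq_\mathrm{m}^{\mathrm{pp},O}$-hard for $\mathrm{DisjCoUP}^O$ (in particular, $\mathrm{DisjCoNP}^O$ has no $\leq_\mathrm{m}^{\mathrm{pp},O}$-complete pair).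
   Context: All classes are relativized to $O$ by giving the corresponding machines oracle access to $O$. $\mathrm{UP}$ is the class of languages accepted by nondeterministic polynomial-time machines that on every input have at most one accepting computation path. $\mathrm{DisjNP}$ (resp. $\mathrm{DisjUP}$, $\mathrm{DisjCoNP}$, $\mathrm{DisjCoUP}$) is the class of pairs $(A,B)$ of disjoint sets $A,B$ both in $\mathrm{NP}$ (resp. $\mathrm{UP}$, $\mathrm{coNP}$, $\mathrm{coUP}$). For sets, $A\leq_\mathrm{m}^{\mathrm{p},O} B$ means there is $f\in\mathrm{FP}^O$ (total function computable in deterministic polynomial time with oracle $O$) with $x\in A\iff f(x)\in B$ for all $x$; $B$ is complete for a class $\mathcal C$ if $B\in\mathcal C$ and every $A\in\mathcal C$ reduces to $B$. For disjoint pairs, $(A,B)\leq_\mathrm{m}^{\mathrm{pp},O}(C,D)$ means there is $h\in\mathrm{FP}^O$ with $h(A)\subseteq C$ and $h(B)\subseteq D$; a pair is hard for a class of pairs if every pair of that class reduces to it. *)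

theory Defs
  imports Main "HOL-Computational_Algebra.Polynomial"
begin

type_synonym word = "bool list"
type_synonym lang = "word set"

datatype sym = Blank | Bit bool | Aux nat
datatype dir = MoveL | Stay | MoveR

text \<open>
  Multi-tape nondeterministic oracle Turing machines on two-way infinite tapes: tape 0 carries
  the input, tape 1 the oracle queries, tape 2 the output of transducers; any further tapes are
  work tapes. All tapes are read-write. The set of states and the tape alphabet are not listed
  separately: both are finite because the transition table is.
\<close>

record otm =
  n_tapes :: nat
  delta :: "(nat \<times> sym list \<times> nat \<times> sym list \<times> dir list) set"
  q_start :: nat
  q_acc :: nat
  q_query :: nat
  q_yes :: nat
  q_no :: nat

definition wf_otm :: "otm \<Rightarrow> bool" where
  "wf_otm M \<longleftrightarrow> n_tapes M \<ge> 3 \<and> finite (delta M) \<and> q_acc M \<noteq> q_query M \<and>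
     (\<forall>(q, rs, q', ws, ds) \<in> delta M. q \<noteq> q_acc M \<and> q \<noteq> q_query M \<and>
        length rs = n_tapes M \<and> length ws = n_tapes M \<and> length ds = n_tapes M)"

definition deterministic :: "otm \<Rightarrow> bool" where
  "deterministic M \<longleftrightarrow> (\<forall>q rs a b. (q, rs, a) \<in> delta M \<longrightarrow> (q, rs, b) \<in> delta M \<longrightarrow> a = b)"

record conf =
  state :: nat
  tape :: "nat \<Rightarrow> int \<Rightarrow> sym"
  head :: "nat \<Rightarrow> int"

fun shift :: "dir \<Rightarrow> int" where
  "shift MoveL = -1"
| "shift Stay = 0"
| "shift MoveR = 1"

text \<open>The word on a tape is the maximal block of bits starting at cell 0.\<close>

definition tape_word :: "(int \<Rightarrow> sym) \<Rightarrow> word \<Rightarrow> bool" where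
  "tape_word t w \<longleftrightarrow> (\<forall>i < length w. t (int i) = Bit (w ! i)) \<and> t (int (length w)) \<notin> range Bit"

definition input_tape :: "word \<Rightarrow> int \<Rightarrow> sym" where
  "input_tape x = (\<lambda>j. if 0 \<le> j \<and> j < int (length x) then Bit (x ! nat j) else Blank)"

definition init_conf :: "otm \<Rightarrow> word \<Rightarrow> conf" where
  "init_conf M x = \<lparr>state = q_start M,
     tape = (\<lambda>i. if i = 0 then input_tape x else (\<lambda>_. Blank)), head = (\<lambda>_. 0)\<rparr>"

text \<open>
  A query takes one step and changes nothing but the state. A configuration without successor is
  halting; it is accepting iff its state is \<open>q_acc\<close>.
\<close>

inductive step :: "otm \<Rightarrow> lang \<Rightarrow> conf \<Rightarrow> conf \<Rightarrow> bool" for M :: otm and A :: lang where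
  move: "(q, rs, q', ws, ds) \<in> delta M \<Longrightarrow> state c = q \<Longrightarrow>
     rs = map (\<lambda>i. tape c i (head c i)) [0..<n_tapes M] \<Longrightarrow>
     step M A c \<lparr>state = q',
       tape = (\<lambda>i. if i < n_tapes M then (tape c i)(head c i := ws ! i) else tape c i),
       head = (\<lambda>i. if i < n_tapes M then head c i + shift (ds ! i) else head c i)\<rparr>"
| ask: "state c = q_query M \<Longrightarrow> tape_word (tape c 1) w \<Longrightarrow>
     step M A c (c\<lparr>state := (if w \<in> A then q_yes M else q_no M)\<rparr>)"

text \<open>
  Computation paths are sequences of configurations. Since tapes are two-way infinite, distinct
  applicable transitions lead to distinct configurations, so counting these sequences is the same
  as counting sequences of nondeterministic choices.
\<close>

definition computation :: "otm \<Rightarrow> lang \<Rightarrow> word \<Rightarrow> conf list \<Rightarrow> bool" where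
  "computation M A x cs \<longleftrightarrow> cs \<noteq> [] \<and> hd cs = init_conf M x \<and> successively (step M A) cs"

definition accepting_paths :: "otm \<Rightarrow> lang \<Rightarrow> word \<Rightarrow> conf list set" where
  "accepting_paths M A x = {cs. computation M A x cs \<and> state (last cs) = q_acc M}"

definition accepted_lang :: "otm \<Rightarrow> lang \<Rightarrow> lang" where
  "accepted_lang M A = {x. accepting_paths M A x \<noteq> {}}"

text \<open>A computation path visiting \<open>n + 1\<close> configurations has \<open>n\<close> steps.\<close>

definition poly_time :: "otm \<Rightarrow> lang \<Rightarrow> bool" where
  "poly_time M A \<longleftrightarrow> (\<exists>p :: nat poly. \<forall>x cs. computation M A x cs \<longrightarrow>
     length cs \<le> poly p (length x) + 1)"

definition unambiguous :: "otm \<Rightarrow> lang \<Rightarrow> bool" where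
  "unambiguous M A \<longleftrightarrow>
     (\<forall>x. \<forall>cs \<in> accepting_paths M A x. \<forall>cs' \<in> accepting_paths M A x. cs = cs')"

definition class_P :: "lang \<Rightarrow> lang set" where
  "class_P A = {accepted_lang M A | M. wf_otm M \<and> deterministic M \<and> poly_time M A}"

definition class_NP :: "lang \<Rightarrow> lang set" where
  "class_NP A = {accepted_lang M A | M. wf_otm M \<and> poly_time M A}"

definition class_UP :: "lang \<Rightarrow> lang set" where
  "class_UP A = {accepted_lang M A | M. wf_otm M \<and> poly_time M A \<and> unambiguous M A}"

definition co :: "lang set \<Rightarrow> lang set" where
  "co \<C> = {- X | X. X \<in> \<C>}"

definition class_FP :: "lang \<Rightarrow> (word \<Rightarrow> word) set" where
  "class_FP A = {f. \<exists>M. wf_otm M \<and> deterministic M \<and> poly_time M A \<and>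
     (\<forall>x. \<exists>cs \<in> accepting_paths M A x. tape_word (tape (last cs) 2) (f x))}"

definition disj_pairs :: "lang set \<Rightarrow> (lang \<times> lang) set" where
  "disj_pairs \<C> = {(X, Y). X \<in> \<C> \<and> Y \<in> \<C> \<and> X \<inter> Y = {}}"

definition DisjNP :: "lang \<Rightarrow> (lang \<times> lang) set" where
  "DisjNP A = disj_pairs (class_NP A)"

definition DisjUP :: "lang \<Rightarrow> (lang \<times> lang) set" where
  "DisjUP A = disj_pairs (class_UP A)"

definition DisjCoNP :: "lang \<Rightarrow> (lang \<times> lang) set" where
  "DisjCoNP A = disj_pairs (co (class_NP A))"

definition DisjCoUP :: "lang \<Rightarrow> (lang \<times> lang) set" where
  "DisjCoUP A = disj_pairs (co (class_UP A))"

definition m_reducible :: "lang \<Rightarrow> lang \<Rightarrow> lang \<Rightarrow> bool" where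
  "m_reducible A X Y \<longleftrightarrow> (\<exists>f \<in> class_FP A. \<forall>x. x \<in> X \<longleftrightarrow> f x \<in> Y)"

definition m_complete :: "lang \<Rightarrow> lang \<Rightarrow> lang set \<Rightarrow> bool" where
  "m_complete A Y \<C> \<longleftrightarrow> Y \<in> \<C> \<and> (\<forall>X \<in> \<C>. m_reducible A X Y)"

definition pp_reducible :: "lang \<Rightarrow> lang \<times> lang \<Rightarrow> lang \<times> lang \<Rightarrow> bool" where
  "pp_reducible A X Y \<longleftrightarrow> (\<exists>h \<in> class_FP A. h ` fst X \<subseteq> fst Y \<and> h ` snd X \<subseteq> snd Y)"

definition pp_hard :: "lang \<Rightarrow> lang \<times> lang \<Rightarrow> (lang \<times> lang) set \<Rightarrow> bool" where
  "pp_hard A Y \<C> \<longleftrightarrow> (\<forall>X \<in> \<C>. pp_reducible A X Y)"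

definition pp_complete :: "lang \<Rightarrow> lang \<times> lang \<Rightarrow> (lang \<times> lang) set \<Rightarrow> bool" where
  "pp_complete A Y \<C> \<longleftrightarrow> Y \<in> \<C> \<and> pp_hard A Y \<C>"

end

theory Submission
  imports Defs "HOL-Library.Countable_Set"
begin

text \<open>
  Every requirement owns a cone of words \<open>1\<^sup>d 0 v\<close> of the oracle. For a pair of machines whose
  languages are complementary, the cone codes the answers of the first machine, so that the
  pair's language is in P. For a candidate complete language or hard pair, the cone carries at most
  one word per length (or at least one of two kinds, at most one of each), which defines a
  language in UP or a pair in DisjUP or DisjCoUP. Requirements are treated in turn: if some oracle
  respecting the earlier constraints violates the promise of the requirement (complementarity,
  unambiguity, disjointness), a finite part of such an oracle is fixed; otherwise the constraint
  is added.

  To defeat a reduction, one varies the words on one large level of the cone. The answer to a code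
  word is witnessed by an accepting path of one of the two complementary machines, and code words are
  padded, so unfolding these witnesses shows that a path depends on only polynomially many
  oracle words. If the reduction could not be defeated, paths for two different level words
  could be combined in one oracle that respects the earlier constraints and violates the promise, which
  was ruled out when the constraint was added.
\<close>

section \<open>Computations and their queries\<close>

text \<open>The delicate point is over which oracles a promise is required to hold. An oracle built
  to break the promise of the constraint at \<open>d\<close> in general also breaks the shape of
  cone \<open>d\<close> (two words on a level, or an empty level for \<open>CCo\<close>), and then
  nothing ensures that pairs adopted after \<open>d\<close> are still complementary there. So
  non-destruction is demanded over all oracles respecting the constraints below \<open>d\<close>
  only; in these, code words of later constraints count as free words. Their values must still be
  chosen: for \<open>CUP\<close> and \<open>CNP\<close> they are copied from oracles that respect
  everything, which costs a second unfolding and gives the cubic term in the size condition; for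
  \<open>CCo\<close> they are settled by majority. Acceptance is witnessed by few queries, rejection
  is not; hence for \<open>CCo\<close> an accepting path is carried from the empty-level oracle to
  one that respects all constraints, in that direction only.\<close>

lemma tape_word_unique:
  assumes "tape_word t v" "tape_word t w"
  shows "v = w"
proof -
  have "length v = length w"
    using assms unfolding tape_word_def by (metis linorder_neqE_nat rangeI)
  then show ?thesis
    using assms unfolding tape_word_def by (intro nth_equalityI) (metis sym.inject(1))+
qed

text \<open>Pending queries count too: a configuration in the query state contributes its word even
  when it is the last of \<open>cs\<close>. Because of this, \<open>maximal_run_accepts\<close> can
  extend a run by one step under another oracle.\<close>

definition queries :: "otm \<Rightarrow> conf list \<Rightarrow> lang" where
  "queries M cs = {w. \<exists>c \<in> set cs. state c = q_query M \<and> tape_word (tape c 1) w}"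

lemma finite_queries: "finite (queries M cs)"
  and card_queries: "card (queries M cs) \<le> length cs"
proof -
  have sub: "queries M cs \<subseteq> (\<lambda>c. THE w. tape_word (tape c 1) w) ` set cs"
  proof
    fix w assume "w \<in> queries M cs"
    then obtain c where c: "c \<in> set cs" "tape_word (tape c 1) w" unfolding queries_def by blast
    then have "(THE w. tape_word (tape c 1) w) = w" by (blast intro: the_equality tape_word_unique)
    with c(1) show "w \<in> (\<lambda>c. THE w. tape_word (tape c 1) w) ` set cs" by force
  qed
  then show "finite (queries M cs)" by (meson finite_imageI finite_set finite_subset)
  have "card (queries M cs) \<le> card (set cs)"
    using sub by (meson card_image_le card_mono finite_imageI finite_set le_trans)
  then show "card (queries M cs) \<le> length cs" using card_length le_trans by blast
qed

lemma step_cong: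
  assumes "step M A c c'"
    and "\<And>w. state c = q_query M \<Longrightarrow> tape_word (tape c 1) w \<Longrightarrow> w \<in> A \<longleftrightarrow> w \<in> B"
  shows "step M B c c'"
  using assms(1)
proof cases
  case (move q rs q' ws ds)
  then show ?thesis using step.move[of q rs q' ws ds M c B] by simp
next
  case (ask w)
  then show ?thesis using step.ask[of c M w B] assms(2) by simp
qed

lemma computation_cong:
  assumes "computation M A x cs" "\<forall>w \<in> queries M cs. w \<in> A \<longleftrightarrow> w \<in> B"
  shows "computation M B x cs"
  unfolding computation_def successively_conv_nth
proof (intro conjI allI impI)
  fix i assume i: "Suc i < length cs"
  then have "step M A (cs ! i) (cs ! Suc i)"
    using assms(1) unfolding computation_def successively_conv_nth by blast
  then show "step M B (cs ! i) (cs ! Suc i)"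
  proof (rule step_cong)
    fix w assume "state (cs ! i) = q_query M" "tape_word (tape (cs ! i) 1) w"
    moreover have "cs ! i \<in> set cs" using i by simp
    ultimately show "w \<in> A \<longleftrightarrow> w \<in> B" using assms(2) unfolding queries_def by blast
  qed
qed (use assms(1) in \<open>simp_all add: computation_def\<close>)

lemma accepting_paths_cong:
  assumes "cs \<in> accepting_paths M A x" "\<forall>w \<in> queries M cs. w \<in> A \<longleftrightarrow> w \<in> B"
  shows "cs \<in> accepting_paths M B x"
  using assms computation_cong unfolding accepting_paths_def by blast

text \<open>Every tape but the input tape starts blank, and heads move by at most one cell per step.
  This is the source of the strict bound on the length of queried and written words, so that later
  it suffices for oracles to agree strictly below the clock.\<close>

lemma computation_support:
  assumes "computation M A x cs" "i \<ge> 1" "j < length cs"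
  shows "\<bar>head (cs ! j) i\<bar> \<le> int j \<and> (\<forall>p. tape (cs ! j) i p \<noteq> Blank \<longrightarrow> \<bar>p\<bar> < int j)"
  using assms(3)
proof (induction j)
  case 0
  have "cs ! 0 = init_conf M x"
    using assms(1) unfolding computation_def by (metis hd_conv_nth)
  then show ?case using assms(2) by (simp add: init_conf_def)
next
  case (Suc j)
  have st: "step M A (cs ! j) (cs ! Suc j)"
    using assms(1) Suc.prems unfolding computation_def successively_conv_nth by blast
  have IH: "\<bar>head (cs ! j) i\<bar> \<le> int j" "\<And>p. tape (cs ! j) i p \<noteq> Blank \<Longrightarrow> \<bar>p\<bar> < int j"
    using Suc by auto
  have sh: "\<bar>shift d\<bar> \<le> 1" for d by (cases d) auto
  from st show ?case
  proof cases
    case (move q rs q' ws ds)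
    have "\<bar>head (cs ! j) i + shift (ds ! i)\<bar> \<le> int (Suc j)"
      using IH(1) sh[of "ds ! i"] by linarith
    moreover have "\<bar>p\<bar> < int (Suc j)" if "((tape (cs ! j) i)(head (cs ! j) i := s)) p \<noteq> Blank" for p s
      using that IH(1) IH(2)[of p] by (auto split: if_splits)
    moreover have "\<bar>p\<bar> < int (Suc j)" if "tape (cs ! j) i p \<noteq> Blank" for p
      using that IH(2)[of p] by auto
    ultimately show ?thesis unfolding move(1) using IH(1) by (auto split: if_splits)
  next
    case (ask w)
    then show ?thesis using IH by fastforce
  qed
qed

lemma tape_word_length:
  assumes "computation M A x cs" "i \<ge> 1" "c \<in> set cs" "tape_word (tape c i) w"
  shows "length w < length cs"
proof -
  obtain j where j: "j < length cs" "c = cs ! j" using assms(3) by (metis in_set_conv_nth)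
  show ?thesis
  proof (cases "w = []")
    case False
    then have "tape c i (int (length w - 1)) \<noteq> Blank"
      using assms(4) unfolding tape_word_def by simp
    then show ?thesis using computation_support[OF assms(1,2) j(1)] j by fastforce
  qed (use j in auto)
qed

lemma queries_length:
  assumes "computation M A x cs" "w \<in> queries M cs"
  shows "length w < length cs"
  using assms tape_word_length[OF assms(1), of 1] unfolding queries_def by auto

lemma acc_state_no_step:
  assumes "wf_otm M" "step M A c c'"
  shows "state c \<noteq> q_acc M"
  using assms(2,1) by cases (auto simp: wf_otm_def)

lemma deterministic_step:
  assumes "wf_otm M" "deterministic M" "step M A c c1" "step M A c c2"
  shows "c1 = c2"
  using assms(3)
proof cases
  case m: (move q rs q' ws ds)
  from assms(4) show ?thesis
  proof cases
    case (move q2 rs2 q2' ws2 ds2)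
    then show ?thesis using m assms(2) unfolding deterministic_def by blast
  next
    case (ask w)
    then show ?thesis using m assms(1) unfolding wf_otm_def by blast
  qed
next
  case a: (ask w)
  from assms(4) show ?thesis
  proof cases
    case (move q2 rs2 q2' ws2 ds2)
    then show ?thesis using a assms(1) unfolding wf_otm_def by blast
  next
    case (ask w)
    then show ?thesis using a tape_word_unique by blast
  qed
qed

lemma deterministic_prefix:
  assumes "wf_otm M" "deterministic M" "computation M A x cs" "computation M A x cs'"
    and "j < length cs" "j < length cs'"
  shows "cs ! j = cs' ! j"
  using assms(5,6)
proof (induction j)
  case 0
  then show ?case using assms(3,4) unfolding computation_def by (metis hd_conv_nth)
next
  case (Suc j)
  then have "step M A (cs ! j) (cs ! Suc j)" "step M A (cs' ! j) (cs' ! Suc j)"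
    using assms(3,4) unfolding computation_def successively_conv_nth by blast+
  then show ?case using Suc deterministic_step[OF assms(1,2)] by (metis Suc_lessD)
qed

lemma deterministic_halting_maximal:
  assumes "wf_otm M" "deterministic M" "computation M A x cs" "computation M A x cs'"
    and "\<And>c. \<not> step M A (last cs) c"
  shows "length cs' \<le> length cs"
proof (rule ccontr)
  assume "\<not> ?thesis"
  then have l: "length cs < length cs'" by simp
  have ne: "cs \<noteq> []" using assms(3) unfolding computation_def by blast
  have "step M A (cs' ! (length cs - 1)) (cs' ! Suc (length cs - 1))"
    using assms(4) l ne unfolding computation_def successively_conv_nth
    by (metis Suc_diff_1 length_greater_0_conv)
  moreover have "cs' ! (length cs - 1) = last cs"
    using deterministic_prefix[OF assms(1,2,3,4), of "length cs - 1"] l ne by (simp add: last_conv_nth)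
  ultimately show False using assms(5) by metis
qed

lemma accepting_path_maximal:
  assumes "wf_otm M" "deterministic M" "cs \<in> accepting_paths M A x" "computation M A x cs'"
  shows "length cs' \<le> length cs"
proof (rule deterministic_halting_maximal[OF assms(1,2) _ assms(4)])
  show "computation M A x cs" using assms(3) unfolding accepting_paths_def by simp
  show "\<not> step M A (last cs) c" for c
    using assms(3) acc_state_no_step[OF assms(1)] unfolding accepting_paths_def by auto
qed

lemma accepting_path_unique:
  assumes "wf_otm M" "deterministic M" "cs \<in> accepting_paths M A x" "cs' \<in> accepting_paths M A x"
  shows "cs = cs'"
proof -
  have c: "computation M A x cs" "computation M A x cs'" using assms unfolding accepting_paths_def by auto
  have "length cs = length cs'"
    using accepting_path_maximal[OF assms(1,2)] assms(3,4) c by (meson le_antisym)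
  then show ?thesis
    using deterministic_prefix[OF assms(1,2) c] by (intro nth_equalityI) auto
qed

section \<open>Oracles that agree up to a length, and clock bounds\<close>

definition agree :: "nat \<Rightarrow> lang \<Rightarrow> lang \<Rightarrow> bool" where
  "agree N A B \<longleftrightarrow> (\<forall>w. length w < N \<longrightarrow> (w \<in> A \<longleftrightarrow> w \<in> B))"

lemma agree_refl [simp]: "agree N A A"
  and agree_sym: "agree N A B \<Longrightarrow> agree N B A"
  and agree_trans: "agree N A B \<Longrightarrow> agree N B C \<Longrightarrow> agree N A C"
  and agree_mono: "agree N A B \<Longrightarrow> N' \<le> N \<Longrightarrow> agree N' A B"
  unfolding agree_def by auto

text \<open>The base is at least 2 even for the empty input, so constants and sums are absorbed by
  raising the exponent, and every polynomial is dominated by some \<open>bnd k\<close>.\<close>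

definition bnd :: "nat \<Rightarrow> nat \<Rightarrow> nat" where
  "bnd k n = (n + 2) ^ k"

lemma bnd_pos [simp]: "bnd k n > 0" "Suc 0 \<le> bnd k n" unfolding bnd_def by (auto simp: Suc_le_eq)

lemma bnd_mono: "k \<le> k' \<Longrightarrow> n \<le> n' \<Longrightarrow> bnd k n \<le> bnd k' n'"
  unfolding bnd_def 
  by (rule order_trans[OF power_increasing power_mono]) auto

lemma bnd_mult: "bnd j n * bnd k n = bnd (j + k) n"
  unfolding bnd_def by (simp add: power_add)

lemma bnd_ge_const: "c \<le> bnd c n"
proof -
  have "c \<le> 2 ^ c" by simp
  also have "\<dots> \<le> (n + 2) ^ c" by (intro power_mono) auto
  finally show ?thesis by (simp add: bnd_def)
qed

lemma bnd_add: "bnd k n + bnd k n \<le> bnd (Suc k) n"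
  unfolding bnd_def by simp

lemma bnd_bnd: "bnd k (bnd j n) \<le> bnd ((j + 2) * k) n"
proof -
  have "2 * 2 \<le> (n + 2) * (n + 2)" by (intro mult_mono) auto
  then have "(n + 2) ^ j * 4 \<le> (n + 2) ^ j * ((n + 2) * (n + 2))" by simp
  moreover have "(n + 2) ^ j > 0" by simp
  ultimately have "(n + 2) ^ j + 2 \<le> (n + 2) ^ (j + 2)"
    unfolding power_add power2_eq_square by linarith
  then show ?thesis
    unfolding bnd_def power_mult by (intro power_mono) auto
qed

section \<open>Constraints and certificates\<close>

text \<open>The clock belongs to acceptance because a machine that is polynomial-time relative to
  the final oracle need not be so relative to the oracles tried on the way. With it, acceptance of
  \<open>x\<close> depends only on oracle words shorter than
  \<open>bnd k (length x)\<close>.\<close>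

definition acc :: "otm \<Rightarrow> nat \<Rightarrow> lang \<Rightarrow> word \<Rightarrow> bool" where
  "acc M k A x \<longleftrightarrow> (\<exists>ps \<in> accepting_paths M A x. length ps \<le> bnd k (length x))"

definition outputs :: "otm \<Rightarrow> nat \<Rightarrow> lang \<Rightarrow> word \<Rightarrow> word \<Rightarrow> bool" where
  "outputs T k A x y \<longleftrightarrow> (\<exists>ps \<in> accepting_paths T A x. length ps \<le> bnd k (length x) \<and>
     tape_word (tape (last ps) 2) y)"

lemma accepting_paths_agree:
  assumes "agree N A B" "ps \<in> accepting_paths M A x" "length ps \<le> N"
  shows "ps \<in> accepting_paths M B x"
proof (rule accepting_paths_cong[OF assms(2)])
  have "computation M A x ps" using assms(2) unfolding accepting_paths_def by simp
  then show "\<forall>w \<in> queries M ps. w \<in> A \<longleftrightarrow> w \<in> B"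
    using queries_length assms(1,3) unfolding agree_def by fastforce
qed

lemma acc_agree:
  assumes "agree (bnd k (length x)) A B"
  shows "acc M k A x \<longleftrightarrow> acc M k B x"
  using accepting_paths_agree[OF assms] accepting_paths_agree[OF agree_sym[OF assms]]
  unfolding acc_def by blast

lemma outputs_agree:
  assumes "agree (bnd k (length x)) A B"
  shows "outputs T k A x y \<longleftrightarrow> outputs T k B x y"
  using accepting_paths_agree[OF assms] accepting_paths_agree[OF agree_sym[OF assms]]
  unfolding outputs_def by blast

lemma outputs_length:
  assumes "outputs T k A x y"
  shows "length y < bnd k (length x)"
proof -
  obtain ps where "computation T A x ps" "length ps \<le> bnd k (length x)"
    "tape_word (tape (last ps) 2) y" "ps \<noteq> []"
    using assms unfolding outputs_def accepting_paths_def computation_def by blast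
  then show ?thesis using tape_word_length[of T A x ps 2 "last ps" y] by simp
qed

lemma outputs_unique:
  assumes "wf_otm T" "deterministic T" "outputs T k A x y" "outputs T k A x y'"
  shows "y = y'"
  using assms(3,4) accepting_path_unique[OF assms(1,2)] tape_word_unique
  unfolding outputs_def by metis

text \<open>The prefix is a self-delimiting code of \<open>d\<close>, so cones are disjoint. Words
  of cone \<open>d\<close> are longer than \<open>d\<close>; a constraint placed at index
  \<open>N\<close> therefore leaves all words of length below \<open>N\<close> alone.\<close>

definition cone :: "nat \<Rightarrow> word \<Rightarrow> word" where
  "cone d v = replicate d True @ False # v"

lemma length_cone [simp]: "length (cone d v) = d + length v + 1"
  by (simp add: cone_def)

lemma cone_inj [simp]: "cone d v = cone d' v' \<longleftrightarrow> d = d' \<and> v = v'"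
proof (induction d arbitrary: d')
  case 0
  then show ?case by (cases d') (auto simp: cone_def)
next
  case (Suc d)
  then show ?case by (cases d') (auto simp: cone_def)
qed

text \<open>Stop words tell a deterministic machine when the padding \<open>t\<close> is long enough
  for a code word. For \<open>t \<ge> 1\<close> a stop word ends in 1, whereas a code word ends in
  0; for \<open>t = 0\<close> the two kinds could coincide, hence the recurring condition
  \<open>t \<ge> 1\<close>.\<close>

definition stop_word :: "nat \<Rightarrow> word \<Rightarrow> nat \<Rightarrow> word" where
  "stop_word d x t = cone d (x @ False # replicate t True)"

definition code_word :: "nat \<Rightarrow> word \<Rightarrow> nat \<Rightarrow> word" where
  "code_word d x t = cone d (x @ False # replicate t True @ [False])"

lemma trailing_inj: "x @ False # replicate t True = x' @ False # replicate t' True \<longleftrightarrow> x = x' \<and> t = t'"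
proof -
  have "x @ False # replicate t True = x' @ False # replicate t' True \<longleftrightarrow>
      rev (x @ False # replicate t True) = rev (x' @ False # replicate t' True)"
    by (rule rev_is_rev_conv[symmetric])
  also have "\<dots> \<longleftrightarrow> cone t (rev x) = cone t' (rev x')"
    by (simp add: cone_def)
  finally show ?thesis by auto
qed

lemma code_word_inj [simp]: "code_word d x t = code_word d' x' t' \<longleftrightarrow> d = d' \<and> x = x' \<and> t = t'"
  using trailing_inj[of x t x' t'] unfolding code_word_def
  by (auto simp flip: append_Cons append_assoc)

lemma stop_word_not_code_word:
  assumes "t \<ge> 1"
  shows "stop_word d x t \<noteq> code_word d' x' t'"
proof
  assume "stop_word d x t = code_word d' x' t'"
  then have "x @ False # replicate t True = x' @ False # replicate t' True @ [False]"
    unfolding stop_word_def code_word_def by simp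
  then have "last (x @ False # replicate t True) = last (x' @ False # replicate t' True @ [False])"
    by simp
  then show False using assms by (simp split: if_splits)
qed

lemma length_code_word: "length (code_word d x t) = d + length x + t + 3"
  by (simp add: code_word_def)

text \<open>
  \<open>CPair\<close> stands for a language in NP and coNP, \<open>CUP\<close> for a candidate complete language of UP,
  \<open>CNP\<close> and \<open>CCo\<close> for candidate hard pairs of DisjNP and DisjCoNP; the last argument \<open>k\<close> is the
  exponent of the clock \<open>bnd k\<close>.
\<close>

datatype constr = CPair otm otm nat | CUP otm nat | CNP otm otm nat | CCo otm otm nat

text \<open>The exponent \<open>2 * k\<close> squares the clock: a code word is longer than the
  number of queries on a clocked path times the bound on their lengths. All linear bounds on
  dependency sets rest on this.\<close>

definition is_code :: "(nat \<rightharpoonup> constr) \<Rightarrow> word \<Rightarrow> otm \<Rightarrow> otm \<Rightarrow> nat \<Rightarrow> word \<Rightarrow> bool" where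
  "is_code C w M1 M2 k x \<longleftrightarrow>
     (\<exists>d t. C d = Some (CPair M1 M2 k) \<and> bnd (2 * k) (length x) \<le> t \<and> w = code_word d x t)"

definition coded :: "(nat \<rightharpoonup> constr) \<Rightarrow> word \<Rightarrow> bool" where
  "coded C w \<longleftrightarrow> (\<exists>M1 M2 k x. is_code C w M1 M2 k x)"

lemma is_code_unique:
  assumes "is_code C w M1 M2 k x" "is_code C w M1' M2' k' x'"
  shows "M1 = M1' \<and> M2 = M2' \<and> k = k' \<and> x = x'"
  using assms unfolding is_code_def by force

lemma is_code_length:
  assumes "is_code C w M1 M2 k x"
  shows "bnd k (length x) < length w" "bnd k (length x) * bnd k (length x) < length w"
proof -
  have *: "bnd (2 * k) (length x) < length w"
    using assms unfolding is_code_def by (auto simp: length_code_word)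
  then show "bnd k (length x) * bnd k (length x) < length w" by (simp add: bnd_mult mult_2)
  show "bnd k (length x) < length w"
    using * bnd_mono[of k "2 * k" "length x" "length x"] by simp
qed

text \<open>Only free words are constrained here, so the property survives any recomputation of code
  words; those are governed by \<open>codes_ok\<close>. For \<open>CCo\<close> the first letter of a
  word is its kind, and nonempty levels make the complements of the two guessed languages
  disjoint.\<close>

fun fsat :: "nat \<Rightarrow> constr \<Rightarrow> lang \<Rightarrow> bool" where
  "fsat d (CPair M1 M2 k) A \<longleftrightarrow>
     (\<forall>x t. t \<ge> 1 \<longrightarrow> (stop_word d x t \<in> A \<longleftrightarrow> bnd (2 * k) (length x) \<le> t))"
| "fsat d (CUP M k) A \<longleftrightarrow>
     (\<forall>v v'. length v = length v' \<longrightarrow> cone d v \<in> A \<longrightarrow> cone d v' \<in> A \<longrightarrow> v = v')"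
| "fsat d (CNP M1 M2 k) A \<longleftrightarrow>
     (\<forall>v v'. length v = length v' \<longrightarrow> cone d v \<in> A \<longrightarrow> cone d v' \<in> A \<longrightarrow> v = v')"
| "fsat d (CCo M1 M2 k) A \<longleftrightarrow>
     (\<forall>b v v'. length v = length v' \<longrightarrow> cone d (b # v) \<in> A \<longrightarrow> cone d (b # v') \<in> A \<longrightarrow> v = v') \<and>
     (\<forall>n. \<exists>b v. length v = n \<and> cone d (b # v) \<in> A)"

definition codes_ok :: "(nat \<rightharpoonup> constr) \<Rightarrow> lang \<Rightarrow> bool" where
  "codes_ok C A \<longleftrightarrow> (\<forall>w M1 M2 k x. is_code C w M1 M2 k x \<longrightarrow> (w \<in> A \<longleftrightarrow> acc M1 k A x))"

definition Sat :: "(nat \<rightharpoonup> constr) \<Rightarrow> lang \<Rightarrow> bool" where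
  "Sat C A \<longleftrightarrow> (\<forall>d c. C d = Some c \<longrightarrow> fsat d c A) \<and> codes_ok C A"

text \<open>The clocks make every violation visible on a finite part of the oracle, also where it
  consists in rejection (\<open>CPair\<close>, \<open>CCo\<close>).\<close>

fun destroyed :: "constr \<Rightarrow> lang \<Rightarrow> bool" where
  "destroyed (CPair M1 M2 k) A \<longleftrightarrow> (\<exists>x. acc M1 k A x \<longleftrightarrow> acc M2 k A x)"
| "destroyed (CUP M k) A \<longleftrightarrow> (\<exists>x. \<exists>ps \<in> accepting_paths M A x. \<exists>ps' \<in> accepting_paths M A x.
     ps \<noteq> ps' \<and> length ps \<le> bnd k (length x) \<and> length ps' \<le> bnd k (length x))"
| "destroyed (CNP M1 M2 k) A \<longleftrightarrow> (\<exists>x. acc M1 k A x \<and> acc M2 k A x)"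
| "destroyed (CCo M1 M2 k) A \<longleftrightarrow> (\<exists>x. \<not> acc M1 k A x \<and> \<not> acc M2 k A x)"

lemma destroyed_finite:
  assumes "destroyed c A"
  shows "\<exists>N. \<forall>B. agree N A B \<longrightarrow> destroyed c B"
proof (cases c)
  case (CPair M1 M2 k)
  then obtain x where "acc M1 k A x \<longleftrightarrow> acc M2 k A x" using assms by auto
  then show ?thesis using CPair acc_agree[of k x A] by (intro exI[of _ "bnd k (length x)"]) auto
next
  case (CUP M k)
  then obtain x ps ps' where "ps \<in> accepting_paths M A x" "ps' \<in> accepting_paths M A x"
     "ps \<noteq> ps'" "length ps \<le> bnd k (length x)" "length ps' \<le> bnd k (length x)" using assms by auto
  then have "\<forall>B. agree (bnd k (length x)) A B \<longrightarrow> destroyed c B"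
    unfolding CUP destroyed.simps using accepting_paths_agree by blast
  then show ?thesis by blast
next
  case (CNP M1 M2 k)
  then obtain x where "acc M1 k A x \<and> acc M2 k A x" using assms by auto
  then show ?thesis using CNP acc_agree[of k x A] by (intro exI[of _ "bnd k (length x)"]) auto
next
  case (CCo M1 M2 k)
  then obtain x where "\<not> acc M1 k A x \<and> \<not> acc M2 k A x" using assms by auto
  then show ?thesis using CCo acc_agree[of k x A] by (intro exI[of _ "bnd k (length x)"]) auto
qed

lemma stop_word_not_coded: "t \<ge> 1 \<Longrightarrow> \<not> coded C (stop_word d x t)"
  unfolding coded_def is_code_def using stop_word_not_code_word by blast

lemma cone_not_coded:
  assumes "\<And>M1 M2 k. C d \<noteq> Some (CPair M1 M2 k)"
  shows "\<not> coded C (cone d v)"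
  using assms unfolding coded_def is_code_def code_word_def by auto

lemma fsat_cong:
  assumes "C d = Some c" "fsat d c A"
    and *: "\<And>v. \<not> coded C (cone d v) \<Longrightarrow> cone d v \<in> A \<longleftrightarrow> cone d v \<in> B"
  shows "fsat d c B"
proof (cases c)
  case (CPair M1 M2 k)
  have "stop_word d x t \<in> A \<longleftrightarrow> stop_word d x t \<in> B" if "t \<ge> 1" for x t
    using * stop_word_not_coded[OF that] unfolding stop_word_def by blast
  then show ?thesis using assms(2) CPair by simp
next
  case (CUP M k)
  then have "cone d v \<in> A \<longleftrightarrow> cone d v \<in> B" for v using * cone_not_coded[of C d] assms(1) by auto
  then show ?thesis using assms(2) CUP by simp
next
  case (CNP M1 M2 k)
  then have "cone d v \<in> A \<longleftrightarrow> cone d v \<in> B" for v using * cone_not_coded[of C d] assms(1) by auto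
  then show ?thesis using assms(2) CNP by simp
next
  case (CCo M1 M2 k)
  then have "cone d v \<in> A \<longleftrightarrow> cone d v \<in> B" for v using * cone_not_coded[of C d] assms(1) by auto
  then show ?thesis using assms(2) CCo by simp
qed

section \<open>Oracles determined by their free words\<close>

definition body :: "(nat \<rightharpoonup> constr) \<Rightarrow> lang \<Rightarrow> lang \<Rightarrow> word \<Rightarrow> bool" where
  "body C G A w \<longleftrightarrow> \<not> coded C w \<and> w \<in> G \<or> (\<exists>M1 M2 k x. is_code C w M1 M2 k x \<and> acc M1 k A x)"

primrec Phi_upto :: "(nat \<rightharpoonup> constr) \<Rightarrow> lang \<Rightarrow> nat \<Rightarrow> lang" where
  "Phi_upto C G 0 = {}"
| "Phi_upto C G (Suc n) = Phi_upto C G n \<union> {w. length w = n \<and> body C G (Phi_upto C G n) w}"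

text \<open>Recursion on length is well founded because the computation coded by \<open>w\<close>
  sees only words shorter than \<open>w\<close>. By \<open>Phi_agree\<close>, this is the unique
  oracle with correct codes whose free words come from \<open>G\<close>; the values of
  \<open>G\<close> on code words are overwritten.\<close>

definition Phi :: "(nat \<rightharpoonup> constr) \<Rightarrow> lang \<Rightarrow> lang" where
  "Phi C G = {w. w \<in> Phi_upto C G (Suc (length w))}"

lemma body_agree:
  assumes "agree (length w) A B"
  shows "body C G A w \<longleftrightarrow> body C G B w"
proof -
  have "acc M1 k A x \<longleftrightarrow> acc M1 k B x" if "is_code C w M1 M2 k x" for M1 M2 k x
    using acc_agree agree_mono[OF assms] is_code_length(1)[OF that] by (metis less_imp_le_nat)
  then show ?thesis unfolding body_def by blast
qed

lemma Phi_upto_eq: "w \<in> Phi_upto C G n \<longleftrightarrow> length w < n \<and> w \<in> Phi C G"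
proof (induction n)
  case (Suc n)
  show ?case
  proof (cases "length w = n")
    case True
    then show ?thesis using Suc unfolding Phi_def by auto
  qed (use Suc in auto)
qed simp

lemma Phi_unfold: "w \<in> Phi C G \<longleftrightarrow> body C G (Phi C G) w"
proof -
  have "w \<in> Phi C G \<longleftrightarrow> body C G (Phi_upto C G (length w)) w"
    unfolding Phi_def by (auto simp: Phi_upto_eq)
  also have "\<dots> \<longleftrightarrow> body C G (Phi C G) w"
    by (rule body_agree) (simp add: agree_def Phi_upto_eq)
  finally show ?thesis .
qed

lemma Phi_free: "\<not> coded C w \<Longrightarrow> w \<in> Phi C G \<longleftrightarrow> w \<in> G"
  by (subst Phi_unfold) (auto simp: body_def coded_def)

lemma codes_ok_Phi: "codes_ok C (Phi C G)"
proof -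
  have "w \<in> Phi C G \<longleftrightarrow> acc M1 k (Phi C G) x" if "is_code C w M1 M2 k x" for w M1 M2 k x
  proof -
    have "w \<in> Phi C G \<longleftrightarrow> body C G (Phi C G) w" by (rule Phi_unfold)
    also have "\<dots> \<longleftrightarrow> acc M1 k (Phi C G) x"
      unfolding body_def using that is_code_unique[OF that] coded_def by blast
    finally show ?thesis .
  qed
  then show ?thesis unfolding codes_ok_def by blast
qed

text \<open>Correct codes are asked of \<open>F\<close> below \<open>N\<close> only:
  \<open>add_constraint\<close> applies this to an \<open>F\<close> that predates the new
  constraint, all of whose code words are longer than \<open>N\<close>.\<close>

lemma Phi_agree_below:
  assumes codes: "\<And>w M1 M2 k x. length w < N \<Longrightarrow> is_code C w M1 M2 k x \<Longrightarrow> w \<in> F \<longleftrightarrow> acc M1 k F x"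
    and free: "\<And>w. length w < N \<Longrightarrow> \<not> coded C w \<Longrightarrow> w \<in> F \<longleftrightarrow> w \<in> G"
  shows "agree N F (Phi C G)"
proof -
  have "length w < N \<Longrightarrow> w \<in> F \<longleftrightarrow> w \<in> Phi C G" for w
  proof (induction "length w" arbitrary: w rule: less_induct)
    case less
    show ?case
    proof (cases "coded C w")
      case False
      then show ?thesis using Phi_free[OF False, of G] free less.prems by blast
    next
      case True
      then obtain M1 M2 k x where c: "is_code C w M1 M2 k x" unfolding coded_def by blast
      have "agree (bnd k (length x)) F (Phi C G)"
        unfolding agree_def using less is_code_length(1)[OF c] by auto
      then have "acc M1 k F x \<longleftrightarrow> acc M1 k (Phi C G) x" by (rule acc_agree)
      then show ?thesis using c codes[OF less.prems c] codes_ok_Phi[of C G] unfolding codes_ok_def by blast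
    qed
  qed
  then show ?thesis unfolding agree_def by blast
qed

lemma Phi_agree:
  assumes "codes_ok C F" and "\<And>w. length w < N \<Longrightarrow> \<not> coded C w \<Longrightarrow> w \<in> F \<longleftrightarrow> w \<in> G"
  shows "agree N F (Phi C G)"
  using assms unfolding codes_ok_def by (intro Phi_agree_below) blast+

section \<open>Certificates for code words and their closures\<close>

definition good :: "(nat \<rightharpoonup> constr) \<Rightarrow> lang \<Rightarrow> bool" where
  "good C A \<longleftrightarrow> codes_ok C A \<and> (\<forall>d M1 M2 k x. C d = Some (CPair M1 M2 k) \<longrightarrow>
     acc M1 k A x \<noteq> acc M2 k A x)"

definition closed_under :: "(nat \<rightharpoonup> constr) \<Rightarrow> lang \<Rightarrow> lang \<Rightarrow> bool" where
  "closed_under C A S \<longleftrightarrow> (\<forall>w \<in> S. \<forall>M1 M2 k x. is_code C w M1 M2 k x \<longrightarrow>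
     (\<exists>M \<in> {M1, M2}. \<exists>ps \<in> accepting_paths M A x. length ps \<le> bnd k (length x) \<and> queries M ps \<subseteq> S))"

lemma closed_under_Union: "(\<And>S. S \<in> \<S> \<Longrightarrow> closed_under C A S) \<Longrightarrow> closed_under C A (\<Union>\<S>)"
  unfolding closed_under_def by (meson UnionE Union_upper subset_trans)

lemma good_certificate:
  assumes "good C A" "is_code C w M1 M2 k x"
  shows "\<exists>M \<in> {M1, M2}. \<exists>ps \<in> accepting_paths M A x. length ps \<le> bnd k (length x)"
  using assms unfolding good_def is_code_def acc_def by blast

text \<open>Complementarity provides a positive witness for either answer: a path of
  \<open>M1\<close> for membership of \<open>w\<close>, a path of \<open>M2\<close> for
  non-membership. The path survives in \<open>B\<close>, and as exactly one of the two machines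
  accepts there, it settles the value in \<open>B\<close> too. This is why both oracles have to be
  good.\<close>

lemma certificate_value:
  assumes "good C A" "good C B" "is_code C w M1 M2 k x" "M \<in> {M1, M2}"
    and "ps \<in> accepting_paths M A x" "length ps \<le> bnd k (length x)"
    and "\<And>q. q \<in> queries M ps \<Longrightarrow> q \<in> A \<longleftrightarrow> q \<in> B"
  shows "w \<in> A \<longleftrightarrow> w \<in> B"
proof -
  have "ps \<in> accepting_paths M B x" using assms accepting_paths_cong by blast
  then have "acc M k A x" "acc M k B x" using assms unfolding acc_def by blast+
  moreover have "w \<in> A \<longleftrightarrow> acc M1 k A x" "w \<in> B \<longleftrightarrow> acc M1 k B x"
    using assms(1,2,3) unfolding good_def codes_ok_def by blast+
  moreover have "acc M1 k A x \<noteq> acc M2 k A x" "acc M1 k B x \<noteq> acc M2 k B x"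
    using assms(1,2,3) unfolding good_def is_code_def by blast+
  ultimately show ?thesis using assms(4) by blast
qed

lemma card_UN_le_mult:
  assumes "finite I" "card I \<le> a" "\<And>i. i \<in> I \<Longrightarrow> card (S i) \<le> b"
  shows "card (\<Union>i \<in> I. S i) \<le> a * b"
proof -
  have "card (\<Union>i \<in> I. S i) \<le> (\<Sum>i \<in> I. card (S i))" by (rule card_UN_le[OF assms(1)])
  also have "\<dots> \<le> card I * b" using sum_bounded_above[of I "\<lambda>i. card (S i)" b] assms(3) by simp
  also have "\<dots> \<le> a * b" using assms(2) by simp
  finally show ?thesis .
qed

text \<open>
  A path for a code word \<open>w\<close> makes at most \<open>t\<close> queries of length below \<open>t\<close> with \<open>t * t < length w\<close>,
  so the linear bound survives unfolding the code words that are queried in turn.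
\<close>

lemma closure_of_word:
  assumes "good C A"
  shows "\<exists>S. w \<in> S \<and> finite S \<and> card S \<le> length w + 1 \<and> closed_under C A S \<and>
    (\<forall>q \<in> S. length q \<le> length w)"
proof (induction "length w" arbitrary: w rule: less_induct)
  case less
  show ?case
  proof (cases "coded C w")
    case False
    then show ?thesis by (intro exI[of _ "{w}"]) (auto simp: closed_under_def coded_def)
  next
    case True
    then obtain M1 M2 k x where c: "is_code C w M1 M2 k x" unfolding coded_def by blast
    obtain M ps where M: "M \<in> {M1, M2}" and ps: "ps \<in> accepting_paths M A x"
      "length ps \<le> bnd k (length x)" using good_certificate[OF assms c] by blast
    let ?t = "bnd k (length x)"
    have ql: "length q < ?t" if "q \<in> queries M ps" for q
      using that queries_length[of M A x ps q] ps unfolding accepting_paths_def by simp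
    have "\<forall>q \<in> queries M ps. \<exists>S. q \<in> S \<and> finite S \<and> card S \<le> length q + 1 \<and> closed_under C A S \<and>
      (\<forall>r \<in> S. length r \<le> length q)"
      using less ql is_code_length(1)[OF c] by (meson order.strict_trans)
    then obtain S where S: "\<And>q. q \<in> queries M ps \<Longrightarrow> q \<in> S q \<and> finite (S q) \<and>
      card (S q) \<le> length q + 1 \<and> closed_under C A (S q) \<and> (\<forall>r \<in> S q. length r \<le> length q)"
      by metis
    define U where "U = (\<Union>q \<in> queries M ps. S q)"
    have "card U \<le> ?t * ?t"
      unfolding U_def
    proof (rule card_UN_le_mult)
      show "finite (queries M ps)" by (rule finite_queries)
      show "card (queries M ps) \<le> ?t" using card_queries[of M ps] ps by linarith
      show "card (S q) \<le> ?t" if "q \<in> queries M ps" for q using S[OF that] ql[OF that] by linarith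
    qed
    then have card: "card U < length w" using is_code_length(2)[OF c] by linarith
    have fin: "finite U" unfolding U_def using finite_queries S by blast
    have qU: "queries M ps \<subseteq> U" unfolding U_def using S by blast
    have cl: "closed_under C A U" unfolding U_def using S by (intro closed_under_Union) blast
    have lU: "\<forall>q \<in> U. length q \<le> length w"
      unfolding U_def using S ql is_code_length(1)[OF c] by fastforce
    have "closed_under C A (insert w U)"
      unfolding closed_under_def
    proof (intro ballI allI impI)
      fix v N1 N2 j y assume v: "v \<in> insert w U" and vc: "is_code C v N1 N2 j y"
      show "\<exists>M\<in>{N1, N2}. \<exists>ps\<in>accepting_paths M A y.
          length ps \<le> bnd j (length y) \<and> queries M ps \<subseteq> insert w U"
      proof (cases "v = w")
        case True
        then have "N1 = M1 \<and> N2 = M2 \<and> j = k \<and> y = x" using vc c is_code_unique by blast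
        then show ?thesis using M ps qU by blast
      next
        case False
        then show ?thesis using v vc cl unfolding closed_under_def by blast
      qed
    qed
    then show ?thesis using card fin lU
      by (intro exI[of _ "insert w U"]) (auto simp: card_insert_if)
  qed
qed

lemma closure_of_set:
  assumes "good C A" "finite W" "card W \<le> a" "\<And>w. w \<in> W \<Longrightarrow> length w < b"
  shows "\<exists>S. W \<subseteq> S \<and> finite S \<and> card S \<le> a * b \<and> closed_under C A S \<and> (\<forall>q \<in> S. length q < b)"
proof -
  obtain S where S: "\<And>w. w \<in> S w \<and> finite (S w) \<and> card (S w) \<le> length w + 1 \<and>
      closed_under C A (S w) \<and> (\<forall>q \<in> S w. length q \<le> length w)"
    using closure_of_word[OF assms(1)] by metis
  have "card (\<Union>w \<in> W. S w) \<le> a * b"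
  proof (rule card_UN_le_mult[OF assms(2,3)])
    fix w assume "w \<in> W"
    then show "card (S w) \<le> b" using S[of w] assms(4)[of w] by linarith
  qed
  moreover have "closed_under C A (\<Union>w \<in> W. S w)" using S by (intro closed_under_Union) blast
  moreover have "\<forall>q \<in> (\<Union>w \<in> W. S w). length q < b" using S assms(4) le_less_trans by blast
  ultimately show ?thesis using S assms(2) by (intro exI[of _ "\<Union>w \<in> W. S w"]) blast
qed

text \<open>The queries of the certificate of a code word in \<open>S\<close> are shorter than the
  word and stay in \<open>S\<close>, so agreement on free words propagates upwards by length. The
  closure is measured in \<open>A\<close> alone, which allows \<open>B\<close> to be constructed
  after \<open>S\<close>.\<close>

lemma closed_under_agree:
  assumes "good C A" "good C B" "closed_under C A S"
    and "\<And>w. w \<in> S \<Longrightarrow> \<not> coded C w \<Longrightarrow> w \<in> A \<longleftrightarrow> w \<in> B"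
    and "w \<in> S"
  shows "w \<in> A \<longleftrightarrow> w \<in> B"
  using assms(5)
proof (induction "length w" arbitrary: w rule: less_induct)
  case less
  show ?case
  proof (cases "coded C w")
    case False
    then show ?thesis using assms(4) less.prems by blast
  next
    case True
    then obtain M1 M2 k x where c: "is_code C w M1 M2 k x" unfolding coded_def by blast
    then obtain M ps where M: "M \<in> {M1, M2}" and ps: "ps \<in> accepting_paths M A x"
      "length ps \<le> bnd k (length x)" "queries M ps \<subseteq> S"
      using assms(3)[unfolded closed_under_def, rule_format, OF less.prems c] by blast
    have "q \<in> A \<longleftrightarrow> q \<in> B" if "q \<in> queries M ps" for q
    proof -
      have "length q < length ps"
        using that queries_length[of M A x ps q] ps(1) unfolding accepting_paths_def by simp
      then have "length q < length w" using ps(2) is_code_length(1)[OF c] by linarith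
      then show ?thesis using that less.hyps ps(3) by blast
    qed
    then show ?thesis using certificate_value[OF assms(1,2) c M ps(1,2)] by blast
  qed
qed

section \<open>Counting pairs of level words that depend on each other\<close>

lemma bipartite_bad_pairs:
  fixes X :: "'a set" and Y :: "'b set"
  assumes "finite X" "finite Y" "card X = m" "card Y = m"
    and "\<And>x. x \<in> X \<Longrightarrow> finite (g x) \<and> card (g x) \<le> K"
    and "\<And>y. y \<in> Y \<Longrightarrow> finite (h y) \<and> card (h y) \<le> K"
    and "\<And>x y. (x, y) \<in> B \<Longrightarrow> x \<in> X \<and> y \<in> Y \<and> (y \<in> g x \<or> x \<in> h y)"
  shows "card B \<le> 2 * K * m"
proof -
  let ?P = "SIGMA x : X. g x" and ?Q = "SIGMA y : Y. h y"
  have sub: "B \<subseteq> ?P \<union> prod.swap ` ?Q" using assms(7) by force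
  have "card ?P \<le> m * K"
    using assms(1,3,5) sum_bounded_above[of X "\<lambda>x. card (g x)" K] by (simp add: card_SigmaI)
  moreover have "card ?Q \<le> m * K"
    using assms(2,4,6) sum_bounded_above[of Y "\<lambda>x. card (h x)" K] by (simp add: card_SigmaI)
  moreover have "finite ?P" "finite ?Q" using assms by auto
  moreover have "card (prod.swap ` ?Q) \<le> card ?Q" using \<open>finite ?Q\<close> by (rule card_image_le)
  moreover have "card (?P \<union> prod.swap ` ?Q) \<le> card ?P + card (prod.swap ` ?Q)" by (rule card_Un_le)
  moreover have "card B \<le> card (?P \<union> prod.swap ` ?Q)"
    using sub \<open>finite ?P\<close> \<open>finite ?Q\<close> by (intro card_mono) auto
  ultimately have "card B \<le> m * K + m * K" by linarith
  then show ?thesis by (simp add: algebra_simps)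
qed

text \<open>At most \<open>2 * K * m\<close> pairs have a partner in the dependency set of the
  other, fewer than the \<open>m * m\<close> pairs there are. The two level words found in this way
  can be used in one oracle.\<close>

lemma bipartite_avoid:
  assumes "finite X" "finite Y" "card X = m" "card Y = m" "2 * K < m"
    and "\<And>x. x \<in> X \<Longrightarrow> finite (g x) \<and> card (g x) \<le> K"
    and "\<And>y. y \<in> Y \<Longrightarrow> finite (h y) \<and> card (h y) \<le> K"
  shows "\<exists>x \<in> X. \<exists>y \<in> Y. y \<notin> g x \<and> x \<notin> h y"
proof (rule ccontr)
  assume "\<not> ?thesis"
  then have "card (X \<times> Y) \<le> 2 * K * m"
    using assms by (intro bipartite_bad_pairs[of X Y m g K h]) auto
  then have "m * m \<le> 2 * K * m" using assms by (simp add: card_cartesian_product)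
  then show False using assms(5) by simp
qed

text \<open>All pairs in \<open>P v \<times> R (\<not> v)\<close> are bad, so there are at most
  \<open>2 * K * m\<close> of them. If \<open>v\<close> is taken by at least half of
  \<open>X\<close>, then \<open>R (\<not> v)\<close> has at most \<open>4 * K\<close> elements; thus
  \<open>v\<close> is also taken by at least half of \<open>Y\<close>, and the same estimate bounds
  \<open>P (\<not> v)\<close>.\<close>

lemma bipartite_majority:
  fixes f0 :: "'a \<Rightarrow> bool" and f1 :: "'a \<Rightarrow> bool"
  assumes "finite X" "finite Y" "card X = m" "card Y = m"
    and "\<And>x. x \<in> X \<Longrightarrow> finite (g x) \<and> card (g x) \<le> K"
    and "\<And>y. y \<in> Y \<Longrightarrow> finite (h y) \<and> card (h y) \<le> K"
    and eq: "\<And>x y. x \<in> X \<Longrightarrow> y \<in> Y \<Longrightarrow> y \<notin> g x \<Longrightarrow> x \<notin> h y \<Longrightarrow> f0 x = f1 y"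
  shows "\<exists>v E. finite E \<and> card E \<le> 16 * K \<and> (\<forall>x \<in> X - E. f0 x = v) \<and> (\<forall>y \<in> Y - E. f1 y = v)"
proof (cases "m \<le> 8 * K")
  case True
  \<comment> \<open>Small sides are declared exceptional as a whole. This case determines the
    constant 16; the other one yields only \<open>8 * K\<close>.\<close>
  then have "card (X \<union> Y) \<le> 16 * K" using card_Un_le[of X Y] assms(3,4) by linarith
  then show ?thesis using assms(1,2) by (intro exI[of _ True] exI[of _ "X \<union> Y"]) auto
next
  case False
  define P R where "P = (\<lambda>v. {x \<in> X. f0 x = v})" and "R = (\<lambda>v. {y \<in> Y. f1 y = v})"
  have fin: "finite (P v)" "finite (R v)" for v using assms(1,2) unfolding P_def R_def by auto
  have PX: "card (P v) + card (P (\<not> v)) = m" for v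
  proof -
    have "P v \<union> P (\<not> v) = X" "P v \<inter> P (\<not> v) = {}" unfolding P_def by auto
    then show ?thesis using card_Un_disjoint[OF fin(1)[of v] fin(1)[of "\<not> v"]] assms(3) by simp
  qed
  have RY: "card (R v) + card (R (\<not> v)) = m" for v
  proof -
    have "R v \<union> R (\<not> v) = Y" "R v \<inter> R (\<not> v) = {}" unfolding R_def by auto
    then show ?thesis using card_Un_disjoint[OF fin(2)[of v] fin(2)[of "\<not> v"]] assms(4) by simp
  qed
  have bad: "card (P v) * card (R (\<not> v)) \<le> 2 * K * m" for v
  proof -
    have "card (P v \<times> R (\<not> v)) \<le> 2 * K * m"
      using assms eq unfolding P_def R_def by (intro bipartite_bad_pairs[of X Y m g K h]) auto
    then show ?thesis by (simp add: card_cartesian_product)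
  qed
  obtain v where v: "m \<le> 2 * card (P v)" using PX[of True] by (metis add_le_cancel_left le_cases mult_2 nat_add_left_cancel_le add.commute)
  have half: "b \<le> 4 * K" if "a * b \<le> 2 * K * m" "m \<le> 2 * a" for a b
  proof -
    have "m * b \<le> (2 * a) * b" using that(2) by (rule mult_right_mono) simp
    also have "\<dots> \<le> (4 * K) * m" using that(1) by simp
    finally have "m * b \<le> m * (4 * K)" by (simp add: mult.commute)
    then show ?thesis using False by simp
  qed
  have r: "card (R (\<not> v)) \<le> 4 * K" using half[OF bad v] .
  then have "m \<le> 2 * card (R v)" using RY[of v] False by linarith
  moreover have "card (R v) * card (P (\<not> v)) \<le> 2 * K * m" using bad[of "\<not> v"] by (simp add: mult.commute)
  ultimately have p: "card (P (\<not> v)) \<le> 4 * K" using half by blast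
  have "card (P (\<not> v) \<union> R (\<not> v)) \<le> 16 * K" using card_Un_le[of "P (\<not> v)" "R (\<not> v)"] r p by linarith
  then show ?thesis
    using fin by (intro exI[of _ v] exI[of _ "P (\<not> v) \<union> R (\<not> v)"]) (auto simp: P_def R_def)
qed

section \<open>Choosing a level large enough\<close>

lemma card_words: "card {v :: word. length v = n} = 2 ^ n" and finite_words: "finite {v :: word. length v = n}"
  using card_lists_length_eq[of "UNIV :: bool set" n] finite_lists_length_eq[of "UNIV :: bool set" n] by simp_all

lemma linear_less_two_power: "\<exists>m \<ge> N. a * m + b < 2 ^ m" for a b N :: nat
proof -
  define j where "j = 2 * a + b + N + 1"
  have j: "j + 1 \<le> 2 ^ j" by (metis Suc_eq_plus1 Suc_leI less_exp)
  have "a * (2 * j) + b < (2 * a + b + 1) * (j + 1)" by (simp add: algebra_simps)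
  also have "\<dots> \<le> (j + 1) * (j + 1)" unfolding j_def by (intro mult_right_mono) auto
  also have "\<dots> \<le> 2 ^ j * 2 ^ j" using j by (intro mult_mono) auto
  finally have "a * (2 * j) + b < 2 ^ (2 * j)" by (simp add: mult_2 power_add)
  then show ?thesis by (intro exI[of _ "2 * j"]) (auto simp: j_def)
qed

lemma bnd_less_two_power: "\<exists>n \<ge> N. bnd K n < 2 ^ n"
proof -
  \<comment> \<open>The level is sought among the powers of two: for \<open>n = 2 ^ m\<close>,
    \<open>bnd K n\<close> is at most \<open>2 ^ (K * m + K)\<close>, which reduces the claim to a
    linear exponent against \<open>2 ^ m\<close>.\<close>
  obtain m where m: "m \<ge> N + 1" "K * m + K < 2 ^ m" using linear_less_two_power by blast
  have le: "2 ^ m + 2 \<le> (2 :: nat) ^ (m + 1)"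
    using m(1) power_increasing[of 1 m "2 :: nat"] by simp
  have "bnd K (2 ^ m) \<le> (2 ^ (m + 1)) ^ K" unfolding bnd_def using le by (intro power_mono) auto
  also have "\<dots> = 2 ^ (K * m + K)" by (simp add: add.commute mult.commute power_mult[symmetric] distrib_right del: power_Suc)
  also have "\<dots> < 2 ^ (2 ^ m)" using m(2) by simp
  finally have "bnd K (2 ^ m) < 2 ^ (2 ^ m)" .
  moreover have "N \<le> 2 ^ m" using m(1) less_exp[of m] by linarith
  ultimately show ?thesis by blast
qed

text \<open>Here \<open>bnd k (Suc n)\<close> is the clock \<open>t\<close> of the reduction and
  \<open>bnd j (bnd k (Suc n))\<close> the clock \<open>s\<close> of the candidate on its output.
  The term \<open>t * t\<close> bounds the words that influence the output, \<open>s * s * s\<close>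
  a twofold closure of the queries of a candidate path, and 16 comes from the majority argument.
  Inputs have length up to \<open>Suc n\<close> because a level word carries a kind bit and
  \<open>n\<close> further bits.\<close>

lemma level_size:
  "\<exists>n \<ge> N. 16 * (bnd k (Suc n) * bnd k (Suc n) +
     bnd j (bnd k (Suc n)) * bnd j (bnd k (Suc n)) * bnd j (bnd k (Suc n))) < 2 ^ n"
proof -
  define J K where "J = (k + 2) * j" and "K = 2 * k + 3 * J"
  obtain s where s: "s \<ge> Suc N" "bnd (6 + K) s < 2 ^ s" using bnd_less_two_power by blast
  then obtain n where n: "s = Suc n" by (cases s) auto
  have "bnd k s * bnd k s = bnd (2 * k) s" by (simp add: bnd_mult mult_2)
  then have 1: "bnd k s * bnd k s \<le> bnd K s" by (simp add: bnd_mono K_def)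
  have "bnd j (bnd k s) \<le> bnd J s" unfolding J_def by (rule bnd_bnd)
  then have "bnd j (bnd k s) * bnd j (bnd k s) * bnd j (bnd k s) \<le> bnd J s * bnd J s * bnd J s"
    by (intro mult_mono) auto
  also have "\<dots> = bnd (3 * J) s" by (simp add: bnd_mult eval_nat_numeral add.assoc)
  also have "\<dots> \<le> bnd K s" by (simp add: bnd_mono K_def)
  finally have 2: "bnd j (bnd k s) * bnd j (bnd k s) * bnd j (bnd k s) \<le> bnd K s" .
  have "(2 :: nat) ^ 6 \<le> bnd 6 s" unfolding bnd_def by (intro power_mono) auto
  \<comment> \<open>The factor is 16, doubled for the two summands and doubled again for passing
    from \<open>2 ^ s\<close> to \<open>2 ^ n\<close>.\<close>
  then have "64 * bnd K s \<le> bnd (6 + K) s" unfolding bnd_mult[symmetric] by (intro mult_right_mono) auto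
  then have "16 * (bnd k s * bnd k s + bnd j (bnd k s) * bnd j (bnd k s) * bnd j (bnd k s)) < 2 ^ n"
    using 1 2 s(2) n by simp
  then show ?thesis using n s(1) by (intro exI[of _ n]) simp
qed

text \<open>In an oracle \<open>A\<close> that violates the constraint under attack,
  \<open>T\<close> may fail to finish in time, so a longest run within the clock takes the place of
  the accepting path. Were it a proper prefix of \<open>ps'\<close>, the next step of
  \<open>ps'\<close> would be possible in \<open>A\<close> as well, since a query pending at the end
  of \<open>ps\<close> is answered alike.\<close>

lemma maximal_run_accepts:
  assumes "wf_otm T" "deterministic T" "computation T A x ps"
    and max: "\<And>ps'. computation T A x ps' \<Longrightarrow> length ps' \<le> t \<Longrightarrow> length ps' \<le> length ps"
    and agr: "\<forall>w \<in> queries T ps. w \<in> A \<longleftrightarrow> w \<in> B"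
    and "ps' \<in> accepting_paths T B x" "length ps' \<le> t"
  shows "ps' = ps"
proof -
  have B: "computation T B x ps" "computation T B x ps'"
    using computation_cong[OF assms(3) agr] assms(6) unfolding accepting_paths_def by auto
  have le: "length ps \<le> length ps'" using accepting_path_maximal[OF assms(1,2,6) B(1)] .
  have nth: "ps ! j = ps' ! j" if "j < length ps" for j
    using deterministic_prefix[OF assms(1,2) B that] that le by simp
  have "length ps = length ps'"
  proof (rule ccontr)
    assume "length ps \<noteq> length ps'"
    with le have l: "length ps < length ps'" by simp
    let ?q = "take (Suc (length ps)) ps'"
    have "computation T A x ?q"
      unfolding computation_def successively_conv_nth
    proof (intro conjI allI impI)
      show "?q \<noteq> []" using l by auto
      show "hd ?q = init_conf T x" using B(2) unfolding computation_def by simp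
      fix i assume i: "Suc i < length ?q"
      then have "step T B (ps' ! i) (ps' ! Suc i)"
        using B(2) unfolding computation_def successively_conv_nth by auto
      then have "step T A (ps' ! i) (ps' ! Suc i)"
      proof (rule step_cong)
        fix w assume w: "state (ps' ! i) = q_query T" "tape_word (tape (ps' ! i) 1) w"
        have "ps' ! i \<in> set ps" using nth[of i] i l by (metis length_take min_less_iff_conj nth_mem Suc_less_eq)
        then show "w \<in> B \<longleftrightarrow> w \<in> A" using agr w unfolding queries_def by blast
      qed
      then show "step T A (?q ! i) (?q ! Suc i)" using i by simp
    qed
    then show False using max[of ?q] l assms(7) by simp
  qed
  then show ?thesis using nth by (intro nth_equalityI) auto
qed

section \<open>Conditions and diagonalization\<close>

lemma cone_append [simp]: "cone d v @ z = cone d (v @ z)"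
  by (simp add: cone_def)

definition admissible :: "(nat \<rightharpoonup> constr) \<Rightarrow> nat \<Rightarrow> lang \<Rightarrow> lang set" where
  "admissible C N F = {A. Sat C A \<and> agree N F A}"

text \<open>A forcing condition: only the part of \<open>F\<close> below \<open>N\<close> is
  committed, the rest of \<open>F\<close> witnesses that the constraints can be met. Indices grow
  with the order of adoption, so \<open>{..<d}\<close> selects the constraints adopted before the
  one at \<open>d\<close>.\<close>

definition condition :: "(nat \<rightharpoonup> constr) \<Rightarrow> nat \<Rightarrow> lang \<Rightarrow> bool" where
  "condition C N F \<longleftrightarrow> dom C \<subseteq> {..<N} \<and> Sat C F \<and>
     (\<forall>d c. C d = Some c \<longrightarrow> (\<forall>A \<in> admissible (C |` {..<d}) N F. \<not> destroyed c A))"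

text \<open>Membership depends on the length of \<open>x\<close> only. This is the language that a
  cone sets against its candidate; a kind bit in \<open>u\<close> turns one cone into a pair of
  languages.\<close>

definition guessed :: "word \<Rightarrow> lang \<Rightarrow> lang" where
  "guessed u A = {x. \<exists>z. length z = length x \<and> u @ z \<in> A}"

text \<open>One input \<open>x\<close> refutes the reduction, and a transducer without output in
  time is refuted at once. A \<open>CPair\<close> is met by its codes alone, so its clause is
  \<open>True\<close> and all constraints can share one family of requirements.\<close>

fun fails :: "otm \<Rightarrow> nat \<Rightarrow> nat \<Rightarrow> constr \<Rightarrow> lang \<Rightarrow> bool" where
  "fails T k d (CPair M1 M2 j) A \<longleftrightarrow> True"
| "fails T k d (CUP M j) A \<longleftrightarrow> (\<exists>x. \<forall>y. outputs T k A x y \<longrightarrow> (x \<in> guessed (cone d []) A) \<noteq> acc M j A y)"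
| "fails T k d (CNP M1 M2 j) A \<longleftrightarrow> (\<exists>x. \<forall>y. outputs T k A x y \<longrightarrow>
     x \<in> guessed (cone d [False]) A \<and> \<not> acc M1 j A y \<or> x \<in> guessed (cone d [True]) A \<and> \<not> acc M2 j A y)"
| "fails T k d (CCo M1 M2 j) A \<longleftrightarrow> (\<exists>x. \<forall>y. outputs T k A x y \<longrightarrow>
     x \<notin> guessed (cone d [False]) A \<and> acc M1 j A y \<or> x \<notin> guessed (cone d [True]) A \<and> acc M2 j A y)"

lemma guessed_agree: "agree (length u + length x + 1) A B \<Longrightarrow> x \<in> guessed u A \<longleftrightarrow> x \<in> guessed u B"
  unfolding guessed_def agree_def by auto

lemma fails_finite:
  assumes "fails T k d c A"
  shows "\<exists>N. \<forall>B. agree N A B \<longrightarrow> fails T k d c B"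
proof -
  have gen: "\<exists>N. \<forall>B. agree N A B \<longrightarrow>
      (\<forall>u. length u \<le> 1 \<longrightarrow> x \<in> guessed (cone d u) A \<longleftrightarrow> x \<in> guessed (cone d u) B) \<and>
      (\<forall>y. outputs T k B x y \<longrightarrow> outputs T k A x y \<and> (\<forall>M. acc M j A y \<longleftrightarrow> acc M j B y))" for x j
  proof (intro exI allI impI conjI)
    fix B
    assume agr: "agree (bnd k (length x) + bnd j (bnd k (length x)) + d + length x + 3) A B"
    show "x \<in> guessed (cone d u) A \<longleftrightarrow> x \<in> guessed (cone d u) B" if "length u \<le> 1" for u
      using that by (intro guessed_agree agree_mono[OF agr]) simp
    fix y assume y: "outputs T k B x y"
    have "agree (bnd k (length x)) A B" by (rule agree_mono[OF agr]) simp
    with y show "outputs T k A x y" using outputs_agree by blast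
    have "bnd j (length y) \<le> bnd j (bnd k (length x))"
      using outputs_length[OF y] by (intro bnd_mono) auto
    then show "acc M j A y \<longleftrightarrow> acc M j B y" for M by (intro acc_agree agree_mono[OF agr]) simp
  qed
  show ?thesis
  proof (cases c)
    case (CPair M1 M2 j)
    then show ?thesis by simp
  next
    case (CUP M j)
    then obtain x where "\<forall>y. outputs T k A x y \<longrightarrow> (x \<in> guessed (cone d []) A) \<noteq> acc M j A y"
      using assms by auto
    note x = this
    obtain N where N: "\<And>B. agree N A B \<Longrightarrow>
      (\<forall>u. length u \<le> 1 \<longrightarrow> x \<in> guessed (cone d u) A \<longleftrightarrow> x \<in> guessed (cone d u) B) \<and>
      (\<forall>y. outputs T k B x y \<longrightarrow> outputs T k A x y \<and> (\<forall>M. acc M j A y \<longleftrightarrow> acc M j B y))"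
      using gen[of x j] by blast
    show ?thesis unfolding CUP fails.simps
    proof (intro exI[of _ N] allI impI exI[of _ x])
      fix B y assume "agree N A B" "outputs T k B x y"
      then show "(x \<in> guessed (cone d []) B) \<noteq> acc M j B y"
        using N[of B] x by auto
    qed
  next
    case (CNP M1 M2 j)
    then obtain x where x: "\<forall>y. outputs T k A x y \<longrightarrow> x \<in> guessed (cone d [False]) A \<and> \<not> acc M1 j A y \<or>
        x \<in> guessed (cone d [True]) A \<and> \<not> acc M2 j A y"
      using assms by auto
    obtain N where N: "\<And>B. agree N A B \<Longrightarrow>
      (\<forall>u. length u \<le> 1 \<longrightarrow> x \<in> guessed (cone d u) A \<longleftrightarrow> x \<in> guessed (cone d u) B) \<and>
      (\<forall>y. outputs T k B x y \<longrightarrow> outputs T k A x y \<and> (\<forall>M. acc M j A y \<longleftrightarrow> acc M j B y))"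
      using gen[of x j] by blast
    show ?thesis unfolding CNP fails.simps
    proof (intro exI[of _ N] allI impI exI[of _ x])
      fix B y assume "agree N A B" "outputs T k B x y"
      then show "x \<in> guessed (cone d [False]) B \<and> \<not> acc M1 j B y \<or>
        x \<in> guessed (cone d [True]) B \<and> \<not> acc M2 j B y"
        using N[of B] x by auto
    qed
  next
    case (CCo M1 M2 j)
    then obtain x where x: "\<forall>y. outputs T k A x y \<longrightarrow> x \<notin> guessed (cone d [False]) A \<and> acc M1 j A y \<or>
        x \<notin> guessed (cone d [True]) A \<and> acc M2 j A y"
      using assms by auto
    obtain N where N: "\<And>B. agree N A B \<Longrightarrow>
      (\<forall>u. length u \<le> 1 \<longrightarrow> x \<in> guessed (cone d u) A \<longleftrightarrow> x \<in> guessed (cone d u) B) \<and>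
      (\<forall>y. outputs T k B x y \<longrightarrow> outputs T k A x y \<and> (\<forall>M. acc M j A y \<longleftrightarrow> acc M j B y))"
      using gen[of x j] by blast
    show ?thesis unfolding CCo fails.simps
    proof (intro exI[of _ N] allI impI exI[of _ x])
      fix B y assume "agree N A B" "outputs T k B x y"
      then show "x \<notin> guessed (cone d [False]) B \<and> acc M1 j B y \<or>
        x \<notin> guessed (cone d [True]) B \<and> acc M2 j B y"
        using N[of B] x by auto
    qed
  qed
qed

lemma is_code_restrict: "is_code (C |` D) w M1 M2 k x \<Longrightarrow> is_code C w M1 M2 k x"
  unfolding is_code_def restrict_map_def by (auto split: if_splits)

lemma Sat_restrict: "Sat C A \<Longrightarrow> Sat (C |` D) A"
  unfolding Sat_def codes_ok_def by (metis is_code_restrict option.distinct(1) restrict_map_def)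

lemma admissible_restrict: "A \<in> admissible C N F \<Longrightarrow> A \<in> admissible (C |` D) N F"
  unfolding admissible_def using Sat_restrict by blast

text \<open>A pair at index \<open>e < d\<close> is protected over oracles respecting the indices
  below \<open>e\<close>; restricting the constraints on \<open>A\<close> from \<open>d\<close> down
  to \<open>e\<close> makes it one of these.\<close>

lemma condition_good:
  assumes "condition C N F" "A \<in> admissible (C |` {..<d}) N F"
  shows "good (C |` {..<d}) A"
  unfolding good_def
proof (intro conjI allI impI)
  show "codes_ok (C |` {..<d}) A" using assms(2) unfolding admissible_def Sat_def by blast
  fix e M1 M2 k x assume "(C |` {..<d}) e = Some (CPair M1 M2 k)"
  then have e: "e < d" "C e = Some (CPair M1 M2 k)" by (auto simp: restrict_map_def split: if_splits)
  then have "{..<d} \<inter> {..<e} = {..<e}" by auto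
  then have "A \<in> admissible (C |` {..<e}) N F" using admissible_restrict[OF assms(2), of "{..<e}"] by simp
  then have "\<not> destroyed (CPair M1 M2 k) A" using assms(1) e(2) unfolding condition_def by blast
  then show "acc M1 k A x \<noteq> acc M2 k A x" by auto
qed

lemma condition_good':
  assumes "condition C N F" "A \<in> admissible C N F"
  shows "good C A"
proof -
  have "C |` {..<N} = C"
  proof
    fix e
    have "e < N" if "C e \<noteq> None" using assms(1) that unfolding condition_def by blast
    then show "(C |` {..<N}) e = C e" by (cases "C e") (auto simp: restrict_map_def)
  qed
  then show ?thesis using condition_good[OF assms(1), of A N] assms(2) by simp
qed

section \<open>Varying one level of the cone\<close>

locale diagonalization =
  fixes C :: "nat \<rightharpoonup> constr" and N :: nat and F :: lang and d :: nat and c :: constr and n :: nat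
  assumes cond: "condition C N F" and Cd: "C d = Some c" and nopair: "\<And>M1 M2 k. c \<noteq> CPair M1 M2 k"
    and Nn: "N \<le> n"
begin

definition X :: "bool \<Rightarrow> lang" where "X b = (\<lambda>v. cone d (b # v)) ` {v. length v = n}"

abbreviation level :: lang where "level \<equiv> X False \<union> X True"

definition C0 :: "nat \<rightharpoonup> constr" where "C0 = C |` {..<d}"

text \<open>Exchanging the level may change code words of constraints before and after
  \<open>d\<close>. They are all recomputed, so only free words are under direct control, and the
  influence of \<open>Z\<close> has to be traced through closures.\<close>

definition OZ :: "lang \<Rightarrow> lang" where "OZ Z = Phi C ((F - level) \<union> Z)"

lemma finite_X: "finite (X b)" unfolding X_def by (simp add: finite_words)

lemma card_X: "card (X b) = 2 ^ n"
  unfolding X_def by (subst card_image) (auto simp: card_words inj_on_def)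

lemma X_disjoint: "z \<in> X b \<Longrightarrow> z \<notin> X (\<not> b)"
  unfolding X_def by auto

lemma cone_in_X: "cone e v \<in> level \<longleftrightarrow> e = d \<and> length v = Suc n"
  unfolding X_def by (cases v) (auto simp: image_iff)

lemma X_length: "z \<in> X b \<Longrightarrow> \<not> length z < N"
  unfolding X_def using Nn by auto

lemma cone_d_not_coded: "\<not> coded C (cone d v)"
  using cone_not_coded[of C d v] Cd nopair by auto

lemma F_Sat: "Sat C F" using cond unfolding condition_def by blast

lemma OZ_free: "\<not> coded C w \<Longrightarrow> w \<in> OZ Z \<longleftrightarrow> w \<in> F - level \<union> Z"
  unfolding OZ_def by (rule Phi_free)

lemma OZ_admissible:
  assumes Z: "Z \<subseteq> level" and "fsat d c ((F - level) \<union> Z)"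
  shows "OZ Z \<in> admissible C N F"
proof -
  have "fsat e c' (OZ Z)" if e: "C e = Some c'" for e c'
  proof (cases "e = d")
    case True
    then have "c' = c" using Cd e by simp
    show ?thesis
    proof (rule fsat_cong[of C e c' "(F - level) \<union> Z"])
      show "C e = Some c'" by (rule e)
      show "fsat e c' ((F - level) \<union> Z)" using assms(2) True \<open>c' = c\<close> by simp
      show "cone e v \<in> (F - level) \<union> Z \<longleftrightarrow> cone e v \<in> OZ Z" if "\<not> coded C (cone e v)" for v
        using OZ_free[OF that] by blast
    qed
  next
    case False
    have "fsat e c' F" using F_Sat e unfolding Sat_def by blast
    moreover have "cone e v \<in> F \<longleftrightarrow> cone e v \<in> OZ Z" if "\<not> coded C (cone e v)" for v
      using OZ_free[OF that] cone_in_X[of e v] False Z by blast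
    ultimately show ?thesis using fsat_cong[of C e c' F "OZ Z"] e by blast
  qed
  moreover have "codes_ok C (OZ Z)" unfolding OZ_def by (rule codes_ok_Phi)
  moreover have "agree N F (OZ Z)"
    unfolding OZ_def
  proof (rule Phi_agree)
    show "codes_ok C F" using F_Sat unfolding Sat_def by blast
    show "w \<in> F \<longleftrightarrow> w \<in> F - level \<union> Z" if "length w < N" for w
      using that X_length Z by blast
  qed
  ultimately show ?thesis unfolding admissible_def Sat_def by blast
qed

lemma OZ_agree:
  assumes "OZ Z \<in> admissible C N F" "OZ Z' \<in> admissible C N F" "closed_under C (OZ Z) S"
    and "\<And>w. w \<in> S \<Longrightarrow> w \<in> Z \<longleftrightarrow> w \<in> Z'" "w \<in> S"
  shows "w \<in> OZ Z \<longleftrightarrow> w \<in> OZ Z'"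
proof (rule closed_under_agree[OF _ _ assms(3) _ assms(5)])
  show "good C (OZ Z)" "good C (OZ Z')" using assms condition_good'[OF cond] by auto
  show "w \<in> OZ Z \<longleftrightarrow> w \<in> OZ Z'" if "w \<in> S" "\<not> coded C w" for w
    using OZ_free[OF that(2)] assms(4)[OF that(1)] by blast
qed

lemma coded_C0_cone: "e < d \<Longrightarrow> coded C (cone e v) \<Longrightarrow> coded C0 (cone e v)"
  unfolding coded_def C0_def is_code_def code_word_def restrict_map_def by fastforce

text \<open>From length \<open>N\<close> on, \<open>G\<close> is unrestricted on cones with index at
  least \<open>d\<close>. This is the freedom used to break the shape of cone \<open>d\<close> and
  to prescribe the codes of later constraints.\<close>

lemma Phi_C0_admissible:
  assumes "\<And>w. length w < N \<Longrightarrow> w \<in> G \<longleftrightarrow> w \<in> F"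
    and "\<And>e v. e < d \<Longrightarrow> \<not> coded C (cone e v) \<Longrightarrow> cone e v \<in> G \<longleftrightarrow> cone e v \<in> F"
  shows "Phi C0 G \<in> admissible C0 N F"
proof -
  have S0: "Sat C0 F" unfolding C0_def by (rule Sat_restrict[OF F_Sat])
  have "fsat e c' (Phi C0 G)" if e: "C0 e = Some c'" for e c'
  proof (rule fsat_cong[of C0 e c' F])
    show "C0 e = Some c'" by (rule e)
    show "fsat e c' F" using S0 e unfolding Sat_def by blast
    have "e < d" using e unfolding C0_def by (auto simp: restrict_map_def split: if_splits)
    then show "cone e v \<in> F \<longleftrightarrow> cone e v \<in> Phi C0 G" if "\<not> coded C0 (cone e v)" for v
      using Phi_free[OF that, of G] assms(2)[of e v] coded_C0_cone[of e v] that by blast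
  qed
  moreover have "agree N F (Phi C0 G)"
    using S0 assms(1) unfolding Sat_def by (intro Phi_agree) auto
  ultimately show ?thesis unfolding admissible_def Sat_def using codes_ok_Phi by blast
qed

lemma good_C0: "A \<in> admissible C0 N F \<Longrightarrow> good C0 A"
  unfolding C0_def by (rule condition_good[OF cond])

lemma admissible_C0: "A \<in> admissible C N F \<Longrightarrow> A \<in> admissible C0 N F"
  unfolding C0_def by (rule admissible_restrict)

lemma admissible_agree: "A \<in> admissible C N F \<Longrightarrow> length w < N \<Longrightarrow> w \<in> A \<longleftrightarrow> w \<in> F"
  unfolding admissible_def agree_def by blast

text \<open>The two prescriptions do not conflict: on a word common to \<open>S1\<close> and
  \<open>S2\<close>, both \<open>OZ {z1}\<close> and \<open>OZ {z2}\<close> agree with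
  \<open>OZ {}\<close>. Free words in cones below \<open>d\<close> are the same in all three
  oracles. Codes of later constraints are free for \<open>C0\<close> and hence copied like other
  free words, so closure under \<open>C0\<close> suffices to carry \<open>S1\<close> and
  \<open>S2\<close> over.\<close>

lemma amalgamate:
  assumes V: "OZ {} \<in> admissible C N F" "OZ {z1} \<in> admissible C N F" "OZ {z2} \<in> admissible C N F"
    and z: "z1 \<in> X False" "z2 \<in> X True"
    and cl: "closed_under C0 (OZ {z1}) S1" "closed_under C0 (OZ {z2}) S2"
    and e1: "\<And>q. q \<in> S1 \<Longrightarrow> q \<in> OZ {z2} \<longleftrightarrow> q \<in> OZ {}"
    and e2: "\<And>q. q \<in> S2 \<Longrightarrow> q \<in> OZ {z1} \<longleftrightarrow> q \<in> OZ {}"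
  shows "\<exists>A \<in> admissible C0 N F. (\<forall>q \<in> S1. q \<in> A \<longleftrightarrow> q \<in> OZ {z1}) \<and> (\<forall>q \<in> S2. q \<in> A \<longleftrightarrow> q \<in> OZ {z2})"
proof -
  define G where "G = {q. if q \<in> S1 then q \<in> OZ {z1} else if q \<in> S2 then q \<in> OZ {z2} else q \<in> OZ {}}"
  have A: "Phi C0 G \<in> admissible C0 N F"
  proof (rule Phi_C0_admissible)
    show "w \<in> G \<longleftrightarrow> w \<in> F" if "length w < N" for w
      using that admissible_agree[OF V(1)] admissible_agree[OF V(2)] admissible_agree[OF V(3)] unfolding G_def by simp
    show "cone e v \<in> G \<longleftrightarrow> cone e v \<in> F" if "e < d" "\<not> coded C (cone e v)" for e v
    proof -
      have "cone e v \<notin> level" using cone_in_X[of e v] that(1) by simp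
      then have "cone e v \<in> OZ Z \<longleftrightarrow> cone e v \<in> F" if "Z \<subseteq> level" for Z
        using OZ_free[OF \<open>\<not> coded C (cone e v)\<close>] that by blast
      then show ?thesis using z unfolding G_def by simp
    qed
  qed
  have "q \<in> OZ {z1} \<longleftrightarrow> q \<in> Phi C0 G" if "q \<in> S1" for q
  proof (rule closed_under_agree[OF _ _ cl(1) _ that])
    show "good C0 (OZ {z1})" "good C0 (Phi C0 G)" using good_C0 admissible_C0 V(2) A by auto
    show "w \<in> OZ {z1} \<longleftrightarrow> w \<in> Phi C0 G" if "w \<in> S1" "\<not> coded C0 w" for w
      using Phi_free[OF that(2), of G] that(1) unfolding G_def by simp
  qed
  moreover have "q \<in> OZ {z2} \<longleftrightarrow> q \<in> Phi C0 G" if "q \<in> S2" for q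
  proof (rule closed_under_agree[OF _ _ cl(2) _ that])
    show "good C0 (OZ {z2})" "good C0 (Phi C0 G)" using good_C0 admissible_C0 V(3) A by auto
    show "w \<in> OZ {z2} \<longleftrightarrow> w \<in> Phi C0 G" if "w \<in> S2" "\<not> coded C0 w" for w
      using Phi_free[OF that(2), of G] that(1) e1 e2 unfolding G_def by auto
  qed
  ultimately show ?thesis using A by blast
qed

text \<open>The two closures serve different ends. \<open>S\<close> unfolds the queries under
  \<open>C0\<close> in \<open>OZ {z}\<close>, as \<open>amalgamate\<close> requires.
  \<open>D\<close> unfolds \<open>S\<close> under the whole of \<open>C\<close> in
  \<open>OZ {}\<close>: a level word outside \<open>D\<close>, put on the empty level, changes no
  value on \<open>S\<close>, not even that of a later code. Starting from at most \<open>t\<close>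
  queries, each unfolding multiplies the size by \<open>t\<close>.\<close>

lemma certificate_closures:
  assumes V: "OZ {} \<in> admissible C N F" "OZ {z} \<in> admissible C N F" and "acc M j (OZ {z}) y"
  defines "t \<equiv> bnd j (length y)"
  shows "\<exists>ps S D. ps \<in> accepting_paths M (OZ {z}) y \<and> length ps \<le> t \<and> queries M ps \<subseteq> S \<and>
    closed_under C0 (OZ {z}) S \<and> S \<subseteq> D \<and> closed_under C (OZ {}) D \<and> finite D \<and> card D \<le> t * t * t"
proof -
  obtain ps where ps: "ps \<in> accepting_paths M (OZ {z}) y" "length ps \<le> t"
    using assms(3) unfolding acc_def t_def by blast
  have ql: "length q < t" if "q \<in> queries M ps" for q
    using that queries_length[of M "OZ {z}" y ps q] ps unfolding accepting_paths_def by simp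
  have "card (queries M ps) \<le> t" using card_queries[of M ps] ps(2) by linarith
  from closure_of_set[OF good_C0[OF admissible_C0[OF V(2)]] finite_queries this ql]
  obtain S where S: "queries M ps \<subseteq> S" "finite S" "card S \<le> t * t" "closed_under C0 (OZ {z}) S"
      "\<forall>q \<in> S. length q < t" by blast
  have "length q < t" if "q \<in> S" for q using S(5) that by blast
  from closure_of_set[OF condition_good'[OF cond V(1)] S(2,3) this]
  obtain D where "S \<subseteq> D" "finite D" "card D \<le> t * t * t" "closed_under C (OZ {}) D" by blast
  then show ?thesis using ps S by blast
qed

text \<open>Two level words are chosen, neither in the set \<open>D\<close> of the other, and their
  paths are combined by \<open>amalgamate\<close>. The last clause is there for unambiguity: if both
  paths coincide, their queries lie in both closures, where \<open>OZ {z1}\<close> agrees with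
  \<open>OZ {}\<close>, so the path accepts already with the empty level.\<close>

lemma double_acceptance:
  fixes M :: "bool \<Rightarrow> otm"
  assumes V: "OZ {} \<in> admissible C N F" "\<And>b z. z \<in> X b \<Longrightarrow> OZ {z} \<in> admissible C N F"
    and acc: "\<And>b z. z \<in> X b \<Longrightarrow> z \<notin> W \<Longrightarrow> acc (M b) j (OZ {z}) y"
    and W: "finite W" "card W \<le> s"
    and t: "t = bnd j (length y)" "2 * (s + t * t * t) < 2 ^ n"
  shows "\<exists>A \<in> admissible C0 N F. \<exists>ps1 ps2. ps1 \<in> accepting_paths (M False) A y \<and> ps2 \<in> accepting_paths (M True) A y \<and>
     length ps1 \<le> t \<and> length ps2 \<le> t \<and> (M False = M True \<longrightarrow> ps1 = ps2 \<longrightarrow> acc (M False) j (OZ {}) y)"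
proof -
  have "\<forall>b. \<forall>z \<in> X b - W. \<exists>ps S D. ps \<in> accepting_paths (M b) (OZ {z}) y \<and> length ps \<le> t \<and>
    queries (M b) ps \<subseteq> S \<and> closed_under C0 (OZ {z}) S \<and> S \<subseteq> D \<and> closed_under C (OZ {}) D \<and>
    finite D \<and> card D \<le> t * t * t"
    using certificate_closures[OF V(1) V(2)] acc unfolding t(1) by blast
  then obtain ps S D where *: "\<And>b z. z \<in> X b - W \<Longrightarrow> ps b z \<in> accepting_paths (M b) (OZ {z}) y \<and>
    length (ps b z) \<le> t \<and> queries (M b) (ps b z) \<subseteq> S b z \<and> closed_under C0 (OZ {z}) (S b z) \<and>
    S b z \<subseteq> D b z \<and> closed_under C (OZ {}) (D b z) \<and> finite (D b z) \<and> card (D b z) \<le> t * t * t"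
    by metis
  \<comment> \<open>With \<open>W\<close> in every dependency set, the two chosen words
    automatically lie outside \<open>W\<close>.\<close>
  define g where "g = (\<lambda>b z. W \<union> (if z \<in> W then {} else D b z))"
  have g: "finite (g b z) \<and> card (g b z) \<le> s + t * t * t" if "z \<in> X b" for b z
  proof (cases "z \<in> W")
    case True
    then show ?thesis using W unfolding g_def by simp
  next
    case False
    then have "finite (D b z)" "card (D b z) \<le> t * t * t" using *[of z b] that by auto
    then show ?thesis using W False card_Un_le[of W "D b z"] unfolding g_def by simp
  qed
  obtain z1 z2 where z: "z1 \<in> X False" "z2 \<in> X True" "z2 \<notin> g False z1" "z1 \<notin> g True z2"
    using bipartite_avoid[OF finite_X finite_X card_X card_X t(2), of False "g False" True "g True"] g by blast
  have z1: "z1 \<in> X False - W" and z2: "z2 \<in> X True - W"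
    and d: "z2 \<notin> D False z1" "z1 \<notin> D True z2"
    using z unfolding g_def by (auto split: if_splits)
  note c1 = *[OF z1] and c2 = *[OF z2]
  have e1: "q \<in> OZ {z2} \<longleftrightarrow> q \<in> OZ {}" if "q \<in> S False z1" for q
    using OZ_agree[OF V(1) V(2)[OF z(2)], of "D False z1" q] c1 d(1) that by blast
  have e2: "q \<in> OZ {z1} \<longleftrightarrow> q \<in> OZ {}" if "q \<in> S True z2" for q
    using OZ_agree[OF V(1) V(2)[OF z(1)], of "D True z2" q] c2 d(2) that by blast
  obtain A where A: "A \<in> admissible C0 N F" "\<forall>q \<in> S False z1. q \<in> A \<longleftrightarrow> q \<in> OZ {z1}"
     "\<forall>q \<in> S True z2. q \<in> A \<longleftrightarrow> q \<in> OZ {z2}"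
    using amalgamate[OF V(1) V(2)[OF z(1)] V(2)[OF z(2)] z(1,2) _ _ e1 e2] c1 c2 by blast
  have "ps False z1 \<in> accepting_paths (M False) A y" "ps True z2 \<in> accepting_paths (M True) A y"
    using accepting_paths_cong[of "ps False z1" "M False" "OZ {z1}" y A]
      accepting_paths_cong[of "ps True z2" "M True" "OZ {z2}" y A] c1 c2 A by blast+
  moreover have "acc (M False) j (OZ {}) y" if "M False = M True" "ps False z1 = ps True z2"
  proof -
    have "queries (M False) (ps False z1) \<subseteq> S True z2" using c2 that by simp
    then have "ps False z1 \<in> accepting_paths (M False) (OZ {}) y"
      using accepting_paths_cong[of "ps False z1" "M False" "OZ {z1}" y "OZ {}"] c1 e2 by blast
    then show ?thesis unfolding acc_def using c1 t(1) by blast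
  qed
  ultimately show ?thesis using A(1) c1 c2 by blast
qed

lemma not_destroyed: "A \<in> admissible C0 N F \<Longrightarrow> \<not> destroyed c A"
  using cond Cd unfolding condition_def C0_def by blast

lemma fsat_F: "fsat d c F" using F_Sat Cd unfolding Sat_def by blast

lemma sparse_replace_level:
  assumes "\<forall>v v'. length v = length v' \<longrightarrow> cone d v \<in> F \<longrightarrow> cone d v' \<in> F \<longrightarrow> v = v'"
    and "Z \<subseteq> level" "\<And>z z'. z \<in> Z \<Longrightarrow> z' \<in> Z \<Longrightarrow> z = z'"
  shows "\<forall>v v'. length v = length v' \<longrightarrow> cone d v \<in> F - level \<union> Z \<longrightarrow>
    cone d v' \<in> F - level \<union> Z \<longrightarrow> v = v'"
proof (intro allI impI)
  fix v v' :: word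
  assume l: "length v = length v'" and v: "cone d v \<in> F - level \<union> Z"
    "cone d v' \<in> F - level \<union> Z"
  show "v = v'"
  proof (cases "length v = Suc n")
    case True
    then have "cone d v \<in> Z" "cone d v' \<in> Z" using l v cone_in_X by auto
    then show ?thesis using assms(3) cone_inj by blast
  next
    case False
    then have "cone d v \<notin> Z" "cone d v' \<notin> Z"
      using l cone_in_X[of d v] cone_in_X[of d v'] assms(2) by auto
    then have "cone d v \<in> F" "cone d v' \<in> F" using v by auto
    then show ?thesis using assms(1) l by blast
  qed
qed

lemma sparse_OZ_admissible:
  assumes "(\<exists>M j. c = CUP M j) \<or> (\<exists>M1 M2 j. c = CNP M1 M2 j)"
  shows "OZ {} \<in> admissible C N F" "z \<in> X b \<Longrightarrow> OZ {z} \<in> admissible C N F"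
proof -
  have *: "OZ Z \<in> admissible C N F" if "Z \<subseteq> level" "\<And>z z'. z \<in> Z \<Longrightarrow> z' \<in> Z \<Longrightarrow> z = z'" for Z
  proof (rule OZ_admissible[OF that(1)])
    have iff: "fsat d c A \<longleftrightarrow> (\<forall>v v'. length v = length v' \<longrightarrow> cone d v \<in> A \<longrightarrow> cone d v' \<in> A \<longrightarrow> v = v')"
      for A using assms by auto
    show "fsat d c (F - level \<union> Z)"
      unfolding iff by (rule sparse_replace_level[OF fsat_F[unfolded iff] that])
  qed
  show "OZ {} \<in> admissible C N F" by (rule *) auto
  show "OZ {z} \<in> admissible C N F" if "z \<in> X b" using that by (intro *) (cases b; auto)+
qed

lemma outputs_stable:
  assumes V: "OZ {} \<in> admissible C N F" and out: "outputs T k (OZ {}) x y"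
  defines "t \<equiv> bnd k (length x)"
  shows "\<exists>W. finite W \<and> card W \<le> t * t \<and>
    (\<forall>z. z \<notin> W \<longrightarrow> OZ {z} \<in> admissible C N F \<longrightarrow> outputs T k (OZ {z}) x y)"
proof -
  obtain ps where ps: "ps \<in> accepting_paths T (OZ {}) x" "length ps \<le> t" "tape_word (tape (last ps) 2) y"
    using out unfolding outputs_def t_def by blast
  have ql: "length q < t" if "q \<in> queries T ps" for q
    using that queries_length[of T "OZ {}" x ps q] ps unfolding accepting_paths_def by simp
  have "card (queries T ps) \<le> t" using card_queries[of T ps] ps(2) by linarith
  from closure_of_set[OF condition_good'[OF cond V] finite_queries this ql]
  obtain W where W: "queries T ps \<subseteq> W" "finite W" "card W \<le> t * t" "closed_under C (OZ {}) W" by blast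
  have "outputs T k (OZ {z}) x y" if z: "z \<notin> W" "OZ {z} \<in> admissible C N F" for z
  proof -
    have "q \<in> OZ {} \<longleftrightarrow> q \<in> OZ {z}" if "q \<in> W" for q
      using OZ_agree[OF V z(2) W(4) _ that] z(1) by blast
    then have "ps \<in> accepting_paths T (OZ {z}) x"
      using accepting_paths_cong[OF ps(1)] W(1) by blast
    then show ?thesis unfolding outputs_def using ps t_def by blast
  qed
  then show ?thesis using W by blast
qed

lemma guessed_OZ: "length v = Suc n \<Longrightarrow> cone d v \<in> OZ Z \<longleftrightarrow> cone d v \<in> Z"
  using OZ_free[OF cone_d_not_coded, of v Z] cone_in_X[of d v] by auto

lemma size_bound:
  assumes "length x \<le> Suc n" "outputs T k A x y"
    and size: "16 * (bnd k (Suc n) * bnd k (Suc n) +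
     bnd j (bnd k (Suc n)) * bnd j (bnd k (Suc n)) * bnd j (bnd k (Suc n))) < 2 ^ n"
  shows "16 * (bnd k (length x) * bnd k (length x) +
     bnd j (length y) * bnd j (length y) * bnd j (length y)) < 2 ^ n"
proof -
  have 1: "bnd k (length x) \<le> bnd k (Suc n)" using assms(1) by (intro bnd_mono) auto
  then have "length y \<le> bnd k (Suc n)" using outputs_length[OF assms(2)] by linarith
  then have 2: "bnd j (length y) \<le> bnd j (bnd k (Suc n))" by (intro bnd_mono) auto
  have "bnd k (length x) * bnd k (length x) \<le> bnd k (Suc n) * bnd k (Suc n)"
    using 1 by (intro mult_mono) auto
  moreover have "bnd j (length y) * bnd j (length y) * bnd j (length y) \<le>
      bnd j (bnd k (Suc n)) * bnd j (bnd k (Suc n)) * bnd j (bnd k (Suc n))"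
    using 2 by (intro mult_mono) auto
  ultimately have "16 * (bnd k (length x) * bnd k (length x) +
     bnd j (length y) * bnd j (length y) * bnd j (length y)) \<le> 16 * (bnd k (Suc n) * bnd k (Suc n) +
     bnd j (bnd k (Suc n)) * bnd j (bnd k (Suc n)) * bnd j (bnd k (Suc n)))"
    by (intro mult_left_mono add_mono) auto
  then show ?thesis using size by (rule le_less_trans)
qed

text \<open>A working reduction forces rejection of \<open>y\<close> when the level is empty, and
  acceptance of the same \<open>y\<close> for almost every single level word. Two such words yield
  two accepting paths in one oracle, and these are distinct because a common path would accept with
  the empty level.\<close>

lemma diagonalize_CUP:
  assumes c: "c = CUP M j" and T: "wf_otm T" "deterministic T"
    and size: "16 * (bnd k (Suc n) * bnd k (Suc n) +
     bnd j (bnd k (Suc n)) * bnd j (bnd k (Suc n)) * bnd j (bnd k (Suc n))) < 2 ^ n"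
  shows "\<exists>A \<in> admissible C N F. fails T k d c A"
proof (rule ccontr)
  assume "\<not> ?thesis"
  then have nf: "\<exists>y. outputs T k A x y \<and> ((x \<in> guessed (cone d []) A) \<longleftrightarrow> acc M j A y)" if "A \<in> admissible C N F" for A x
    using that unfolding c by auto
  \<comment> \<open>The guessed part includes the kind bit, hence length \<open>n + 1\<close>. For
    \<open>CUP\<close> the kinds merely split the level into the two sides of the bipartite
    count.\<close>
  define x where "x = replicate (Suc n) False"
  note V = sparse_OZ_admissible[OF disjI1, OF exI, OF exI, OF c]
  obtain y where y: "outputs T k (OZ {}) x y" "x \<in> guessed (cone d []) (OZ {}) \<longleftrightarrow> acc M j (OZ {}) y"
    using nf[OF V(1)] by blast
  have "x \<notin> guessed (cone d []) (OZ {})"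
    unfolding guessed_def x_def using guessed_OZ by auto
  with y have na: "\<not> acc M j (OZ {}) y" by blast
  obtain W where W: "finite W" "card W \<le> bnd k (length x) * bnd k (length x)"
    "\<And>z. z \<notin> W \<Longrightarrow> OZ {z} \<in> admissible C N F \<Longrightarrow> outputs T k (OZ {z}) x y"
    using outputs_stable[OF V(1) y(1)] by blast
  have ac: "acc M j (OZ {z}) y" if z: "z \<in> X b" "z \<notin> W" for b z
  proof -
    obtain y' where y': "outputs T k (OZ {z}) x y'" "x \<in> guessed (cone d []) (OZ {z}) \<longleftrightarrow> acc M j (OZ {z}) y'"
      using nf[OF V(2)[OF z(1)]] by blast
    have "y' = y" using outputs_unique[OF T y'(1) W(3)[OF z(2) V(2)[OF z(1)]]] .
    moreover obtain v where "z = cone d (b # v)" "length v = n" using z(1) unfolding X_def by blast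
    then have "x \<in> guessed (cone d []) (OZ {z})"
      unfolding guessed_def x_def using guessed_OZ[of "b # v" "{z}"] by (auto intro!: exI[of _ "b # v"])
    ultimately show ?thesis using y'(2) by blast
  qed
  have sz: "2 * (bnd k (length x) * bnd k (length x) + bnd j (length y) * bnd j (length y) * bnd j (length y)) < 2 ^ n"
    using size_bound[OF _ y(1) size] unfolding x_def by simp
  have "\<exists>A \<in> admissible C0 N F. \<exists>ps1 ps2. ps1 \<in> accepting_paths M A y \<and> ps2 \<in> accepting_paths M A y \<and>
      length ps1 \<le> bnd j (length y) \<and> length ps2 \<le> bnd j (length y) \<and>
      (M = M \<longrightarrow> ps1 = ps2 \<longrightarrow> acc M j (OZ {}) y)"
    by (rule double_acceptance[of W "\<lambda>_. M" j y, OF V(1) _ _ W(1,2) refl sz]) (use V(2) ac in blast)+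
  then obtain A ps1 ps2 where A: "A \<in> admissible C0 N F" "ps1 \<in> accepting_paths M A y" "ps2 \<in> accepting_paths M A y"
    "length ps1 \<le> bnd j (length y)" "length ps2 \<le> bnd j (length y)" "ps1 = ps2 \<longrightarrow> acc M j (OZ {}) y"
    by blast
  then have "destroyed c A" using na unfolding c destroyed.simps by blast
  then show False using not_destroyed[OF A(1)] by blast
qed

text \<open>A level word of kind \<open>b\<close> puts \<open>x\<close> on side \<open>b\<close> of
  the pair, so the combined oracle has a path of \<open>M1\<close> and a path of \<open>M2\<close>
  on the same \<open>y\<close>. The empty level supplies the common background and fixes
  \<open>y\<close>.\<close>

lemma diagonalize_CNP:
  assumes c: "c = CNP M1 M2 j" and T: "wf_otm T" "deterministic T"
    and size: "16 * (bnd k (Suc n) * bnd k (Suc n) +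
     bnd j (bnd k (Suc n)) * bnd j (bnd k (Suc n)) * bnd j (bnd k (Suc n))) < 2 ^ n"
  shows "\<exists>A \<in> admissible C N F. fails T k d c A"
proof (rule ccontr)
  assume "\<not> ?thesis"
  then have nf: "\<exists>y. outputs T k A x y \<and> (x \<in> guessed (cone d [False]) A \<longrightarrow> acc M1 j A y) \<and>
      (x \<in> guessed (cone d [True]) A \<longrightarrow> acc M2 j A y)" if "A \<in> admissible C N F" for A x
    using that unfolding c by auto
  define x where "x = replicate n False"
  define M where "M = (\<lambda>b. if b then M2 else M1)"
  note V = sparse_OZ_admissible[OF disjI2, OF exI, OF exI, OF exI, OF c]
  obtain y where y: "outputs T k (OZ {}) x y"
    using nf[OF V(1)] by blast
  obtain W where W: "finite W" "card W \<le> bnd k (length x) * bnd k (length x)"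
    "\<And>z. z \<notin> W \<Longrightarrow> OZ {z} \<in> admissible C N F \<Longrightarrow> outputs T k (OZ {z}) x y"
    using outputs_stable[OF V(1) y(1)] by blast
  have ac: "acc (M b) j (OZ {z}) y" if z: "z \<in> X b" "z \<notin> W" for b z
  proof -
    obtain y' where y': "outputs T k (OZ {z}) x y'" "x \<in> guessed (cone d [False]) (OZ {z}) \<longrightarrow> acc M1 j (OZ {z}) y'"
      "x \<in> guessed (cone d [True]) (OZ {z}) \<longrightarrow> acc M2 j (OZ {z}) y'"
      using nf[OF V(2)[OF z(1)], of x] by blast
    have "y' = y" using outputs_unique[OF T y'(1) W(3)[OF z(2) V(2)[OF z(1)]]] .
    moreover obtain v where "z = cone d (b # v)" "length v = n" using z(1) unfolding X_def by blast
    then have "x \<in> guessed (cone d [b]) (OZ {z})"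
      unfolding guessed_def x_def using guessed_OZ[of "b # v" "{z}"] by (auto intro!: exI[of _ v])
    ultimately show ?thesis using y'(2,3) unfolding M_def by (cases b) auto
  qed
  have sz: "2 * (bnd k (length x) * bnd k (length x) + bnd j (length y) * bnd j (length y) * bnd j (length y)) < 2 ^ n"
    using size_bound[OF _ y(1) size] unfolding x_def by simp
  have "\<exists>A \<in> admissible C0 N F. \<exists>ps1 ps2. ps1 \<in> accepting_paths (M False) A y \<and>
      ps2 \<in> accepting_paths (M True) A y \<and>
      length ps1 \<le> bnd j (length y) \<and> length ps2 \<le> bnd j (length y) \<and>
      (M False = M True \<longrightarrow> ps1 = ps2 \<longrightarrow> acc (M False) j (OZ {}) y)"
    by (rule double_acceptance[of W M j y, OF V(1) _ _ W(1,2) refl sz]) (use V(2) ac in blast)+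
  then obtain A ps1 ps2 where A: "A \<in> admissible C0 N F" "ps1 \<in> accepting_paths M1 A y" "ps2 \<in> accepting_paths M2 A y"
    "length ps1 \<le> bnd j (length y)" "length ps2 \<le> bnd j (length y)"
    unfolding M_def by auto
  then have "destroyed c A" unfolding c destroyed.simps acc_def by blast
  then show False using not_destroyed[OF A(1)] by blast
qed

section \<open>Constraints whose levels must not be empty\<close>

lemma CCo_OZ_admissible:
  assumes c: "c = CCo M1 M2 j"
    and Z: "Z \<subseteq> level" "Z \<noteq> {}" "\<And>b z z'. z \<in> Z \<inter> X b \<Longrightarrow> z' \<in> Z \<inter> X b \<Longrightarrow> z = z'"
  shows "OZ Z \<in> admissible C N F"
proof (rule OZ_admissible[OF Z(1)])
  let ?G = "F - level \<union> Z"
  have F: "\<forall>b v v'. length v = length v' \<longrightarrow> cone d (b # v) \<in> F \<longrightarrow> cone d (b # v') \<in> F \<longrightarrow> v = v'"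
    "\<forall>m. \<exists>b v. length v = m \<and> cone d (b # v) \<in> F" using fsat_F c by auto
  have out: "cone d (b # v) \<in> ?G \<longleftrightarrow> cone d (b # v) \<in> F" if "length v \<noteq> n" for b v
    using that Z(1) cone_in_X[of d "b # v"] by auto
  have lev: "cone d (b # v) \<in> ?G \<longleftrightarrow> cone d (b # v) \<in> Z" if "length v = n" for b v
    using that cone_in_X[of d "b # v"] by auto
  have uniq: "v = v'" if l: "length v = length v'" and v: "cone d (b # v) \<in> ?G" "cone d (b # v') \<in> ?G" for b v v'
  proof (cases "length v = n")
    case True
    then have "cone d (b # v) \<in> Z \<inter> X b" "cone d (b # v') \<in> Z \<inter> X b"
      using v lev l unfolding X_def by auto
    then show ?thesis using Z(3) cone_inj by blast
  next
    case False
    then have "cone d (b # v) \<in> F" "cone d (b # v') \<in> F" using l v out[of v b] out[of v' b] by auto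
    then show ?thesis using F(1) l by blast
  qed
  have ex: "\<exists>b v. length v = m \<and> cone d (b # v) \<in> ?G" for m
  proof (cases "m = n")
    case True
    obtain z where "z \<in> Z" using Z(2) by blast
    moreover obtain b v where "z = cone d (b # v)" "length v = n"
      using \<open>z \<in> Z\<close> Z(1) unfolding X_def by blast
    ultimately show ?thesis using True by blast
  next
    case False
    moreover obtain b v where "length v = m" "cone d (b # v) \<in> F" using F(2) by blast
    ultimately show ?thesis using out[of v b] by blast
  qed
  show "fsat d c ?G" unfolding c fsat.simps
    by (intro conjI allI impI) (rule uniq, assumption+, rule ex)
qed

text \<open>The empty level is forbidden as a common background. Instead \<open>OZ {a}\<close> and
  \<open>OZ {b}\<close> are compared through \<open>OZ {a, b}\<close>, which is allowed because a
  level may hold one word of each kind.\<close>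

lemma majority_value:
  assumes c: "c = CCo M1 M2 j"
  shows "\<exists>v E. finite E \<and> card E \<le> 16 * (length w + 1) \<and>
    (\<forall>b. \<forall>z \<in> X b - E. (w \<in> OZ {z}) = v)"
proof -
  have V1: "OZ {z} \<in> admissible C N F" if "z \<in> X b" for b z
    using that X_disjoint by (intro CCo_OZ_admissible[OF c]) (cases b; auto)+
  have V2: "OZ {a, b} \<in> admissible C N F" if "a \<in> X False" "b \<in> X True" for a b
  proof (rule CCo_OZ_admissible[OF c])
    show "z = z'" if "z \<in> {a, b} \<inter> X e" "z' \<in> {a, b} \<inter> X e" for e z z'
      using that \<open>a \<in> X False\<close> \<open>b \<in> X True\<close> X_disjoint[of a False] X_disjoint[of b True] by (cases e) auto
  qed (use that in auto)
  have "\<exists>S. w \<in> S \<and> finite S \<and> card S \<le> length w + 1 \<and> closed_under C (OZ {z}) S" if "z \<in> X b" for b z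
    using closure_of_word[OF condition_good'[OF cond V1[OF that]], of w] by blast
  then obtain S where S: "\<And>b z. z \<in> X b \<Longrightarrow> w \<in> S z \<and> finite (S z) \<and> card (S z) \<le> length w + 1 \<and>
     closed_under C (OZ {z}) (S z)" by metis
  have eq: "(w \<in> OZ {a}) = (w \<in> OZ {b})"
    if "a \<in> X False" "b \<in> X True" "b \<notin> S a" "a \<notin> S b" for a b
  proof -
    have "w \<in> OZ {a} \<longleftrightarrow> w \<in> OZ {a, b}"
      by (rule OZ_agree[OF V1[OF that(1)] V2[OF that(1,2)], of "S a"]) (use S[OF that(1)] that in auto)
    moreover have "w \<in> OZ {b} \<longleftrightarrow> w \<in> OZ {a, b}"
      by (rule OZ_agree[OF V1[OF that(2)] V2[OF that(1,2)], of "S b"]) (use S[OF that(2)] that in auto)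
    ultimately show ?thesis by blast
  qed
  have "\<exists>v E. finite E \<and> card E \<le> 16 * (length w + 1) \<and> (\<forall>z \<in> X False - E. (w \<in> OZ {z}) = v) \<and>
     (\<forall>z \<in> X True - E. (w \<in> OZ {z}) = v)"
    using S by (intro bipartite_majority[OF finite_X finite_X card_X card_X _ _ eq]) auto
  then show ?thesis by (metis (full_types))
qed

text \<open>
  The level \<open>n\<close> of a \<open>CCo\<close> constraint may not be empty. An oracle respecting only the earlier
  constraints may leave it empty; giving every other code word its majority value makes that
  oracle indistinguishable from almost all oracles with a single word on the level.
\<close>

lemma empty_level_oracle:
  assumes c: "c = CCo M1 M2 j"
  obtains A where "A \<in> admissible C0 N F"
    and "\<And>w. \<exists>E. finite E \<and> card E \<le> 16 * (length w + 1) \<and> (\<forall>b. \<forall>z \<in> X b - E. w \<in> OZ {z} \<longleftrightarrow> w \<in> A)"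
proof -
  have V1: "OZ {z} \<in> admissible C N F" if "z \<in> X b" for b z
    using that X_disjoint by (intro CCo_OZ_admissible[OF c]) (cases b; auto)+
  have "\<forall>w. \<exists>v E. finite E \<and> card E \<le> 16 * (length w + 1) \<and> (\<forall>b. \<forall>z \<in> X b - E. (w \<in> OZ {z}) = v)"
    using majority_value[OF c] by blast
  then obtain v E where E: "\<And>w. finite (E w) \<and> card (E w) \<le> 16 * (length w + 1) \<and>
     (\<forall>b. \<forall>z \<in> X b - E w. (w \<in> OZ {z}) = v w)" by metis
  \<comment> \<open>\<open>Phi C0\<close> overrules the vote on code words of earlier constraints,
    so from length \<open>N\<close> on it takes effect exactly on the codes of later ones.\<close>
  define G where "G = {w. if length w < N then w \<in> F else if coded C w then v w
    else w \<in> F - level}"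
  define A where "A = Phi C0 G"
  have A: "A \<in> admissible C0 N F"
    unfolding A_def
  proof (rule Phi_C0_admissible)
    show "w \<in> G \<longleftrightarrow> w \<in> F" if "length w < N" for w using that unfolding G_def by simp
    show "cone e u \<in> G \<longleftrightarrow> cone e u \<in> F" if "e < d" "\<not> coded C (cone e u)" for e u
      using that cone_in_X[of e u] unfolding G_def by auto
  qed
  moreover have "\<exists>E. finite E \<and> card E \<le> 16 * (length w + 1) \<and>
      (\<forall>b. \<forall>z \<in> X b - E. w \<in> OZ {z} \<longleftrightarrow> w \<in> A)" for w
  proof (induction "length w" arbitrary: w rule: less_induct)
    case less
    consider "length w < N" | "coded C0 w" | "\<not> length w < N" "\<not> coded C0 w" "coded C w"
      | "\<not> length w < N" "\<not> coded C0 w" "\<not> coded C w" by blast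
    then show ?case
    proof cases
      case 1
      have "w \<in> A \<longleftrightarrow> w \<in> F" using A 1 unfolding admissible_def agree_def by blast
      then show ?thesis using admissible_agree[OF V1 1] by (intro exI[of _ "{}"]) auto
    next
      case 2
      then obtain N1 N2 k x where w: "is_code C0 w N1 N2 k x" unfolding coded_def by blast
      obtain M ps where M: "M \<in> {N1, N2}" and ps: "ps \<in> accepting_paths M A x"
        "length ps \<le> bnd k (length x)" using good_certificate[OF good_C0[OF A] w] by blast
      let ?t = "bnd k (length x)"
      have ql: "length q < ?t" if "q \<in> queries M ps" for q
        using that queries_length[of M A x ps q] ps unfolding accepting_paths_def by simp
      have "\<exists>E. finite E \<and> card E \<le> 16 * (length q + 1) \<and>
          (\<forall>b. \<forall>z \<in> X b - E. q \<in> OZ {z} \<longleftrightarrow> q \<in> A)" if "q \<in> queries M ps" for q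
        using less ql[OF that] is_code_length(1)[OF w] by simp
      then obtain E where E: "\<And>q. q \<in> queries M ps \<Longrightarrow> finite (E q) \<and> card (E q) \<le> 16 * (length q + 1) \<and>
          (\<forall>b. \<forall>z \<in> X b - E q. q \<in> OZ {z} \<longleftrightarrow> q \<in> A)" by metis
      define U where "U = (\<Union>q \<in> queries M ps. E q)"
      have "card U \<le> ?t * (16 * ?t)"
        unfolding U_def
      proof (rule card_UN_le_mult)
        show "finite (queries M ps)" by (rule finite_queries)
        show "card (queries M ps) \<le> ?t" using card_queries[of M ps] ps(2) by linarith
        show "card (E q) \<le> 16 * ?t" if "q \<in> queries M ps" for q
        proof -
          have "card (E q) \<le> 16 * (length q + 1)" using E[OF that] by blast
          also have "\<dots> \<le> 16 * ?t" by (intro mult_le_mono2) (use ql[OF that] in simp)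
          finally show ?thesis .
        qed
      qed
      \<comment> \<open>The linear bound reproduces itself: at most \<open>?t\<close> queries with
        at most \<open>16 * ?t\<close> exceptions each, and
        \<open>?t * ?t < length w\<close>.\<close>
      then have "card U \<le> 16 * (length w + 1)" using is_code_length(2)[OF w] by simp
      moreover have "finite U" unfolding U_def using finite_queries E by blast
      moreover have "w \<in> OZ {z} \<longleftrightarrow> w \<in> A" if "z \<in> X b - U" for b z
      proof -
        have "good C0 (OZ {z})" using good_C0 admissible_C0 V1 that by blast
        moreover have "q \<in> A \<longleftrightarrow> q \<in> OZ {z}" if "q \<in> queries M ps" for q
          using E[OF that] \<open>z \<in> X b - U\<close> that unfolding U_def by blast
        ultimately show ?thesis using certificate_value[OF good_C0[OF A] _ w M ps] by blast
      qed
      ultimately show ?thesis by blast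
    next
      case 3
      then have "w \<in> A \<longleftrightarrow> v w" unfolding A_def using Phi_free[of C0 w G] by (simp add: G_def)
      then show ?thesis using E[of w] by blast
    next
      case 4
      then have "w \<in> A \<longleftrightarrow> w \<in> F - level"
        unfolding A_def using Phi_free[of C0 w G] by (simp add: G_def)
      then have "w \<in> OZ {z} \<longleftrightarrow> w \<in> A" if "z \<noteq> w" for z using OZ_free[OF 4(3), of "{z}"] that by auto
      then show ?thesis by (intro exI[of _ "{w}"]) auto
    qed
  qed
  ultimately show ?thesis using that by blast
qed

text \<open>If the level holds just one word, of kind \<open>\<not> b\<close>, then \<open>x\<close>
  lies in the complement belonging to \<open>b\<close>, and a working reduction forces the machine
  for \<open>b\<close> to reject the output. An accepting path of that machine in the empty-level
  oracle \<open>A\<close> would persist for almost all such words. So neither machine accepts in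
  \<open>A\<close>, against the promise. The output \<open>y\<close> is read off a longest timely
  run of \<open>T\<close> in \<open>A\<close>.\<close>

lemma diagonalize_CCo:
  assumes c: "c = CCo M1 M2 j" and T: "wf_otm T" "deterministic T"
    and size: "16 * (bnd k (Suc n) * bnd k (Suc n) +
     bnd j (bnd k (Suc n)) * bnd j (bnd k (Suc n)) * bnd j (bnd k (Suc n))) < 2 ^ n"
  shows "\<exists>A \<in> admissible C N F. fails T k d c A"
proof (rule ccontr)
  assume "\<not> ?thesis"
  then have nf: "\<exists>y. outputs T k A x y \<and> (x \<notin> guessed (cone d [False]) A \<longrightarrow> \<not> acc M1 j A y) \<and>
      (x \<notin> guessed (cone d [True]) A \<longrightarrow> \<not> acc M2 j A y)" if "A \<in> admissible C N F" for A x
    using that unfolding c by auto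
  have V1: "OZ {z} \<in> admissible C N F" if "z \<in> X b" for b z
    using that X_disjoint by (intro CCo_OZ_admissible[OF c]) (cases b; auto)+
  obtain A where A: "A \<in> admissible C0 N F"
    and ex: "\<And>w. \<exists>E. finite E \<and> card E \<le> 16 * (length w + 1) \<and> (\<forall>b. \<forall>z \<in> X b - E. w \<in> OZ {z} \<longleftrightarrow> w \<in> A)"
    using empty_level_oracle[OF c] by blast
  then obtain E where E: "\<And>w. finite (E w) \<and> card (E w) \<le> 16 * (length w + 1) \<and>
      (\<forall>b. \<forall>z \<in> X b - E w. w \<in> OZ {z} \<longleftrightarrow> w \<in> A)" by metis
  have exc: "finite (\<Union>q \<in> queries M ps. E q) \<and> card (\<Union>q \<in> queries M ps. E q) \<le> t * (16 * t)"
    if "computation M A x ps" "length ps \<le> t" for M x ps t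
  proof
    show "finite (\<Union>q \<in> queries M ps. E q)" using finite_queries E by blast
    show "card (\<Union>q \<in> queries M ps. E q) \<le> t * (16 * t)"
    proof (rule card_UN_le_mult[OF finite_queries])
      show "card (queries M ps) \<le> t" using card_queries[of M ps] that(2) by linarith
      show "card (E q) \<le> 16 * t" if "q \<in> queries M ps" for q
      proof -
        have "card (E q) \<le> 16 * (length q + 1)" using E[of q] by blast
        also have "\<dots> \<le> 16 * t"
          using queries_length[OF \<open>computation M A x ps\<close> that] \<open>length ps \<le> t\<close>
          by (intro mult_le_mono2) simp
        finally show ?thesis .
      qed
    qed
  qed
  define x where "x = replicate n False"
  define t where "t = bnd k (length x)"
  have "\<exists>ps. (computation T A x ps \<and> length ps \<le> t) \<and>
    (\<forall>ps'. computation T A x ps' \<and> length ps' \<le> t \<longrightarrow> length ps' \<le> length ps)"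
  proof (rule ex_has_greatest_nat[where P = "\<lambda>ps. computation T A x ps \<and> length ps \<le> t" and f = length
        and k = "[init_conf T x]" and b = "Suc t"])
    show "computation T A x [init_conf T x] \<and> length [init_conf T x] \<le> t"
      unfolding computation_def t_def by simp
    show "\<forall>ps. computation T A x ps \<and> length ps \<le> t \<longrightarrow> length ps < Suc t" by simp
  qed
  then obtain ps where ps: "computation T A x ps" "length ps \<le> t"
    "\<And>ps'. computation T A x ps' \<Longrightarrow> length ps' \<le> t \<Longrightarrow> length ps' \<le> length ps" by blast
  define U where "U = (\<Union>q \<in> queries T ps. E q)"
  have U: "finite U" "card U \<le> 16 * (t * t)" using exc[OF ps(1,2)] unfolding U_def by auto
  have Tz: "ps \<in> accepting_paths T (OZ {z}) x \<and> outputs T k (OZ {z}) x y \<longrightarrow> tape_word (tape (last ps) 2) y" for z y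
    unfolding outputs_def using accepting_path_unique[OF T] by blast
  have run: "ps \<in> accepting_paths T (OZ {z}) x" if z: "z \<in> X b - U" for b z
  proof -
    obtain ps' where ps': "ps' \<in> accepting_paths T (OZ {z}) x" "length ps' \<le> t"
      using nf[of "OZ {z}" x] V1 z unfolding outputs_def t_def by blast
    have "\<forall>w \<in> queries T ps. w \<in> A \<longleftrightarrow> w \<in> OZ {z}"
      using E z unfolding U_def by blast
    then have "ps' = ps" using maximal_run_accepts[OF T ps(1) ps(3) _ ps'] by blast
    then show ?thesis using ps' by simp
  qed
  have tsz: "16 * (t * t) < 2 ^ n"
  proof -
    have "t \<le> bnd k (Suc n)" unfolding t_def x_def by (intro bnd_mono) auto
    then have "t * t \<le> bnd k (Suc n) * bnd k (Suc n)" by (intro mult_mono) auto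
    then show ?thesis using size by simp
  qed
  have pick: "\<exists>z. z \<in> X b - S" if "finite S" "card S < 2 ^ n" for S b
    using that card_mono[OF that(1), of "X b"] card_X[of b] by (metis DiffI leD subsetI)
  obtain z0 where z0: "z0 \<in> X False - U" using pick[OF U(1)] U(2) tsz by (meson le_less_trans)
  obtain y where y0: "outputs T k (OZ {z0}) x y" using nf[OF V1, of z0 False x] z0 by blast
  have y: "tape_word (tape (last ps) 2) y" using Tz[of z0 y] run[OF z0] y0 by blast
  have out: "outputs T k (OZ {z}) x y" if "z \<in> X b - U" for b z
    unfolding outputs_def using run[OF that] y ps(2) t_def by blast
  define s where "s = bnd j (length y)"
  have ssz: "16 * (t * t + s * s * s) < 2 ^ n"
    using size_bound[OF _ y0 size] unfolding x_def s_def t_def by simp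
  \<comment> \<open>The exceptional words of a candidate path number at most
    \<open>16 * s * s\<close> here; \<open>s \<ge> 1\<close> fits this into the cubic size condition
    shared by all three kinds of constraint.\<close>
  have "s * s * 1 \<le> s * s * s" by (rule mult_le_mono2) (simp add: s_def)
  then have "16 * (t * t) + s * (16 * s) \<le> 16 * (t * t + s * s * s)"
    by (simp add: distrib_left mult.left_commute)
  then have ssz': "16 * (t * t) + s * (16 * s) < 2 ^ n" using ssz by (rule le_less_trans)
  have ng: "x \<notin> guessed (cone d [b]) (OZ {z})" if "z \<in> X (\<not> b)" for b z
  proof -
    have "cone d (b # v) \<noteq> z" if "length v = n" for v
      using \<open>z \<in> X (\<not> b)\<close> X_disjoint[of z "\<not> b"] that unfolding X_def by auto
    then show ?thesis unfolding guessed_def x_def using guessed_OZ[of _ "{z}"] by auto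
  qed
  have contra: False if ac: "acc M j A y" and M: "M = (if b then M2 else M1)" for M b
  proof -
    obtain qs where qs: "qs \<in> accepting_paths M A y" "length qs \<le> s"
      using ac unfolding acc_def s_def by blast
    define W where "W = (\<Union>q \<in> queries M qs. E q)"
    have W: "finite W" "card W \<le> s * (16 * s)"
      using exc[of M y qs s] qs unfolding W_def accepting_paths_def by auto
    have "card (U \<union> W) < 2 ^ n" using card_Un_le[of U W] U(2) W(2) ssz' by linarith
    then obtain z where z: "z \<in> X (\<not> b) - (U \<union> W)" using pick[of "U \<union> W" "\<not> b"] U W by blast
    have "\<forall>w \<in> queries M qs. w \<in> A \<longleftrightarrow> w \<in> OZ {z}" using E z unfolding W_def by blast
    then have "qs \<in> accepting_paths M (OZ {z}) y" using accepting_paths_cong[OF qs(1)] by blast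
    then have az: "acc M j (OZ {z}) y" unfolding acc_def using qs(2) s_def by blast
    obtain y' where y': "outputs T k (OZ {z}) x y'" "x \<notin> guessed (cone d [False]) (OZ {z}) \<longrightarrow> \<not> acc M1 j (OZ {z}) y'"
      "x \<notin> guessed (cone d [True]) (OZ {z}) \<longrightarrow> \<not> acc M2 j (OZ {z}) y'"
      using nf[OF V1, of z "\<not> b" x] z by blast
    have "outputs T k (OZ {z}) x y" using out[of z "\<not> b"] z by blast
    then have "y' = y" using outputs_unique[OF T y'(1)] by blast
    then show False using y' az M ng[of z b] z by (cases b) auto
  qed
  have "\<not> destroyed c A" using not_destroyed[OF A] .
  then have "acc M1 j A y \<or> acc M2 j A y" unfolding c destroyed.simps by blast
  then show False using contra[of M1 False] contra[of M2 True] by auto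
qed

end

section \<open>The generic oracle\<close>

lemma admissible_mono:
  assumes "agree N F F'" "N \<le> N'" "A \<in> admissible C N' F'"
  shows "A \<in> admissible C N F"
  using assms agree_trans agree_mono unfolding admissible_def by blast

lemma condition_mono:
  assumes "condition C N F" "F' \<in> admissible C N F" "N \<le> N'"
  shows "condition C N' F'"
proof -
  have "agree N F F'" "Sat C F'" using assms(2) unfolding admissible_def by auto
  moreover have "A \<in> admissible D N F" if "A \<in> admissible D N' F'" for A D
    using admissible_mono[OF \<open>agree N F F'\<close> assms(3) that] .
  ultimately show ?thesis using assms(1,3) unfolding condition_def by fastforce
qed

definition extends :: "(nat \<rightharpoonup> constr) \<times> nat \<times> lang \<Rightarrow> (nat \<rightharpoonup> constr) \<times> nat \<times> lang \<Rightarrow> bool" where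
  "extends = (\<lambda>(C, N, F) (C', N', F'). N \<le> N' \<and> (\<forall>d < N. C' d = C d) \<and> agree N F F')"

lemma fsat_initial: "\<exists>I \<subseteq> range (cone d). fsat d c ((F - range (cone d)) \<union> I)"
proof (cases c)
  case (CPair M1 M2 k)
  let ?I = "{stop_word d x t | x t. t \<ge> 1 \<and> bnd (2 * k) (length x) \<le> t}"
  have "?I \<subseteq> range (cone d)" unfolding stop_word_def by auto
  moreover have "stop_word d x t \<in> (F - range (cone d)) \<union> ?I \<longleftrightarrow> bnd (2 * k) (length x) \<le> t" if "t \<ge> 1" for x t
  proof -
    have "stop_word d x t = stop_word d x' t' \<longleftrightarrow> x = x' \<and> t = t'" for x' t'
      using trailing_inj[of x t x' t'] unfolding stop_word_def by simp
    then show ?thesis using that unfolding stop_word_def by auto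
  qed
  ultimately show ?thesis unfolding CPair fsat.simps by (intro exI[of _ ?I]) blast
next
  case (CCo M1 M2 k)
  \<comment> \<open>An empty cone would violate the constraint, so each level starts with one word
    of kind \<open>False\<close>.\<close>
  let ?I = "{cone d (False # replicate n False) | n. True}"
  have "?I \<subseteq> range (cone d)" by auto
  moreover have mem: "cone d (b # v) \<in> (F - range (cone d)) \<union> ?I \<longleftrightarrow> \<not> b \<and> v = replicate (length v) False" for b v
    by auto
  have "fsat d c ((F - range (cone d)) \<union> ?I)"
    unfolding CCo fsat.simps mem
  proof (intro conjI allI impI)
    show "v = v'" if "length v = length v'" "\<not> b \<and> v = replicate (length v) False"
      "\<not> b \<and> v' = replicate (length v') False" for b v v'
      using that by argo
    show "\<exists>b v. length v = n \<and> \<not> b \<and> v = replicate (length v) False" for n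
      by (intro exI[of _ False] exI[of _ "replicate n False"]) simp
  qed
  ultimately show ?thesis by blast
qed (auto intro!: exI[of _ "{}"])

text \<open>At index \<open>N\<close> the new cone lies above the committed part, so it can be
  filled freely. Since \<open>C\<close> has no index from \<open>N\<close> on, the assumption on
  \<open>c\<close> is precisely what a condition demands of the new index.\<close>

lemma add_constraint:
  assumes cond: "condition C N F" and nd: "\<And>A. A \<in> admissible C N F \<Longrightarrow> \<not> destroyed c A"
  shows "\<exists>F'. condition (C(N \<mapsto> c)) (Suc N) F' \<and> agree N F F'"
proof -
  obtain I where I: "I \<subseteq> range (cone N)" "fsat N c ((F - range (cone N)) \<union> I)"
    using fsat_initial by blast
  define C' where "C' = C(N \<mapsto> c)"
  define G where "G = (F - range (cone N)) \<union> I"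
  define F' where "F' = Phi C' G"
  have dom: "e < N" if "C e = Some c'" for e c' using cond that unfolding condition_def by blast
  have S: "Sat C F" using cond unfolding condition_def by blast
  have agr: "agree N F F'"
    unfolding F'_def
  proof (rule Phi_agree_below)
    fix w M1 M2 k x assume l: "length w < N" and w: "is_code C' w M1 M2 k x"
    obtain e t where e: "C' e = Some (CPair M1 M2 k)" "bnd (2 * k) (length x) \<le> t" "w = code_word e x t"
      using w unfolding is_code_def by blast
    then have "e \<noteq> N" using l length_code_word[of e x t] by auto
    then have "is_code C w M1 M2 k x" using e unfolding C'_def is_code_def by auto
    then show "w \<in> F \<longleftrightarrow> acc M1 k F x" using S unfolding Sat_def codes_ok_def by blast
  next
    fix w :: word assume "length w < N"
    then have "w \<notin> range (cone N)" by auto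
    then show "w \<in> F \<longleftrightarrow> w \<in> G" unfolding G_def using I(1) by blast
  qed
  have "fsat e c' F'" if e: "C' e = Some c'" for e c'
  proof (cases "e = N")
    case True
    then have "c' = c" using e unfolding C'_def by simp
    show ?thesis
    proof (rule fsat_cong[of C' e c' G])
      show "C' e = Some c'" by (rule e)
      show "fsat e c' G" using I(2) True \<open>c' = c\<close> unfolding G_def by simp
      show "cone e v \<in> G \<longleftrightarrow> cone e v \<in> F'" if "\<not> coded C' (cone e v)" for v
        using Phi_free[OF that, of G] unfolding F'_def by blast
    qed
  next
    case False
    show ?thesis
    proof (rule fsat_cong[of C' e c' F])
      show "C' e = Some c'" by (rule e)
      show "fsat e c' F" using S e False unfolding Sat_def C'_def by simp
      show "cone e v \<in> F \<longleftrightarrow> cone e v \<in> F'" if "\<not> coded C' (cone e v)" for v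
      proof -
        have "cone e v \<notin> range (cone N)" using False by auto
        then show ?thesis using Phi_free[OF that, of G] I(1) unfolding F'_def G_def by blast
      qed
    qed
  qed
  then have S': "Sat C' F'" unfolding Sat_def F'_def using codes_ok_Phi by blast
  have restr: "C' |` {..<e} = C |` {..<e}" if "e \<le> N" for e
    using that unfolding C'_def by (intro ext) (auto simp: restrict_map_def)
  have restrN: "C |` {..<N} = C"
  proof
    fix e show "(C |` {..<N}) e = C e" using dom[of e] by (cases "C e") (auto simp: restrict_map_def)
  qed
  have "\<not> destroyed c' A" if e: "C' e = Some c'" and A: "A \<in> admissible (C' |` {..<e}) (Suc N) F'" for e c' A
  proof (cases "e = N")
    case True
    then have "A \<in> admissible C (Suc N) F'" "c' = c" using A e restr[of N] restrN unfolding C'_def by auto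
    then show ?thesis using nd admissible_mono[OF agr, of "Suc N"] by auto
  next
    case False
    then have C: "C e = Some c'" using e unfolding C'_def by simp
    then have "A \<in> admissible (C |` {..<e}) (Suc N) F'" using A restr[of e] dom[of e] by simp
    then have "A \<in> admissible (C |` {..<e}) N F" using admissible_mono[OF agr, of "Suc N"] by simp
    then show ?thesis using cond C unfolding condition_def by blast
  qed
  moreover have "dom C' \<subseteq> {..<Suc N}" unfolding C'_def using dom by (fastforce simp: dom_def)
  ultimately have "condition C' (Suc N) F'" using S' unfolding condition_def by blast
  then show ?thesis using agr unfolding C'_def by blast
qed

lemma dense_constraint:
  assumes "condition C N F"
  shows "\<exists>C' N' F'. condition C' N' F' \<and> extends (C, N, F) (C', N', F') \<and>
    ((\<forall>A \<in> admissible C' N' F'. destroyed c A) \<or> (\<exists>d < N'. C' d = Some c))"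
proof (cases "\<exists>A \<in> admissible C N F. destroyed c A")
  case True
  then obtain A where A: "A \<in> admissible C N F" "destroyed c A" by blast
  obtain m where m: "\<forall>B. agree m A B \<longrightarrow> destroyed c B" using destroyed_finite[OF A(2)] by blast
  have "condition C (max N m) A" using condition_mono[OF assms A(1)] by simp
  moreover have "extends (C, N, F) (C, max N m, A)" using A(1) unfolding extends_def admissible_def by auto
  moreover have "\<forall>B \<in> admissible C (max N m) A. destroyed c B"
    using m agree_mono[of "max N m" A _ m] unfolding admissible_def by simp
  ultimately show ?thesis by blast
next
  case False
  then obtain F' where "condition (C(N \<mapsto> c)) (Suc N) F'" "agree N F F'"
    using add_constraint[OF assms, of c] by blast
  moreover from this have "extends (C, N, F) (C(N \<mapsto> c), Suc N, F')" unfolding extends_def by auto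
  ultimately show ?thesis
    by (intro exI[of _ "C(N \<mapsto> c)"] exI[of _ "Suc N"] exI[of _ F']) (auto intro!: exI[of _ N])
qed

text \<open>The conclusion \<open>d < N'\<close> matters also when \<open>c\<close> is not at
  \<open>d\<close>: extensions never change the constraints below \<open>N'\<close>, so the question
  whether \<open>c\<close> sits at \<open>d\<close> is settled from then on.\<close>

lemma dense_diagonalization:
  assumes cond: "condition C N F" and T: "wf_otm T" "deterministic T"
  shows "\<exists>C' N' F'. condition C' N' F' \<and> extends (C, N, F) (C', N', F') \<and>
    d < N' \<and> (C' d = Some c \<longrightarrow> (\<forall>A \<in> admissible C' N' F'. fails T k d c A))"
proof (cases "C d = Some c")
  case False
  have "F \<in> admissible C N F" using cond unfolding condition_def admissible_def by simp
  then have "condition C (max N (Suc d)) F" using condition_mono[OF cond] by simp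
  moreover have "extends (C, N, F) (C, max N (Suc d), F)" unfolding extends_def by simp
  ultimately show ?thesis using False by (metis lessI max.strict_coboundedI2)
next
  case True
  then have dN: "d < N" using cond unfolding condition_def by blast
  have "\<exists>A \<in> admissible C N F. fails T k d c A"
  proof (cases "\<exists>M1 M2 j. c = CPair M1 M2 j")
    case True
    moreover have "F \<in> admissible C N F" using cond unfolding condition_def admissible_def by simp
    ultimately show ?thesis by auto
  next
    case np: False
    obtain j where j: "(\<exists>M. c = CUP M j) \<or> (\<exists>M1 M2. c = CNP M1 M2 j) \<or> (\<exists>M1 M2. c = CCo M1 M2 j)"
      using np by (cases c) auto
    obtain n where n: "n \<ge> N" "16 * (bnd k (Suc n) * bnd k (Suc n) +
     bnd j (bnd k (Suc n)) * bnd j (bnd k (Suc n)) * bnd j (bnd k (Suc n))) < 2 ^ n"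
      using level_size by blast
    interpret diagonalization C N F d c n
      by unfold_locales (use cond True np n(1) in auto)
    show ?thesis using j diagonalize_CUP[OF _ T n(2)] diagonalize_CNP[OF _ T n(2)]
      diagonalize_CCo[OF _ T n(2)] by blast
  qed
  then obtain A where A: "A \<in> admissible C N F" "fails T k d c A" by blast
  obtain m where m: "\<forall>B. agree m A B \<longrightarrow> fails T k d c B" using fails_finite[OF A(2)] by blast
  have "condition C (max N m) A" using condition_mono[OF cond A(1)] by simp
  moreover have "extends (C, N, F) (C, max N m, A)" using A(1) unfolding extends_def admissible_def by auto
  moreover have "\<forall>B \<in> admissible C (max N m) A. fails T k d c B"
    using m agree_mono[of "max N m" A _ m] unfolding admissible_def by simp
  moreover have "d < max N m" using dN by simp
  ultimately show ?thesis by blast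
qed

section \<open>Passage to the limit\<close>

lemma fsat_limit:
  assumes "\<And>m. \<exists>B. fsat d c B \<and> agree m B A"
  shows "fsat d c A"
proof (cases c)
  case (CPair M1 M2 k)
  have "stop_word d x t \<in> A \<longleftrightarrow> bnd (2 * k) (length x) \<le> t" if t: "t \<ge> 1" for x t
  proof -
    obtain B where B: "fsat d c B" "agree (Suc (length (stop_word d x t))) B A" using assms by blast
    then have "stop_word d x t \<in> B \<longleftrightarrow> bnd (2 * k) (length x) \<le> t" using t unfolding CPair fsat.simps by blast
    then show ?thesis using B(2) unfolding agree_def by simp
  qed
  then show ?thesis unfolding CPair by simp
next
  case (CUP M k)
  have "v = v'" if v: "length v = length v'" "cone d v \<in> A" "cone d v' \<in> A" for v v'
  proof -
    obtain B where B: "fsat d c B" "agree (Suc (length (cone d v))) B A" using assms by blast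
    then have "cone d v \<in> B" "cone d v' \<in> B" using v unfolding agree_def by auto
    then show ?thesis using B(1) v(1) unfolding CUP fsat.simps by blast
  qed
  then show ?thesis unfolding CUP fsat.simps by blast
next
  case (CNP M1 M2 k)
  have "v = v'" if v: "length v = length v'" "cone d v \<in> A" "cone d v' \<in> A" for v v'
  proof -
    obtain B where B: "fsat d c B" "agree (Suc (length (cone d v))) B A" using assms by blast
    then have "cone d v \<in> B" "cone d v' \<in> B" using v unfolding agree_def by auto
    then show ?thesis using B(1) v(1) unfolding CNP fsat.simps by blast
  qed
  then show ?thesis unfolding CNP fsat.simps by blast
next
  case (CCo M1 M2 k)
  have u: "v = v'" if v: "length v = length v'" "cone d (b # v) \<in> A" "cone d (b # v') \<in> A" for b v v'
  proof -
    obtain B where B: "fsat d c B" "agree (Suc (length (cone d (b # v)))) B A" using assms by blast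
    then have "cone d (b # v) \<in> B" "cone d (b # v') \<in> B" using v unfolding agree_def by auto
    then show ?thesis using B(1) v(1) unfolding CCo fsat.simps by blast
  qed
  have e: "\<exists>b v. length v = n \<and> cone d (b # v) \<in> A" for n
  proof -
    obtain B where B: "fsat d c B" "agree (d + n + 3) B A" using assms by blast
    then obtain b v where "length v = n" "cone d (b # v) \<in> B" unfolding CCo fsat.simps by blast
    then show ?thesis using B(2) unfolding agree_def by (intro exI[of _ b] exI[of _ v]) auto
  qed
  show ?thesis unfolding CCo fsat.simps by (intro conjI allI impI) (rule u, assumption+, rule e)
qed

lemma Sat_limit:
  assumes "\<And>m. \<exists>B. Sat C B \<and> agree m B A"
  shows "Sat C A"
  unfolding Sat_def codes_ok_def
proof (intro conjI allI impI)
  show "fsat d c A" if "C d = Some c" for d c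
    by (rule fsat_limit) (use assms that in \<open>metis Sat_def\<close>)
  fix w M1 M2 k x assume w: "is_code C w M1 M2 k x"
  obtain B where B: "Sat C B" "agree (Suc (length w)) B A" using assms by blast
  have "w \<in> B \<longleftrightarrow> acc M1 k B x" using B(1) w unfolding Sat_def codes_ok_def by blast
  moreover have "acc M1 k B x \<longleftrightarrow> acc M1 k A x"
    using is_code_length(1)[OF w] by (intro acc_agree agree_mono[OF B(2)]) simp
  moreover have "w \<in> B \<longleftrightarrow> w \<in> A" using B(2) unfolding agree_def by simp
  ultimately show "w \<in> A \<longleftrightarrow> acc M1 k A x" by simp
qed

section \<open>Countably many requirements\<close>

instance sym :: countable by countable_datatype
instance dir :: countable by countable_datatype

lemma countable_wf_otm: "countable {M. wf_otm M}"
proof -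
  let ?f = "\<lambda>M :: otm. (delta M, n_tapes M, q_start M, q_acc M, q_query M, q_yes M, q_no M)"
  have "?f ` {M. wf_otm M} \<subseteq> Collect finite \<times> UNIV" unfolding wf_otm_def by auto
  moreover have "countable (Collect (finite :: (nat \<times> sym list \<times> nat \<times> sym list \<times> dir list) set \<Rightarrow> bool) \<times>
      (UNIV :: (nat \<times> nat \<times> nat \<times> nat \<times> nat \<times> nat) set))"
    by (intro countable_SIGMA countable_Collect_finite) simp
  ultimately have "countable (?f ` {M. wf_otm M})" by (rule countable_subset)
  moreover have "inj ?f" by (rule injI) simp
  ultimately show ?thesis using countable_image_inj_on inj_on_subset by blast
qed

fun wf_constr :: "constr \<Rightarrow> bool" where
  "wf_constr (CPair M1 M2 k) \<longleftrightarrow> wf_otm M1 \<and> wf_otm M2"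
| "wf_constr (CUP M k) \<longleftrightarrow> wf_otm M"
| "wf_constr (CNP M1 M2 k) \<longleftrightarrow> wf_otm M1 \<and> wf_otm M2"
| "wf_constr (CCo M1 M2 k) \<longleftrightarrow> wf_otm M1 \<and> wf_otm M2"

lemma countable_wf_constr: "countable {c. wf_constr c}"
proof -
  let ?W = "{M. wf_otm M}"
  have "{c. wf_constr c} \<subseteq> (\<lambda>(M, k). CUP M k) ` (?W \<times> UNIV) \<union>
    (\<lambda>(M1, M2, k). CPair M1 M2 k) ` (?W \<times> ?W \<times> UNIV) \<union>
    (\<lambda>(M1, M2, k). CNP M1 M2 k) ` (?W \<times> ?W \<times> UNIV) \<union>
    (\<lambda>(M1, M2, k). CCo M1 M2 k) ` (?W \<times> ?W \<times> UNIV)"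
  proof
    fix c assume "c \<in> {c. wf_constr c}"
    then show "c \<in> (\<lambda>(M, k). CUP M k) ` (?W \<times> UNIV) \<union>
      (\<lambda>(M1, M2, k). CPair M1 M2 k) ` (?W \<times> ?W \<times> UNIV) \<union>
      (\<lambda>(M1, M2, k). CNP M1 M2 k) ` (?W \<times> ?W \<times> UNIV) \<union>
      (\<lambda>(M1, M2, k). CCo M1 M2 k) ` (?W \<times> ?W \<times> UNIV)"
      by (cases c) (auto simp: image_iff)
  qed
  moreover have "countable \<dots>"
    by (intro countable_Un countable_image countable_SIGMA countable_wf_otm) auto
  ultimately show ?thesis by (rule countable_subset)
qed

lemma generic_sequence:
  fixes D :: "nat \<Rightarrow> (nat \<rightharpoonup> constr) \<Rightarrow> nat \<Rightarrow> lang \<Rightarrow> bool"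
  assumes dense: "\<And>i C N F. condition C N F \<Longrightarrow>
    \<exists>C' N' F'. condition C' N' F' \<and> extends (C, N, F) (C', N', F') \<and> D i C' N' F'"
  shows "\<exists>C N F A. \<forall>i. condition (C i) (N i) (F i) \<and> D i (C (Suc i)) (N (Suc i)) (F (Suc i)) \<and>
    A \<in> admissible (C i) (N i) (F i) \<and> (\<forall>j \<ge> i. N i \<le> N j \<and> (\<forall>d < N i. C j d = C i d))"
proof -
  define P where "P = (\<lambda>(C, N, F). condition C N F)"
  \<comment> \<open>The clause \<open>i \<le> N'\<close> makes the committed lengths grow without
    bound, so that the sequence decides every word.\<close>
  define R where "R = (\<lambda>i p (C', N', F'). extends p (C', N', F') \<and> D i C' N' F' \<and> i \<le> N')"
  have "\<exists>p. \<forall>i. P (p i) \<and> R i (p i) (p (Suc i))"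
  proof (rule dependent_nat_choice)
    have "condition Map.empty 0 {}" unfolding condition_def Sat_def codes_ok_def is_code_def by simp
    then show "\<exists>p. P p" unfolding P_def by auto
    fix p i assume "P p"
    obtain C N F where p: "p = (C, N, F)" by (cases p) auto
    with \<open>P p\<close> have c: "condition C N F" unfolding P_def by simp
    then have "F \<in> admissible C N F" unfolding condition_def admissible_def by simp
    with c have "condition C (max N i) F" using condition_mono by simp
    then obtain C' N' F' where *: "condition C' N' F'" "extends (C, max N i, F) (C', N', F')" "D i C' N' F'"
      using dense by blast
    then have "P (C', N', F') \<and> R i p (C', N', F')"
      unfolding P_def R_def p extends_def by (auto elim: agree_mono)
    then show "\<exists>q. P q \<and> R i p q" by blast
  qed
  then obtain p where p: "\<And>i. P (p i)" "\<And>i. R i (p i) (p (Suc i))" by blast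
  define C N F where "C = (\<lambda>i. fst (p i))" and "N = (\<lambda>i. fst (snd (p i)))" and "F = (\<lambda>i. snd (snd (p i)))"
  have peq: "p i = (C i, N i, F i)" for i unfolding C_def N_def F_def by simp
  have c: "condition (C i) (N i) (F i)" for i using p(1)[of i] unfolding P_def peq by simp
  have st: "N i \<le> N (Suc i)" "\<And>d. d < N i \<Longrightarrow> C (Suc i) d = C i d" "agree (N i) (F i) (F (Suc i))"
    "D i (C (Suc i)) (N (Suc i)) (F (Suc i))" "i \<le> N (Suc i)" for i
    using p(2)[of i] unfolding R_def peq extends_def by auto
  have mono: "N i \<le> N j \<and> (\<forall>d < N i. C j d = C i d) \<and> agree (N i) (F i) (F j)" if "i \<le> j" for i j
    using that
  proof (induction rule: dec_induct)
    case (step n)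
    then have IH: "N i \<le> N n" "\<And>d. d < N i \<Longrightarrow> C n d = C i d" "agree (N i) (F i) (F n)" by auto
    then have "agree (N i) (F i) (F (Suc n))" using agree_mono[OF st(3)] agree_trans by blast
    moreover have "C (Suc n) d = C i d" if "d < N i" for d using IH st(2)[of d n] that by simp
    moreover have "N i \<le> N (Suc n)" using IH(1) st(1)[of n] by linarith
    ultimately show ?case by blast
  qed simp
  \<comment> \<open>Stage \<open>Suc i\<close> commits all lengths below \<open>i\<close>, so stage
    \<open>length w + 2\<close> has decided \<open>w\<close>.\<close>
  define A where "A = {w. w \<in> F (Suc (Suc (length w)))}"
  have A: "agree (N i) (F i) A" for i
    unfolding agree_def
  proof (intro allI impI)
    fix w :: word assume w: "length w < N i"
    let ?m = "Suc (Suc (length w))"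
    have wm: "length w < N ?m" using st(5)[of "Suc (length w)"] by linarith
    show "w \<in> F i \<longleftrightarrow> w \<in> A"
    proof (cases "i \<le> ?m")
      case True
      then show ?thesis using mono[OF True] w unfolding agree_def A_def by simp
    next
      case False
      then show ?thesis using mono[of ?m i] wm unfolding agree_def A_def by simp
    qed
  qed
  have "Sat (C i) A" for i
  proof (rule Sat_limit)
    fix m
    let ?j = "max i (Suc m)"
    have "Sat (C ?j) (F ?j)" using c unfolding condition_def by blast
    then have "Sat (C ?j |` {..<N i}) (F ?j)" by (rule Sat_restrict)
    moreover have "C ?j |` {..<N i} = C i"
    proof
      fix d
      have "d < N i" if "C i d \<noteq> None" using c[of i] that unfolding condition_def by blast
      then show "(C ?j |` {..<N i}) d = C i d"
        using mono[of i ?j] by (cases "C i d") (auto simp: restrict_map_def)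
    qed
    moreover have "m \<le> N ?j" using st(5)[of m] mono[of "Suc m" ?j] by simp
    then have "agree m (F ?j) A" using A agree_mono by blast
    ultimately show "\<exists>B. Sat (C i) B \<and> agree m B A" by metis
  qed
  then have "\<forall>i. condition (C i) (N i) (F i) \<and> D i (C (Suc i)) (N (Suc i)) (F (Suc i)) \<and>
    A \<in> admissible (C i) (N i) (F i) \<and> (\<forall>j \<ge> i. N i \<le> N j \<and> (\<forall>d < N i. C j d = C i d))"
    using c st(4) A mono unfolding admissible_def by blast
  then show ?thesis by blast
qed

text \<open>Two families of requirements are enumerated together: destroy or adopt \<open>c\<close>,
  and defeat the transducer \<open>T\<close> with clock \<open>k\<close> at index \<open>d\<close>.
  The second family ranges over all \<open>d\<close> because the index at which \<open>c\<close>
  will be adopted is not known in advance.\<close>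

theorem generic_oracle:
  obtains A where "\<And>c. wf_constr c \<Longrightarrow> destroyed c A \<or>
    (\<exists>d. fsat d c A \<and> codes_ok [d \<mapsto> c] A \<and> (\<forall>T k. wf_otm T \<longrightarrow> deterministic T \<longrightarrow> fails T k d c A))"
proof -
  define TS where "TS = {c. wf_constr c} <+> (UNIV :: nat set) \<times> {c. wf_constr c} \<times> {T. wf_otm T} \<times> (UNIV :: nat set)"
  have "countable TS"
    unfolding TS_def
    by (intro countable_Plus countable_SIGMA countable_wf_constr countable_wf_otm) auto
  then have inj: "inj_on (to_nat_on TS) TS" by (rule inj_on_to_nat_on)
  define Req where "Req = (\<lambda>\<tau> C N F. case \<tau> of
      Inl c \<Rightarrow> (\<forall>A \<in> admissible C N F. destroyed c A) \<or> (\<exists>d < N. C d = Some c)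
    | Inr (d, c, T, k) \<Rightarrow> deterministic T \<longrightarrow> d < N \<and> (C d = Some c \<longrightarrow> (\<forall>A \<in> admissible C N F. fails T k d c A)))"
  have dense: "\<exists>C' N' F'. condition C' N' F' \<and> extends (C, N, F) (C', N', F') \<and>
      (\<forall>\<tau> \<in> TS. to_nat_on TS \<tau> = i \<longrightarrow> Req \<tau> C' N' F')" if c: "condition C N F" for i C N F
  proof (cases "\<exists>\<tau> \<in> TS. to_nat_on TS \<tau> = i")
    case False
    moreover have "extends (C, N, F) (C, N, F)" unfolding extends_def by simp
    ultimately show ?thesis using c by blast
  next
    case True
    then obtain \<tau> where \<tau>: "\<tau> \<in> TS" "to_nat_on TS \<tau> = i" by blast
    have "\<exists>C' N' F'. condition C' N' F' \<and> extends (C, N, F) (C', N', F') \<and> Req \<tau> C' N' F'"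
    proof (cases \<tau>)
      case (Inl c')
      then show ?thesis using dense_constraint[OF c] unfolding Req_def by simp
    next
      case (Inr t)
      obtain d c' T k where t: "t = (d, c', T, k)" by (cases t) auto
      have T: "wf_otm T" using \<tau>(1) unfolding TS_def Inr t by auto
      show ?thesis
      proof (cases "deterministic T")
        case True
        then show ?thesis using dense_diagonalization[OF c T True] unfolding Req_def Inr t by simp
      next
        case False
        moreover have "extends (C, N, F) (C, N, F)" unfolding extends_def by simp
        ultimately show ?thesis using c unfolding Req_def Inr t by auto
      qed
    qed
    moreover have "\<tau>' = \<tau>" if "\<tau>' \<in> TS" "to_nat_on TS \<tau>' = i" for \<tau>'
      using inj \<tau> that unfolding inj_on_def by blast
    ultimately show ?thesis by blast
  qed
  have "\<exists>C N F A. \<forall>i. condition (C i) (N i) (F i) \<and>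
    (\<forall>\<tau> \<in> TS. to_nat_on TS \<tau> = i \<longrightarrow> Req \<tau> (C (Suc i)) (N (Suc i)) (F (Suc i))) \<and>
    A \<in> admissible (C i) (N i) (F i) \<and> (\<forall>j \<ge> i. N i \<le> N j \<and> (\<forall>d < N i. C j d = C i d))"
    by (rule generic_sequence[where D = "\<lambda>i C N F. \<forall>\<tau> \<in> TS. to_nat_on TS \<tau> = i \<longrightarrow> Req \<tau> C N F"])
      (rule dense)
  then obtain C N F A where G0: "\<forall>i. condition (C i) (N i) (F i) \<and>
    (\<forall>\<tau> \<in> TS. to_nat_on TS \<tau> = i \<longrightarrow> Req \<tau> (C (Suc i)) (N (Suc i)) (F (Suc i))) \<and>
    A \<in> admissible (C i) (N i) (F i) \<and> (\<forall>j \<ge> i. N i \<le> N j \<and> (\<forall>d < N i. C j d = C i d))"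
    by (elim exE)
  have G2: "\<exists>i. Req \<tau> (C i) (N i) (F i)" if "\<tau> \<in> TS" for \<tau> using G0 that by blast
  have G3: "A \<in> admissible (C i) (N i) (F i)" for i using G0 by blast
  have G4: "\<forall>d < N i. C j d = C i d" if "i \<le> j" for i j using G0 that by blast
  have "destroyed c A \<or> (\<exists>d. fsat d c A \<and> codes_ok [d \<mapsto> c] A \<and>
      (\<forall>T k. wf_otm T \<longrightarrow> deterministic T \<longrightarrow> fails T k d c A))" if wc: "wf_constr c" for c
  proof -
    have "Inl c \<in> TS" unfolding TS_def using wc by auto
    then obtain i where "Req (Inl c) (C i) (N i) (F i)" using G2 by blast
    then consider "destroyed c A" | d where "d < N i" "C i d = Some c"
      unfolding Req_def using G3[of i] by auto
    then show ?thesis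
    proof cases
      case d: 2
      have S: "Sat (C i) A" using G3[of i] unfolding admissible_def by blast
      then have f: "fsat d c A" using d unfolding Sat_def by blast
      have "is_code [d \<mapsto> c] w M1 M2 k x \<Longrightarrow> is_code (C i) w M1 M2 k x" for w M1 M2 k x
        using d(2) unfolding is_code_def by (auto split: if_splits)
      then have co: "codes_ok [d \<mapsto> c] A" using S unfolding Sat_def codes_ok_def by blast
      have "fails T k d c A" if T: "wf_otm T" "deterministic T" for T k
      proof -
        have "Inr (d, c, T, k) \<in> TS" unfolding TS_def using wc T by auto
        then obtain j where "Req (Inr (d, c, T, k)) (C j) (N j) (F j)" using G2 by blast
        then have j: "d < N j" "C j d = Some c \<longrightarrow> (\<forall>A \<in> admissible (C j) (N j) (F j). fails T k d c A)"
          using T(2) unfolding Req_def by auto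
        have "C j d = Some c"
        proof (cases "i \<le> j")
          case True
          then show ?thesis using G4[OF True] d by simp
        next
          case False
          then have "j \<le> i" by simp
          from G4[OF this] show ?thesis using d(2) j(1) by simp
        qed
        then show ?thesis using j(2) G3[of j] by blast
      qed
      then show ?thesis using f co by blast
    qed simp
  qed
  then show ?thesis using that by blast
qed

section \<open>Machines on explicit configurations\<close>

lemma poly_le_bnd: "\<exists>k. \<forall>n. poly p n \<le> bnd k n" for p :: "nat poly"
proof (induction p)
  case (pCons a p)
  then obtain k where k: "\<And>n. poly p n \<le> bnd k n" by blast
  have "poly (pCons a p) n \<le> bnd (Suc (max a (Suc k))) n" for n
  proof -
    have "n * poly p n \<le> (n + 2) * bnd k n" using k[of n] by (intro mult_mono) auto
    also have "\<dots> = bnd (Suc k) n" unfolding bnd_def by simp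
    also have "\<dots> \<le> bnd (max a (Suc k)) n" by (intro bnd_mono) auto
    finally have "n * poly p n \<le> bnd (max a (Suc k)) n" .
    moreover have "a \<le> bnd (max a (Suc k)) n"
      using bnd_ge_const[of a n] bnd_mono[of a "max a (Suc k)" n n] by simp
    ultimately show ?thesis using bnd_add[of "max a (Suc k)" n] by simp
  qed
  then show ?case by blast
qed (auto simp: bnd_def)

lemma poly_time_bnd:
  assumes "poly_time M A"
  obtains k where "\<And>x ps k'. computation M A x ps \<Longrightarrow> k \<le> k' \<Longrightarrow> length ps \<le> bnd k' (length x)"
proof -
  obtain p where p: "\<forall>x cs. computation M A x cs \<longrightarrow> length cs \<le> poly p (length x) + 1"
    using assms unfolding poly_time_def by blast
  obtain k where k: "\<forall>n. poly (p + [:1:]) n \<le> bnd k n" using poly_le_bnd by blast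
  have "length ps \<le> bnd k' (length x)" if "computation M A x ps" "k \<le> k'" for x ps k'
  proof -
    have "length ps \<le> poly p (length x) + 1" using p that(1) by blast
    also have "\<dots> \<le> bnd k (length x)" using k by simp
    also have "\<dots> \<le> bnd k' (length x)" using that(2) by (intro bnd_mono) auto
    finally show ?thesis .
  qed
  then show ?thesis using that by blast
qed

lemma deterministic_run:
  assumes "wf_otm M" "deterministic M" "(step M A ^^ n) (init_conf M x) c" "\<And>c'. \<not> step M A c c'"
  shows "computation M A x ps \<Longrightarrow> length ps \<le> Suc n"
    and "x \<in> accepted_lang M A \<longleftrightarrow> state c = q_acc M"
proof -
  obtain f where f: "f 0 = init_conf M x" "f n = c" "\<forall>i < n. step M A (f i) (f (Suc i))"
    using assms(3) unfolding relpowp_fun_conv by blast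
  define cs where "cs = map f [0..<Suc n]"
  have cs: "computation M A x cs"
    unfolding computation_def successively_conv_nth cs_def
    using f by (auto simp: hd_map nth_append simp del: upt_Suc)
  have l: "last cs = c" "length cs = Suc n" unfolding cs_def using f by auto
  show b: "length ps \<le> Suc n" if "computation M A x ps" for ps
    using deterministic_halting_maximal[OF assms(1,2) cs that] assms(4) l by simp
  show "x \<in> accepted_lang M A \<longleftrightarrow> state c = q_acc M"
  proof
    assume "state c = q_acc M"
    then show "x \<in> accepted_lang M A"
      unfolding accepted_lang_def accepting_paths_def using cs l by blast
  next
    assume "x \<in> accepted_lang M A"
    then obtain ps where ps: "ps \<in> accepting_paths M A x" unfolding accepted_lang_def by blast
    then have pc: "computation M A x ps" unfolding accepting_paths_def by blast
    have "length cs \<le> length ps" using accepting_path_maximal[OF assms(1,2) ps cs] .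
    then have "length ps = length cs" using b[OF pc] l by simp
    then have "ps = cs" using deterministic_prefix[OF assms(1,2) pc cs] by (intro nth_equalityI) auto
    then show "state c = q_acc M" using ps l unfolding accepting_paths_def by simp
  qed
qed

text \<open>The form of configuration shared by the two machines below: the query tape is only
  appended to, so its head always reads \<open>Blank\<close>, and tape 2 holds at most a mark. All
  reasoning about tapes is thereby confined to \<open>step_cnf\<close>.\<close>

definition cnf :: "nat \<Rightarrow> word \<Rightarrow> nat \<Rightarrow> word \<Rightarrow> sym \<Rightarrow> conf" where
  "cnf q x h v m = \<lparr>state = q,
     tape = (\<lambda>i. if i = 0 then input_tape x else if i = 1 then input_tape v
                 else if i = 2 then (\<lambda>_. Blank)(0 := m) else (\<lambda>_. Blank)),
     head = (\<lambda>i. if i = 0 then int h else if i = 1 then int (length v) else 0)\<rparr>"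

definition tr :: "nat \<Rightarrow> sym \<Rightarrow> sym \<Rightarrow> nat \<Rightarrow> bool option \<Rightarrow> bool \<Rightarrow> sym \<Rightarrow>
    nat \<times> sym list \<times> nat \<times> sym list \<times> dir list" where
  "tr q s m q' ob mv m' = (q, [s, Blank, m], q',
     [s, (case ob of None \<Rightarrow> Blank | Some b \<Rightarrow> Bit b), m'],
     [if mv then MoveR else Stay, (case ob of None \<Rightarrow> Stay | Some b \<Rightarrow> MoveR), Stay])"

lemma tr_inj [simp]: "tr q s m q' ob mv m' = tr p s2 m2 p' ob2 mv2 m2' \<longleftrightarrow>
    q = p \<and> s = s2 \<and> m = m2 \<and> q' = p' \<and> ob = ob2 \<and> mv = mv2 \<and> m' = m2'"
  unfolding tr_def by (auto split: option.splits if_splits)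

definition rd :: "word \<Rightarrow> nat \<Rightarrow> sym" where
  "rd x h = (if h < length x then Bit (x ! h) else Blank)"

lemma input_tape_rd: "input_tape x (int h) = rd x h"
  by (simp add: input_tape_def rd_def)

lemma input_tape_snoc: "(input_tape v)(int (length v) := Bit b) = input_tape (v @ [b])"
  by (rule ext) (auto simp: input_tape_def nth_append nat_less_iff)

lemma input_tape_same: "(input_tape x)(int h := rd x h) = input_tape x"
  by (rule ext) (auto simp: input_tape_rd)

lemma tape_word_input_tape: "tape_word (input_tape v) w \<longleftrightarrow> w = v"
proof -
  have "tape_word (input_tape v) v" unfolding tape_word_def input_tape_def by auto
  then show ?thesis using tape_word_unique by blast
qed

lemma init_conf_cnf: "init_conf M x = cnf (q_start M) x 0 [] Blank"
  unfolding init_conf_def cnf_def input_tape_def by (auto simp: fun_eq_iff)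

fun ostr :: "bool option \<Rightarrow> word" where
  "ostr None = []"
| "ostr (Some b) = [b]"

lemma step_cnf:
  assumes M: "n_tapes M = 3" "\<And>a. a \<in> delta M \<Longrightarrow> \<exists>q s m q' ob mv m'. a = tr q s m q' ob mv m'"
  shows "step M A (cnf q x h v m) c \<longleftrightarrow>
    (\<exists>q' ob mv m'. tr q (rd x h) m q' ob mv m' \<in> delta M \<and>
       c = cnf q' x (if mv then Suc h else h) (v @ ostr ob) m') \<or>
    q = q_query M \<and> c = cnf (if v \<in> A then q_yes M else q_no M) x h v m" (is "?L \<longleftrightarrow> ?R")
proof -
  have three: "[0..<n_tapes M] = [0, 1, 2]" unfolding M(1) by (simp add: upt_rec)
  have reads: "map (\<lambda>i. tape (cnf q x h v m) i (head (cnf q x h v m) i)) [0..<n_tapes M] = [rd x h, Blank, m]"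
    unfolding three by (simp add: cnf_def input_tape_rd) (simp add: rd_def)
  have upd: "\<lparr>state = q',
       tape = (\<lambda>i. if i < n_tapes M then (tape (cnf q x h v m) i)(head (cnf q x h v m) i := ws ! i)
          else tape (cnf q x h v m) i),
       head = (\<lambda>i. if i < n_tapes M then head (cnf q x h v m) i + shift (ds ! i) else head (cnf q x h v m) i)\<rparr> =
      cnf q' x (if mv then Suc h else h) (v @ ostr ob) m'"
    if "(p, rs, p', ws, ds) = tr q (rd x h) m q' ob mv m'" for p rs p' q' ws ds ob mv m'
  proof -
    have ws: "ws = [rd x h, (case ob of None \<Rightarrow> Blank | Some b \<Rightarrow> Bit b), m']"
      and ds: "ds = [if mv then MoveR else Stay, (case ob of None \<Rightarrow> Stay | Some b \<Rightarrow> MoveR), Stay]"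
      using that unfolding tr_def by auto
    have b: "(input_tape v)(int (length v) := Blank) = input_tape v"
      using input_tape_same[of v "length v"] by (simp add: rd_def)
    have v': "(input_tape v)(int (length v) := (case ob of None \<Rightarrow> Blank | Some b \<Rightarrow> Bit b)) =
        input_tape (v @ ostr ob)"
      by (cases ob) (simp_all add: b input_tape_snoc)
    have m: "((\<lambda>_. Blank)(0 := m))(0 := m') = (\<lambda>_ :: int. Blank)(0 := m')" by simp
    have "(if i < 3 then (tape (cnf q x h v m) i)(head (cnf q x h v m) i := ws ! i)
        else tape (cnf q x h v m) i) = tape (cnf q' x (if mv then Suc h else h) (v @ ostr ob) m') i" for i
    proof -
      consider "i = 0" | "i = 1" | "i = 2" | "i > 2" by linarith
      then show ?thesis
        by cases (simp_all add: cnf_def ws input_tape_same v')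
    qed
    moreover have "(if i < 3 then head (cnf q x h v m) i + shift (ds ! i) else head (cnf q x h v m) i) =
        head (cnf q' x (if mv then Suc h else h) (v @ ostr ob) m') i" for i
    proof -
      consider "i = 0" | "i = 1" | "i = 2" | "i > 2" by linarith
      then show ?thesis
        by cases (cases ob; simp add: cnf_def ds)+
    qed
    ultimately show ?thesis
      unfolding M(1) by (intro conf.equality) (simp_all add: cnf_def)
  qed
  show ?thesis
  proof
    assume ?L
    then show ?R
    proof cases
      case (move q0 rs q' ws ds)
      have rs: "rs = [rd x h, Blank, m]" using move reads by simp
      obtain p s m0 p' ob mv m' where t: "(q0, rs, q', ws, ds) = tr p s m0 p' ob mv m'"
        using M(2) move(2) by blast
      then have "p = q" "s = rd x h" "m0 = m" "p' = q'"
        using rs move(3) unfolding tr_def by (auto simp: cnf_def)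
      then have t: "(q0, rs, q', ws, ds) = tr q (rd x h) m q' ob mv m'" using t by simp
      have "c = cnf q' x (if mv then Suc h else h) (v @ ostr ob) m'"
        unfolding move(1) by (rule upd[OF t])
      moreover have "tr q (rd x h) m q' ob mv m' \<in> delta M" using move(2) t by simp
      ultimately show ?thesis by blast
    next
      case (ask w)
      then have "w = v" using tape_word_input_tape by (simp add: cnf_def)
      then show ?thesis using ask by (auto simp: cnf_def)
    qed
  next
    assume ?R
    then show ?L
    proof
      assume "\<exists>q' ob mv m'. tr q (rd x h) m q' ob mv m' \<in> delta M \<and>
         c = cnf q' x (if mv then Suc h else h) (v @ ostr ob) m'"
      then obtain q' ob mv m' where t: "tr q (rd x h) m q' ob mv m' \<in> delta M"
        "c = cnf q' x (if mv then Suc h else h) (v @ ostr ob) m'" by blast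
      obtain ws ds where tt: "(q, [rd x h, Blank, m], q', ws, ds) = tr q (rd x h) m q' ob mv m'"
        unfolding tr_def by blast
      have "state (cnf q x h v m) = q" by (simp add: cnf_def)
      from step.move[OF t(1)[folded tt] this reads[symmetric], of A] show ?L
        unfolding t(2) using upd[OF tt] by simp
    next
      assume a: "q = q_query M \<and> c = cnf (if v \<in> A then q_yes M else q_no M) x h v m"
      then have "step M A (cnf q x h v m) ((cnf q x h v m)\<lparr>state := (if v \<in> A then q_yes M else q_no M)\<rparr>)"
        by (intro step.ask) (auto simp: cnf_def tape_word_input_tape)
      then show ?L using a by (simp add: cnf_def)
    qed
  qed
qed

lemma state_cnf [simp]: "state (cnf q x h v m) = q"
  by (simp add: cnf_def)

lemma rd_cases: "rd x h \<in> {Blank, Bit False, Bit True}"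
  unfolding rd_def by (cases "x ! h") auto

lemma rd_eq_Bit: "(\<exists>a. rd x h = Bit a) \<longleftrightarrow> h < length x"
  and rd_eq_Blank: "rd x h = Blank \<longleftrightarrow> \<not> h < length x"
  unfolding rd_def by auto

lemma wf_otm_tr:
  assumes "n_tapes M = 3" "finite (delta M)" "q_acc M \<noteq> q_query M"
    and "\<And>a. a \<in> delta M \<Longrightarrow> \<exists>q s m q' ob mv m'. a = tr q s m q' ob mv m' \<and> q \<noteq> q_acc M \<and> q \<noteq> q_query M"
  shows "wf_otm M"
  unfolding wf_otm_def using assms by (fastforce simp: tr_def)

section \<open>A nondeterministic machine for the guessed languages\<close>

definition guess_delta :: "word \<Rightarrow> (nat \<times> sym list \<times> nat \<times> sym list \<times> dir list) set" where
  "guess_delta u =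
     (\<lambda>(i, s). tr i s Blank (Suc i) (Some (u ! i)) False Blank) ` ({..<length u} \<times> {Blank, Bit False, Bit True}) \<union>
     (\<lambda>(a, b). tr (length u) (Bit a) Blank (length u) (Some b) True Blank) ` UNIV \<union>
     {tr (length u) Blank Blank (Suc (length u)) None False Blank}"

definition guess_machine :: "word \<Rightarrow> otm" where
  "guess_machine u = \<lparr>n_tapes = 3, delta = guess_delta u, q_start = 0, q_acc = length u + 2,
     q_query = length u + 1, q_yes = length u + 2, q_no = length u + 3\<rparr>"

lemma guess_delta_tr:
  "a \<in> guess_delta u \<Longrightarrow> \<exists>q s m q' ob mv m'. a = tr q s m q' ob mv m' \<and> q \<le> length u"
  unfolding guess_delta_def by (auto; fastforce)

lemma wf_guess_machine: "wf_otm (guess_machine u)"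
proof (rule wf_otm_tr)
  show "finite (delta (guess_machine u))" by (simp add: guess_machine_def guess_delta_def)
  fix a assume "a \<in> delta (guess_machine u)"
  then show "\<exists>q s m q' ob mv m'. a = tr q s m q' ob mv m' \<and> q \<noteq> q_acc (guess_machine u) \<and> q \<noteq> q_query (guess_machine u)"
    using guess_delta_tr[of a u] by (fastforce simp: guess_machine_def)
qed (simp_all add: guess_machine_def)

lemma step_guess_machine:
  "step (guess_machine u) A (cnf q x h v Blank) c \<longleftrightarrow>
     q < length u \<and> c = cnf (Suc q) x h (v @ [u ! q]) Blank \<or>
     q = length u \<and> h < length x \<and> (\<exists>b. c = cnf (length u) x (Suc h) (v @ [b]) Blank) \<or>
     q = length u \<and> \<not> h < length x \<and> c = cnf (Suc (length u)) x h v Blank \<or>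
     q = Suc (length u) \<and> c = cnf (if v \<in> A then length u + 2 else length u + 3) x h v Blank"
proof -
  have mem: "tr q (rd x h) Blank q' ob mv m' \<in> guess_delta u \<longleftrightarrow> m' = Blank \<and>
     (q < length u \<and> q' = Suc q \<and> ob = Some (u ! q) \<and> \<not> mv \<or>
      q = length u \<and> h < length x \<and> q' = length u \<and> (\<exists>b. ob = Some b) \<and> mv \<or>
      q = length u \<and> \<not> h < length x \<and> q' = Suc (length u) \<and> ob = None \<and> \<not> mv)" for q' ob mv m'
    unfolding guess_delta_def using rd_cases[of x h] rd_eq_Bit[of x h] rd_eq_Blank[of x h]
    by (auto simp: image_iff)
  have tr: "\<exists>q s m q' ob mv m'. a = tr q s m q' ob mv m'" if "a \<in> delta (guess_machine u)" for a
    using guess_delta_tr[of a u] that unfolding guess_machine_def by auto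
  have "step (guess_machine u) A (cnf q x h v Blank) c \<longleftrightarrow>
    (\<exists>q' ob mv m'. tr q (rd x h) Blank q' ob mv m' \<in> delta (guess_machine u) \<and>
       c = cnf q' x (if mv then Suc h else h) (v @ ostr ob) m') \<or>
    q = q_query (guess_machine u) \<and>
    c = cnf (if v \<in> A then q_yes (guess_machine u) else q_no (guess_machine u)) x h v Blank"
  proof (rule step_cnf)
    show "n_tapes (guess_machine u) = 3" by (simp add: guess_machine_def)
  qed (rule tr)
  moreover have "delta (guess_machine u) = guess_delta u" "q_query (guess_machine u) = Suc (length u)"
    "q_yes (guess_machine u) = length u + 2" "q_no (guess_machine u) = length u + 3"
    by (simp_all add: guess_machine_def)
  ultimately have "step (guess_machine u) A (cnf q x h v Blank) c \<longleftrightarrow>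
    (\<exists>q' ob mv m'. tr q (rd x h) Blank q' ob mv m' \<in> guess_delta u \<and>
       c = cnf q' x (if mv then Suc h else h) (v @ ostr ob) m') \<or>
    q = Suc (length u) \<and> c = cnf (if v \<in> A then length u + 2 else length u + 3) x h v Blank"
    by simp
  then show ?thesis
    unfolding mem
    by (cases "q < length u"; cases "q = length u"; cases "h < length x"; cases "u ! q")
      (simp_all add: split_option_ex ex_bool_eq)
qed

text \<open>The run that guesses \<open>z\<close>, in closed form: \<open>length u\<close> steps
  write the prefix, \<open>length x\<close> steps guess, one enters the query state and one asks,
  which makes \<open>length u + length x + 3\<close> configurations.\<close>

definition guess_conf :: "word \<Rightarrow> lang \<Rightarrow> word \<Rightarrow> word \<Rightarrow> nat \<Rightarrow> conf" where
  "guess_conf u A x z j =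
     (if j \<le> length u then cnf j x 0 (take j u) Blank
      else if j \<le> length u + length x then cnf (length u) x (j - length u) (u @ take (j - length u) z) Blank
      else if j = Suc (length u + length x) then cnf (Suc (length u)) x (length x) (u @ z) Blank
      else cnf (if u @ z \<in> A then length u + 2 else length u + 3) x (length x) (u @ z) Blank)"

lemma step_guess_conf:
  assumes "length z = length x" "j < length u + length x + 2"
  shows "step (guess_machine u) A (guess_conf u A x z j) (guess_conf u A x z (Suc j))"
proof -
  consider "j < length u" | "length u \<le> j" "j < length u + length x" | "j = length u + length x"
    | "j = Suc (length u + length x)" using assms(2) by linarith
  then show ?thesis
  proof cases
    case 1
    then show ?thesis by (simp add: guess_conf_def step_guess_machine take_Suc_conv_app_nth)
  next
    case 2
    then obtain i where i: "j = length u + i" "i < length x" by (metis le_Suc_ex nat_add_left_cancel_less)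
    have "guess_conf u A x z j = cnf (length u) x i (u @ take i z) Blank"
      using i by (cases i) (auto simp: guess_conf_def)
    moreover have "guess_conf u A x z (Suc j) = cnf (length u) x (Suc i) ((u @ take i z) @ [z ! i]) Blank"
      using i assms(1) by (simp add: guess_conf_def take_Suc_conv_app_nth Suc_diff_le)
    ultimately show ?thesis using i by (simp add: step_guess_machine) blast
  next
    case 3
    then have "guess_conf u A x z j = cnf (length u) x (length x) (u @ z) Blank"
      using assms(1) by (cases "length x") (auto simp: guess_conf_def)
    moreover have "guess_conf u A x z (Suc j) = cnf (Suc (length u)) x (length x) (u @ z) Blank"
      using 3 by (simp add: guess_conf_def)
    ultimately show ?thesis by (simp add: step_guess_machine)
  next
    case 4
    then show ?thesis by (simp add: guess_conf_def step_guess_machine)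
  qed
qed

lemma computation_guess_machine:
  assumes "computation (guess_machine u) A x ps" "j < length ps"
  shows "j \<le> length u + length x + 2 \<and> (\<exists>z. length z = length x \<and> (\<forall>i \<le> j. ps ! i = guess_conf u A x z i))"
  using assms(2)
proof (induction j)
  case 0
  have "ps ! 0 = init_conf (guess_machine u) x"
    using assms(1) unfolding computation_def by (metis hd_conv_nth)
  then show ?case
    by (intro conjI exI[of _ x]) (auto simp: init_conf_cnf guess_machine_def guess_conf_def)
next
  case (Suc j)
  then obtain z where z: "j \<le> length u + length x + 2" "length z = length x"
    "\<And>i. i \<le> j \<Longrightarrow> ps ! i = guess_conf u A x z i" by auto
  have st: "step (guess_machine u) A (guess_conf u A x z j) (ps ! Suc j)"
    using assms(1) Suc.prems z(3)[of j] unfolding computation_def successively_conv_nth by auto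
  have ok: ?case if "Suc j \<le> length u + length x + 2" "length y = length x"
      "\<And>i. i \<le> j \<Longrightarrow> guess_conf u A x y i = guess_conf u A x z i" "ps ! Suc j = guess_conf u A x y (Suc j)" for y
    using that z(3) by (auto simp: le_Suc_eq intro!: exI[of _ y])
  consider "j < length u" | "length u \<le> j" "j < length u + length x" | "j = length u + length x"
    | "j = Suc (length u + length x)" | "j = length u + length x + 2" using z(1) by linarith
  then show ?case
  proof cases
    case 1
    then have "ps ! Suc j = guess_conf u A x z (Suc j)"
      using st by (simp add: guess_conf_def step_guess_machine take_Suc_conv_app_nth)
    then show ?thesis using ok[of z] 1 z(2) by simp
  next
    case 2
    then obtain i where i: "j = length u + i" "i < length x" by (metis le_Suc_ex nat_add_left_cancel_less)
    have "guess_conf u A x z j = cnf (length u) x i (u @ take i z) Blank"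
      using i by (cases i) (auto simp: guess_conf_def)
    then obtain b where b: "ps ! Suc j = cnf (length u) x (Suc i) ((u @ take i z) @ [b]) Blank"
      using st i by (auto simp: step_guess_machine)
    \<comment> \<open>The bit just guessed is entered into the witness; the configurations so far
      show only the first \<open>i\<close> bits and are unchanged.\<close>
    let ?y = "z[i := b]"
    have "ps ! Suc j = guess_conf u A x ?y (Suc j)"
      unfolding b using i z(2) by (simp add: guess_conf_def take_Suc_conv_app_nth Suc_diff_le)
    moreover have "guess_conf u A x ?y l = guess_conf u A x z l" if "l \<le> j" for l
      using that i by (auto simp: guess_conf_def)
    ultimately show ?thesis using ok[of ?y] i z(2) by simp
  next
    case 3
    then have "guess_conf u A x z j = cnf (length u) x (length x) (u @ z) Blank"
      using z(2) by (cases "length x") (auto simp: guess_conf_def)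
    then have "ps ! Suc j = guess_conf u A x z (Suc j)"
      using st 3 by (simp add: guess_conf_def step_guess_machine)
    then show ?thesis using ok[of z] 3 z(2) by simp
  next
    case 4
    then have "ps ! Suc j = guess_conf u A x z (Suc j)"
      using st by (simp add: guess_conf_def step_guess_machine)
    then show ?thesis using ok[of z] 4 z(2) by simp
  next
    case 5
    then show ?thesis using st by (simp add: guess_conf_def step_guess_machine split: if_splits)
  qed
qed

lemma accepting_path_guess_machine:
  assumes "ps \<in> accepting_paths (guess_machine u) A x"
  shows "\<exists>z. length z = length x \<and> u @ z \<in> A \<and> ps = map (guess_conf u A x z) [0..<length u + length x + 3]"
proof -
  have c: "computation (guess_machine u) A x ps" and s: "state (last ps) = length u + 2"
    using assms unfolding accepting_paths_def guess_machine_def by auto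
  then have ne: "ps \<noteq> []" unfolding computation_def by blast
  define j where "j = length ps - 1"
  have l: "length ps = Suc j" using ne unfolding j_def by (simp add: Suc_diff_1)
  then obtain z where z: "j \<le> length u + length x + 2" "length z = length x"
    "\<And>i. i \<le> j \<Longrightarrow> ps ! i = guess_conf u A x z i"
    using computation_guess_machine[OF c, of j] by auto
  have "last ps = guess_conf u A x z j" using z(3)[of j] l ne by (simp add: last_conv_nth)
  then have "j = length u + length x + 2 \<and> u @ z \<in> A"
    using s z(1) unfolding guess_conf_def by (auto split: if_splits)
  moreover have "ps = map (guess_conf u A x z) [0..<length u + length x + 3]"
    using z l calculation by (intro nth_equalityI) (auto simp del: upt_Suc)
  ultimately show ?thesis using z(2) by blast
qed

lemma accepted_guess_machine: "accepted_lang (guess_machine u) A = guessed u A"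
proof (intro equalityI subsetI)
  fix x assume "x \<in> accepted_lang (guess_machine u) A"
  then show "x \<in> guessed u A"
    unfolding accepted_lang_def guessed_def using accepting_path_guess_machine by blast
next
  fix x assume "x \<in> guessed u A"
  then obtain z where z: "length z = length x" "u @ z \<in> A" unfolding guessed_def by blast
  let ?ps = "map (guess_conf u A x z) [0..<length u + length x + 3]"
  have "hd ?ps = init_conf (guess_machine u) x"
    by (simp add: hd_map init_conf_cnf guess_machine_def guess_conf_def del: upt_Suc)
  then have "computation (guess_machine u) A x ?ps"
    unfolding computation_def successively_conv_nth using step_guess_conf[OF z(1)] by (simp del: upt_Suc)
  moreover have "last ?ps = guess_conf u A x z (length u + length x + 2)"
    by (simp add: last_map del: upt_Suc)
  then have "state (last ?ps) = q_acc (guess_machine u)"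
    using z(2) by (simp add: guess_conf_def guess_machine_def)
  ultimately show "x \<in> accepted_lang (guess_machine u) A"
    unfolding accepted_lang_def accepting_paths_def by blast
qed

lemma poly_time_guess_machine: "poly_time (guess_machine u) A"
  unfolding poly_time_def
proof (intro exI[of _ "[:length u + 2, 1:]"] allI impI)
  fix x ps assume c: "computation (guess_machine u) A x ps"
  then have "ps \<noteq> []" unfolding computation_def by blast
  then have "length ps - 1 \<le> length u + length x + 2"
    using computation_guess_machine[OF c, of "length ps - 1"] by simp
  then show "length ps \<le> poly [:length u + 2, 1:] (length x) + 1" by simp
qed

lemma guessed_in_UP:
  assumes "\<And>z z'. length z = length z' \<Longrightarrow> u @ z \<in> A \<Longrightarrow> u @ z' \<in> A \<Longrightarrow> z = z'"
  shows "guessed u A \<in> class_UP A"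
proof -
  have "unambiguous (guess_machine u) A"
    unfolding unambiguous_def
  proof (intro allI ballI)
    fix x ps ps' assume "ps \<in> accepting_paths (guess_machine u) A x" "ps' \<in> accepting_paths (guess_machine u) A x"
    then show "ps = ps'" using accepting_path_guess_machine[of _ u A x] assms by metis
  qed
  then show ?thesis
    unfolding class_UP_def using wf_guess_machine poly_time_guess_machine accepted_guess_machine by blast
qed

section \<open>A deterministic machine that finds and reads a code word\<close>

definition decide_delta :: "word \<Rightarrow> (nat \<times> sym list \<times> nat \<times> sym list \<times> dir list) set" where
  "decide_delta u =
     (\<lambda>(i, s). tr i s Blank (Suc i) (Some (u ! i)) False Blank) ` ({..<length u} \<times> {Blank, Bit False, Bit True}) \<union>
     (\<lambda>a. tr (length u) (Bit a) Blank (length u) (Some a) True Blank) ` UNIV \<union>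
     {tr (length u) Blank Blank (length u + 2) (Some False) False Blank,
      tr (length u + 2) Blank Blank (length u + 1) (Some True) False Blank,
      tr (length u + 3) Blank Blank (length u + 1) (Some False) False (Aux 0),
      tr (length u + 3) Blank (Aux 0) (length u + 4) None False (Aux 0)}"

text \<open>
  The machine copies \<open>u\<close> and the input \<open>x\<close> followed by \<open>0\<close> to the query tape and appends
  \<open>1\<close>s until the oracle contains the resulting word; then it appends \<open>0\<close> and accepts iff the
  oracle contains that word. So it never has to compute a polynomial. The mark on tape 2
  distinguishes the last query from the earlier ones.
\<close>

definition decide_machine :: "word \<Rightarrow> otm" where
  "decide_machine u = \<lparr>n_tapes = 3, delta = decide_delta u, q_start = 0, q_acc = length u + 4,
     q_query = length u + 1, q_yes = length u + 3, q_no = length u + 2\<rparr>"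

lemma decide_delta_tr:
  "a \<in> decide_delta u \<Longrightarrow>
     \<exists>q s m q' ob mv m'. a = tr q s m q' ob mv m' \<and> q \<noteq> length u + 1 \<and> q \<noteq> length u + 4"
  unfolding decide_delta_def by (auto; fastforce)

lemma wf_decide_machine: "wf_otm (decide_machine u)"
proof (rule wf_otm_tr)
  show "finite (delta (decide_machine u))" by (simp add: decide_machine_def decide_delta_def)
  fix a assume "a \<in> delta (decide_machine u)"
  then show "\<exists>q s m q' ob mv m'. a = tr q s m q' ob mv m' \<and> q \<noteq> q_acc (decide_machine u) \<and> q \<noteq> q_query (decide_machine u)"
    using decide_delta_tr[of a u] by (fastforce simp: decide_machine_def)
qed (simp_all add: decide_machine_def)

lemma deterministic_decide_machine: "deterministic (decide_machine u)"
  unfolding deterministic_def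
proof (intro allI impI)
  fix q rs a b assume "(q, rs, a) \<in> delta (decide_machine u)" "(q, rs, b) \<in> delta (decide_machine u)"
  then show "a = b" unfolding decide_machine_def decide_delta_def
    by (auto simp: tr_def)
qed

lemma step_decide_machine:
  "step (decide_machine u) A (cnf q x h v m) c \<longleftrightarrow>
    (\<exists>q' ob mv m'. tr q (rd x h) m q' ob mv m' \<in> decide_delta u \<and>
       c = cnf q' x (if mv then Suc h else h) (v @ ostr ob) m') \<or>
    q = length u + 1 \<and> c = cnf (if v \<in> A then length u + 3 else length u + 2) x h v m"
proof -
  have tr: "\<exists>q s m q' ob mv m'. a = tr q s m q' ob mv m'" if "a \<in> delta (decide_machine u)" for a
    using decide_delta_tr[of a u] that unfolding decide_machine_def by auto
  have "step (decide_machine u) A (cnf q x h v m) c \<longleftrightarrow>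
    (\<exists>q' ob mv m'. tr q (rd x h) m q' ob mv m' \<in> delta (decide_machine u) \<and>
       c = cnf q' x (if mv then Suc h else h) (v @ ostr ob) m') \<or>
    q = q_query (decide_machine u) \<and>
    c = cnf (if v \<in> A then q_yes (decide_machine u) else q_no (decide_machine u)) x h v m"
  proof (rule step_cnf)
    show "n_tapes (decide_machine u) = 3" by (simp add: decide_machine_def)
  qed (rule tr)
  then show ?thesis by (simp add: decide_machine_def)
qed

lemma decide_move:
  assumes "tr q (rd x h) m q' ob mv m' \<in> decide_delta u"
  shows "step (decide_machine u) A (cnf q x h v m) (cnf q' x (if mv then Suc h else h) (v @ ostr ob) m')"
  unfolding step_decide_machine using assms by blast

lemma decide_ask:
  "step (decide_machine u) A (cnf (length u + 1) x h v m)
     (cnf (if v \<in> A then length u + 3 else length u + 2) x h v m)"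
  unfolding step_decide_machine by simp

lemma decide_prefix:
  "i \<le> length u \<Longrightarrow> (step (decide_machine u) A ^^ i) (init_conf (decide_machine u) x) (cnf i x 0 (take i u) Blank)"
proof (induction i)
  case 0
  then show ?case by (simp add: init_conf_cnf decide_machine_def)
next
  case (Suc i)
  have "tr i (rd x 0) Blank (Suc i) (Some (u ! i)) False Blank \<in> decide_delta u"
    unfolding decide_delta_def using Suc.prems rd_cases[of x 0] by auto
  from decide_move[OF this, of A "take i u"] Suc show ?case
    by (auto simp: take_Suc_conv_app_nth)
qed

lemma decide_copy:
  "i \<le> length x \<Longrightarrow> (step (decide_machine u) A ^^ i) (cnf (length u) x 0 u Blank)
     (cnf (length u) x i (u @ take i x) Blank)"
proof (induction i)
  case (Suc i)
  have "tr (length u) (rd x i) Blank (length u) (Some (x ! i)) True Blank \<in> decide_delta u"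
    unfolding decide_delta_def using Suc.prems by (auto simp: rd_def)
  from decide_move[OF this, of A "u @ take i x"] Suc show ?case
    by (auto simp: take_Suc_conv_app_nth)
qed simp

text \<open>Each further 1 costs two steps, append and ask; a negative answer leads straight back to
  the appending state, which is \<open>q_no\<close>.\<close>

lemma decide_loop:
  assumes "\<And>t. t \<ge> 1 \<Longrightarrow> u @ x @ False # replicate t True \<in> A \<longleftrightarrow> B \<le> t" "t < B"
  shows "(step (decide_machine u) A ^^ (2 * t)) (cnf (length u + 2) x (length x) (u @ x @ [False]) Blank)
     (cnf (length u + 2) x (length x) (u @ x @ False # replicate t True) Blank)"
  using assms(2)
proof (induction t)
  case (Suc t)
  let ?L = "\<lambda>t. cnf (length u + 2) x (length x) (u @ x @ False # replicate t True) Blank"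
  have "tr (length u + 2) (rd x (length x)) Blank (length u + 1) (Some True) False Blank \<in> decide_delta u"
    unfolding decide_delta_def by (simp add: rd_def)
  from decide_move[OF this, of A "u @ x @ False # replicate t True"]
  have 1: "step (decide_machine u) A (?L t)
      (cnf (length u + 1) x (length x) (u @ x @ False # replicate (Suc t) True) Blank)"
    by (simp add: replicate_append_same)
  have "u @ x @ False # replicate (Suc t) True \<notin> A" using assms(1)[of "Suc t"] Suc.prems by simp
  then have "step (decide_machine u) A (cnf (length u + 1) x (length x) (u @ x @ False # replicate (Suc t) True) Blank)
      (?L (Suc t))"
    using decide_ask[of u A x "length x" "u @ x @ False # replicate (Suc t) True" Blank] by simp
  with 1 Suc show ?case by (auto simp: relcompp_apply) 
qed simp

lemma decide_run:
  assumes stop: "\<And>t. t \<ge> 1 \<Longrightarrow> u @ x @ False # replicate t True \<in> A \<longleftrightarrow> B \<le> t" and B: "B \<ge> 1"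
    and code: "u @ x @ False # replicate B True @ [False] \<in> A \<longleftrightarrow> P"
  shows "\<exists>n c. n \<le> length u + length x + 2 * B + 4 \<and>
    (step (decide_machine u) A ^^ n) (init_conf (decide_machine u) x) c \<and>
    (\<forall>c'. \<not> step (decide_machine u) A c c') \<and> (state c = q_acc (decide_machine u) \<longleftrightarrow> P)"
proof -
  let ?S = "step (decide_machine u) A"
  let ?n = "length x"
  let ?w = "u @ x @ False # replicate B True"
  have 1: "(?S ^^ length u) (init_conf (decide_machine u) x) (cnf (length u) x 0 u Blank)"
    using decide_prefix[of "length u" u A x] by simp
  have 2: "(?S ^^ ?n) (cnf (length u) x 0 u Blank) (cnf (length u) x ?n (u @ x) Blank)"
    using decide_copy[of ?n x u A] by simp
  have "tr (length u) (rd x ?n) Blank (length u + 2) (Some False) False Blank \<in> decide_delta u"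
    unfolding decide_delta_def by (simp add: rd_def)
  from decide_move[OF this, of A "u @ x"]
  have 3: "?S (cnf (length u) x ?n (u @ x) Blank) (cnf (length u + 2) x ?n (u @ x @ [False]) Blank)" by simp
  have 4: "(?S ^^ (2 * (B - 1))) (cnf (length u + 2) x ?n (u @ x @ [False]) Blank)
      (cnf (length u + 2) x ?n (u @ x @ False # replicate (B - 1) True) Blank)"
    using decide_loop[of u x A B "B - 1", OF stop] B by simp
  have "tr (length u + 2) (rd x ?n) Blank (length u + 1) (Some True) False Blank \<in> decide_delta u"
    unfolding decide_delta_def by (simp add: rd_def)
  from decide_move[OF this, of A "u @ x @ False # replicate (B - 1) True"]
  have 5: "?S (cnf (length u + 2) x ?n (u @ x @ False # replicate (B - 1) True) Blank)
      (cnf (length u + 1) x ?n ?w Blank)"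
    using B by (cases B) (auto simp: replicate_append_same)
  have 6: "?S (cnf (length u + 1) x ?n ?w Blank) (cnf (length u + 3) x ?n ?w Blank)"
    using decide_ask[of u A x ?n ?w Blank] stop[of B] B by simp
  have "tr (length u + 3) (rd x ?n) Blank (length u + 1) (Some False) False (Aux 0) \<in> decide_delta u"
    unfolding decide_delta_def by (simp add: rd_def)
  from decide_move[OF this, of A ?w]
  have 7: "?S (cnf (length u + 3) x ?n ?w Blank) (cnf (length u + 1) x ?n (?w @ [False]) (Aux 0))" by simp
  have 8: "?S (cnf (length u + 1) x ?n (?w @ [False]) (Aux 0))
      (cnf (if P then length u + 3 else length u + 2) x ?n (?w @ [False]) (Aux 0))"
    using decide_ask[of u A x ?n "?w @ [False]" "Aux 0"] code by simp
  \<comment> \<open>The last round of the loop is counted separately because its query succeeds. The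
    five single steps are the separator bit and one append and one query each for the final stop
    word and for the code word.\<close>
  define m where "m = length u + ?n + 2 * (B - 1) + 5"
  have run: "(?S ^^ m) (init_conf (decide_machine u) x)
      (cnf (if P then length u + 3 else length u + 2) x ?n (?w @ [False]) (Aux 0))"
  proof -
    have "(?S ^^ (length u + ?n)) (init_conf (decide_machine u) x) (cnf (length u) x ?n (u @ x) Blank)"
      using relpowp_trans[OF 1 2] .
    from relpowp_Suc_I[OF this 3] have "(?S ^^ Suc (length u + ?n)) (init_conf (decide_machine u) x)
        (cnf (length u + 2) x ?n (u @ x @ [False]) Blank)" .
    from relpowp_trans[OF this 4]
    have "(?S ^^ (Suc (length u + ?n) + 2 * (B - 1))) (init_conf (decide_machine u) x)
        (cnf (length u + 2) x ?n (u @ x @ False # replicate (B - 1) True) Blank)" .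
    from relpowp_Suc_I[OF relpowp_Suc_I[OF relpowp_Suc_I[OF relpowp_Suc_I[OF this 5] 6] 7] 8]
    show ?thesis unfolding m_def by (simp add: eval_nat_numeral)
  qed
  show ?thesis
  proof (cases P)
    case True
    have "tr (length u + 3) (rd x ?n) (Aux 0) (length u + 4) None False (Aux 0) \<in> decide_delta u"
      unfolding decide_delta_def by (simp add: rd_def)
    from decide_move[OF this, of A "?w @ [False]"] run True
    have "(?S ^^ Suc m) (init_conf (decide_machine u) x) (cnf (length u + 4) x ?n (?w @ [False]) (Aux 0))"
      by (intro relpowp_Suc_I) auto
    moreover have "\<not> ?S (cnf (length u + 4) x ?n (?w @ [False]) (Aux 0)) c" for c
      using acc_state_no_step[OF wf_decide_machine[of u], of A _ c] by (fastforce simp: decide_machine_def)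
    moreover have "Suc m \<le> length u + ?n + 2 * B + 4" using B unfolding m_def by simp
    moreover have "state (cnf (length u + 4) x ?n (?w @ [False]) (Aux 0)) = q_acc (decide_machine u)"
      by (simp add: decide_machine_def)
    ultimately show ?thesis using True by blast
  next
    case False
    \<comment> \<open>This is the state that appends 1s, but under the mark \<open>Aux 0\<close> it
      has no transition, so a negative last answer halts without acceptance.\<close>
    let ?c = "cnf (length u + 2) x ?n (?w @ [False]) (Aux 0)"
    have "\<not> ?S ?c c" for c
      unfolding step_decide_machine decide_delta_def by auto
    moreover have "m \<le> length u + ?n + 2 * B + 4" using B unfolding m_def by simp
    moreover have "state ?c \<noteq> q_acc (decide_machine u)" by (simp add: decide_machine_def)
    moreover have "(?S ^^ m) (init_conf (decide_machine u) x) ?c" using run False by simp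
    ultimately show ?thesis using False by blast
  qed
qed

lemma coded_pair_in_P:
  assumes "fsat d (CPair M1 M2 k) A" "codes_ok [d \<mapsto> CPair M1 M2 k] A"
  shows "{x. acc M1 k A x} \<in> class_P A"
proof -
  let ?u = "cone d []" and ?B = "\<lambda>x :: word. bnd (2 * k) (length x)"
  have run: "\<exists>n c. n \<le> length ?u + length x + 2 * ?B x + 4 \<and>
    (step (decide_machine ?u) A ^^ n) (init_conf (decide_machine ?u) x) c \<and>
    (\<forall>c'. \<not> step (decide_machine ?u) A c c') \<and> (state c = q_acc (decide_machine ?u) \<longleftrightarrow> acc M1 k A x)" for x
  proof (rule decide_run)
    show "?u @ x @ False # replicate t True \<in> A \<longleftrightarrow> ?B x \<le> t" if "t \<ge> 1" for t
      using assms(1) that by (simp add: stop_word_def)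
    have "is_code [d \<mapsto> CPair M1 M2 k] (code_word d x (?B x)) M1 M2 k x"
      unfolding is_code_def by auto
    then show "?u @ x @ False # replicate (?B x) True @ [False] \<in> A \<longleftrightarrow> acc M1 k A x"
      using assms(2) unfolding codes_ok_def code_word_def by simp
  qed simp
  note det = deterministic_run[OF wf_decide_machine[of ?u] deterministic_decide_machine[of ?u]]
  have "x \<in> accepted_lang (decide_machine ?u) A \<longleftrightarrow> acc M1 k A x" for x
    using run[of x] det(2)[of _ A x] by blast
  then have "accepted_lang (decide_machine ?u) A = {x. acc M1 k A x}" by blast
  moreover have "poly_time (decide_machine ?u) A"
    unfolding poly_time_def
  proof (intro exI allI impI)
    fix x ps assume ps: "computation (decide_machine ?u) A x ps"
    obtain n c where n: "n \<le> length ?u + length x + 2 * ?B x + 4"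
      "(step (decide_machine ?u) A ^^ n) (init_conf (decide_machine ?u) x) c"
      "\<And>c'. \<not> step (decide_machine ?u) A c c'" using run[of x] by blast
    have "length ps \<le> Suc n" using det(1)[OF n(2) n(3) ps] .
    then show "length ps \<le> poly ([:length ?u + 4, 1:] + smult 2 ([:2, 1:] ^ (2 * k))) (length x) + 1"
      using n(1) by (simp add: bnd_def add.commute)
  qed
  ultimately show ?thesis
    unfolding class_P_def using wf_decide_machine deterministic_decide_machine by blast
qed

section \<open>Closure under complement\<close>

definition symbols :: "otm \<Rightarrow> sym set" where
  "symbols M = {Blank, Bit False, Bit True} \<union> (\<Union>(q, rs, q', ws, ds) \<in> delta M. set rs \<union> set ws)"

definition states :: "otm \<Rightarrow> nat set" where
  "states M = {q_start M, q_yes M, q_no M, q_acc M, q_query M} \<union> (\<Union>(q, rs, q', ws, ds) \<in> delta M. {q, q'})"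

definition fresh :: "otm \<Rightarrow> nat" where
  "fresh M = Suc (Max (states M))"

text \<open>Restriction to states and symbols occurring in \<open>M\<close> keeps the new table
  finite, and by \<open>run_symbols\<close> no run leaves them. The query state is left out because
  a query can always be answered, the old accepting state because it has to keep halting and now
  means rejection.\<close>

definition stuck :: "otm \<Rightarrow> (nat \<times> sym list) set" where
  "stuck M = {(q, rs). q \<in> states M - {q_acc M, q_query M} \<and> set rs \<subseteq> symbols M \<and> length rs = n_tapes M \<and>
     (\<forall>a. (q, rs, a) \<notin> delta M)}"

definition complement_machine :: "otm \<Rightarrow> otm" where
  "complement_machine M = M\<lparr>
     delta := delta M \<union> (\<lambda>(q, rs). (q, rs, fresh M, rs, replicate (n_tapes M) Stay)) ` stuck M,
     q_acc := fresh M\<rparr>"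

lemma complement_machine_simps [simp]:
  "n_tapes (complement_machine M) = n_tapes M" "q_start (complement_machine M) = q_start M"
  "q_query (complement_machine M) = q_query M" "q_yes (complement_machine M) = q_yes M"
  "q_no (complement_machine M) = q_no M" "q_acc (complement_machine M) = fresh M"
  unfolding complement_machine_def by simp_all

lemma finite_symbols: "finite (delta M) \<Longrightarrow> finite (symbols M)"
  and finite_states: "finite (delta M) \<Longrightarrow> finite (states M)"
  unfolding symbols_def states_def by auto

lemma finite_stuck:
  assumes "finite (delta M)"
  shows "finite (stuck M)"
proof (rule finite_subset)
  show "stuck M \<subseteq> states M \<times> {rs. set rs \<subseteq> symbols M \<and> length rs = n_tapes M}"
    unfolding stuck_def by auto
  show "finite (states M \<times> {rs. set rs \<subseteq> symbols M \<and> length rs = n_tapes M})"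
    using finite_states[OF assms] finite_lists_length_eq[OF finite_symbols[OF assms]] by simp
qed

lemma fresh_notin:
  assumes "finite (delta M)"
  shows "fresh M \<notin> states M"
proof
  assume "fresh M \<in> states M"
  then have "fresh M \<le> Max (states M)" using finite_states[OF assms] by (intro Max_ge) auto
  then show False unfolding fresh_def by simp
qed

lemma wf_complement_machine:
  assumes "wf_otm M"
  shows "wf_otm (complement_machine M)"
proof -
  have fin: "finite (delta M)" using assms unfolding wf_otm_def by blast
  have "q_query M \<in> states M" unfolding states_def by simp
  then have 1: "fresh M \<noteq> q_query M" using fresh_notin[OF fin] by auto
  have D: "q \<noteq> fresh M \<and> q \<noteq> q_query M \<and> length rs = n_tapes M \<and> length ws = n_tapes M \<and> length ds = n_tapes M"
    if "(q, rs, q', ws, ds) \<in> delta (complement_machine M)" for q rs q' ws ds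
  proof (cases "(q, rs, q', ws, ds) \<in> delta M")
    case True
    then have "q \<in> states M" unfolding states_def by auto
    then show ?thesis using True assms fresh_notin[OF fin] unfolding wf_otm_def by auto
  next
    case False
    then have s: "(q, rs) \<in> stuck M" "ws = rs" "ds = replicate (n_tapes M) Stay"
      using that unfolding complement_machine_def by auto
    then have "q \<in> states M" "q \<noteq> q_query M" "length rs = n_tapes M" unfolding stuck_def by auto
    then show ?thesis using s(2,3) fresh_notin[OF fin] by auto
  qed
  have fin': "finite (delta (complement_machine M))"
    using fin finite_stuck[OF fin] unfolding complement_machine_def by simp
  have "n_tapes M \<ge> 3" using assms unfolding wf_otm_def by blast
  then show ?thesis
    unfolding wf_otm_def complement_machine_simps using 1 fin' D by (intro conjI ballI) (simp_all split: prod.splits, blast)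
qed

lemma deterministic_complement_machine:
  assumes "deterministic M"
  shows "deterministic (complement_machine M)"
  using assms unfolding deterministic_def complement_machine_def stuck_def by auto

lemma step_complement_machine:
  assumes "step M A c c'"
  shows "step (complement_machine M) A c c'"
  using assms
proof cases
  case (move q rs q' ws ds)
  then show ?thesis
    using step.move[of q rs q' ws ds "complement_machine M" c A] by (simp add: complement_machine_def)
next
  case (ask w)
  then show ?thesis using step.ask[of c "complement_machine M" w A, unfolded complement_machine_simps] by simp
qed

lemma run_symbols:
  assumes "wf_otm M" "(step M A ^^ n) (init_conf M x) c"
  shows "state c \<in> states M \<and> (\<forall>i p. tape c i p \<in> symbols M)"
  using assms(2)
proof (induction n arbitrary: c)
  case 0
  then have "c = init_conf M x" by simp
  moreover have "input_tape x p \<in> symbols M" for p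
    unfolding input_tape_def symbols_def by (cases "x ! nat p") auto
  ultimately show ?case unfolding init_conf_def states_def symbols_def by simp
next
  case (Suc n)
  then obtain c0 where c0: "(step M A ^^ n) (init_conf M x) c0" "step M A c0 c" by auto
  have IH: "state c0 \<in> states M" "\<And>i p. tape c0 i p \<in> symbols M" using Suc.IH[OF c0(1)] by auto
  from c0(2) show ?case
  proof cases
    case (move q rs q' ws ds)
    have "length ws = n_tapes M" using move(2) assms(1) unfolding wf_otm_def by auto
    moreover have "set ws \<subseteq> symbols M"
      using UN_upper[OF move(2), of "\<lambda>(q, rs, q', ws, ds). set rs \<union> set ws"] unfolding symbols_def by auto
    moreover have "q' \<in> states M"
      using UN_upper[OF move(2), of "\<lambda>(q, rs, q', ws, ds). {q, q'}"] unfolding states_def by auto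
    ultimately have "ws ! i \<in> symbols M" if "i < n_tapes M" for i
      using that nth_mem[of i ws] by auto
    then show ?thesis unfolding move(1) using IH \<open>q' \<in> states M\<close> by simp
  next
    case (ask w)
    then show ?thesis using IH unfolding states_def by simp
  qed
qed

text \<open>After finitely many steps the query tape is blank far out, so there is a first cell
  without a bit. Hence no halting run ends in the query state.\<close>

lemma tape_word_exists:
  assumes "computation M A x ps" "c \<in> set ps"
  shows "\<exists>w. tape_word (tape c 1) w"
proof -
  obtain j where j: "j < length ps" "c = ps ! j" using assms(2) by (metis in_set_conv_nth)
  have "tape c 1 (int j) = Blank" using computation_support[OF assms(1) _ j(1), of 1] j(2) by fastforce
  then have ex: "tape c 1 (int j) \<notin> range Bit" by auto
  define l where "l = (LEAST l. tape c 1 (int l) \<notin> range Bit)"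
  have l: "tape c 1 (int l) \<notin> range Bit" unfolding l_def using ex by (rule LeastI)
  have lt: "tape c 1 (int i) \<in> range Bit" if "i < l" for i using not_less_Least[of i] that unfolding l_def by blast
  define w where "w = map (\<lambda>i. SOME b. tape c 1 (int i) = Bit b) [0..<l]"
  have "tape_word (tape c 1) w"
    unfolding tape_word_def
  proof (intro conjI allI impI)
    fix i assume "i < length w"
    then have i: "i < l" unfolding w_def by simp
    then have "tape c 1 (int i) = Bit (SOME b. tape c 1 (int i) = Bit b)" using lt[OF i] by (metis (mono_tags) imageE someI)
    then show "tape c 1 (int i) = Bit (w ! i)" using i unfolding w_def by simp
  qed (use l in \<open>simp add: w_def\<close>)
  then show ?thesis by blast
qed

lemma computation_snoc:
  assumes "computation M A x ps" "step M A (last ps) c"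
  shows "computation M A x (ps @ [c])"
  using assms unfolding computation_def by (auto simp: successively_append_iff)

lemma halting_run:
  assumes "poly_time M A"
  shows "\<exists>ps. computation M A x ps \<and> (\<forall>c. \<not> step M A (last ps) c)"
proof -
  obtain p where p: "\<forall>ps. computation M A x ps \<longrightarrow> length ps \<le> poly p (length x) + 1"
    using assms unfolding poly_time_def by blast
  have "\<exists>ps. computation M A x ps \<and> (\<forall>ps'. computation M A x ps' \<longrightarrow> length ps' \<le> length ps)"
  proof (rule ex_has_greatest_nat[where k = "[init_conf M x]" and b = "poly p (length x) + 2"])
    show "computation M A x [init_conf M x]" unfolding computation_def by simp
    show "\<forall>ps. computation M A x ps \<longrightarrow> length ps < poly p (length x) + 2" using p by fastforce
  qed
  then obtain ps where ps: "computation M A x ps" "\<And>ps'. computation M A x ps' \<Longrightarrow> length ps' \<le> length ps" by blast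
  have "\<not> step M A (last ps) c" for c using ps(2)[OF computation_snoc[OF ps(1)], of c] by auto
  then show ?thesis using ps(1) by blast
qed

lemma computation_relpowp:
  assumes "computation M A x ps"
  shows "(step M A ^^ (length ps - 1)) (init_conf M x) (last ps)"
  unfolding relpowp_fun_conv
  using assms unfolding computation_def successively_conv_nth
  by (intro exI[of _ "\<lambda>i. ps ! i"]) (auto simp: hd_conv_nth last_conv_nth)

lemma complement_run:
  assumes M: "wf_otm M" "deterministic M" and ps: "computation M A x ps" "\<And>c. \<not> step M A (last ps) c"
  shows "\<exists>n c. n \<le> length ps \<and> (step (complement_machine M) A ^^ n) (init_conf (complement_machine M) x) c \<and>
    (\<forall>c'. \<not> step (complement_machine M) A c c') \<and>
    (state c = q_acc (complement_machine M) \<longleftrightarrow> x \<notin> accepted_lang M A)"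
proof -
  let ?M = "complement_machine M" and ?n = "length ps - 1"
  have fin: "finite (delta M)" using M(1) unfolding wf_otm_def by blast
  have ne: "ps \<noteq> []" using ps(1) unfolding computation_def by blast
  have run: "(step M A ^^ ?n) (init_conf M x) (last ps)" using computation_relpowp[OF ps(1)] .
  have acc: "x \<in> accepted_lang M A \<longleftrightarrow> state (last ps) = q_acc M"
    using deterministic_run(2)[OF M run ps(2)] .
  have init: "init_conf ?M x = init_conf M x" unfolding init_conf_def complement_machine_def by simp
  have "(step ?M A ^^ ?n) (init_conf M x) (last ps)"
    using relpowp_mono[of "step M A" "step ?M A"] step_complement_machine run by blast
  then have run': "(step ?M A ^^ ?n) (init_conf ?M x) (last ps)" unfolding init .
  have q: "state (last ps) \<noteq> q_query M"
    using tape_word_exists[OF ps(1), of "last ps"] ne ps(2) step.ask[of "last ps" M _ A] by auto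
  have sy: "state (last ps) \<in> states M" "\<And>i p. tape (last ps) i p \<in> symbols M"
    using run_symbols[OF M(1) run] by auto
  show ?thesis
  proof (cases "state (last ps) = q_acc M")
    case True
    have "q_acc M \<in> states M" unfolding states_def by simp
    then have "q_acc M \<noteq> fresh M" using fresh_notin[OF fin] by auto
    then have f: "state (last ps) \<noteq> q_acc ?M" using True unfolding complement_machine_def by simp
    have "\<not> step ?M A (last ps) c" for c
    proof
      assume "step ?M A (last ps) c"
      then show False
      proof cases
        case (move q' rs q'' ws ds)
        then have "(q', rs, q'', ws, ds) \<in> delta M" using True unfolding complement_machine_def stuck_def by auto
        then show False using move(3) True M(1) unfolding wf_otm_def by blast
      next
        case (ask w)
        then show False using q unfolding complement_machine_def by simp
      qed
    qed
    then show ?thesis using run' f acc True by (intro exI[of _ ?n] exI[of _ "last ps"]) auto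
  next
    case False
    define rs where "rs = map (\<lambda>i. tape (last ps) i (head (last ps) i)) [0..<n_tapes M]"
    have "(state (last ps), rs, a) \<notin> delta M" for a
    proof
      assume a: "(state (last ps), rs, a) \<in> delta M"
      obtain q' ws ds where "a = (q', ws, ds)" by (cases a) auto
      then show False using step.move[OF a[unfolded \<open>a = (q', ws, ds)\<close>] refl rs_def, of A] ps(2) by blast
    qed
    then have "(state (last ps), rs) \<in> stuck M"
      unfolding stuck_def using sy q False by (auto simp: rs_def)
    then have d: "(state (last ps), rs, fresh M, rs, replicate (n_tapes M) Stay) \<in> delta ?M"
      unfolding complement_machine_def by auto
    have "rs = map (\<lambda>i. tape (last ps) i (head (last ps) i)) [0..<n_tapes ?M]"
      unfolding rs_def complement_machine_def by simp
    note mv = step.move[OF d refl this, of A]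
    obtain c where c: "step ?M A (last ps) c" "state c = fresh M"
      by (rule that[OF mv]) simp
    have "(step ?M A ^^ Suc ?n) (init_conf ?M x) c" using relpowp_Suc_I[OF run' c(1)] .
    moreover have "Suc ?n \<le> length ps" using ne by (simp add: Suc_le_eq)
    moreover have "state c = q_acc ?M" using c(2) unfolding complement_machine_def by simp
    moreover from this have "\<not> step ?M A c c'" for c'
      using acc_state_no_step[OF wf_complement_machine[OF M(1)]] by blast
    ultimately show ?thesis using False acc by blast
  qed
qed

text \<open>Rejection is just halting outside \<open>q_acc\<close>, so there is no pair of states to
  swap and missing transitions have to be filled in. This gives the inclusion of P in coNP.\<close>

lemma class_P_complement:
  assumes "L \<in> class_P A"
  shows "- L \<in> class_P A"
proof -
  obtain M where M: "wf_otm M" "deterministic M" "poly_time M A" "L = accepted_lang M A"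
    using assms unfolding class_P_def by blast
  let ?M = "complement_machine M"
  obtain p where p: "\<forall>x ps. computation M A x ps \<longrightarrow> length ps \<le> poly p (length x) + 1"
    using M(3) unfolding poly_time_def by blast
  note det = deterministic_run[OF wf_complement_machine[OF M(1)] deterministic_complement_machine[OF M(2)]]
  have run: "\<exists>n c. n \<le> poly p (length x) + 1 \<and> (step ?M A ^^ n) (init_conf ?M x) c \<and>
    (\<forall>c'. \<not> step ?M A c c') \<and> (state c = q_acc ?M \<longleftrightarrow> x \<notin> accepted_lang M A)" for x
  proof -
    obtain ps where ps: "computation M A x ps" "\<And>c. \<not> step M A (last ps) c" using halting_run[OF M(3)] by blast
    then show ?thesis using complement_run[OF M(1,2) ps] p le_trans by blast
  qed
  have "x \<in> accepted_lang ?M A \<longleftrightarrow> x \<notin> accepted_lang M A" for x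
    using run[of x] det(2)[of _ A x] by blast
  then have "accepted_lang ?M A = - L" unfolding M(4) by blast
  moreover have "poly_time ?M A"
    unfolding poly_time_def
  proof (intro exI[of _ "p + [:1:]"] allI impI)
    fix x ps assume ps: "computation ?M A x ps"
    obtain n c where n: "n \<le> poly p (length x) + 1" "(step ?M A ^^ n) (init_conf ?M x) c"
      "\<And>c'. \<not> step ?M A c c'" using run[of x] by blast
    have "length ps \<le> Suc n" using det(1)[OF n(2) n(3) ps] .
    then show "length ps \<le> poly (p + [:1:]) (length x) + 1" using n(1) by simp
  qed
  ultimately show ?thesis
    unfolding class_P_def
    using wf_complement_machine[OF M(1)] deterministic_complement_machine[OF M(2)] by blast
qed

section \<open>The separation\<close>

lemma acc_iff_accepted:
  assumes "\<And>x ps. computation M A x ps \<Longrightarrow> length ps \<le> bnd k (length x)"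
  shows "acc M k A x \<longleftrightarrow> x \<in> accepted_lang M A"
  unfolding acc_def accepted_lang_def using assms by (auto simp: accepting_paths_def)

text \<open>All larger exponents are offered as well, so that two machines can share the clock
  \<open>max k1 k2\<close>.\<close>

lemma NP_clocked:
  assumes "X \<in> class_NP A"
  obtains M k where "wf_otm M" "\<And>k' x. k \<le> k' \<Longrightarrow> acc M k' A x \<longleftrightarrow> x \<in> X"
proof -
  obtain M where M: "wf_otm M" "poly_time M A" "X = accepted_lang M A"
    using assms unfolding class_NP_def by blast
  obtain k where k: "\<And>x ps k'. computation M A x ps \<Longrightarrow> k \<le> k' \<Longrightarrow> length ps \<le> bnd k' (length x)"
    using poly_time_bnd[OF M(2)] by blast
  have "acc M k' A x \<longleftrightarrow> x \<in> X" if "k \<le> k'" for k' x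
    unfolding M(3) by (rule acc_iff_accepted) (rule k[OF _ that])
  then show ?thesis using that M(1) by blast
qed

lemma UP_clocked:
  assumes "X \<in> class_UP A"
  obtains M k where "wf_otm M" "\<And>x. acc M k A x \<longleftrightarrow> x \<in> X" "\<not> destroyed (CUP M k) A"
proof -
  obtain M where M: "wf_otm M" "poly_time M A" "unambiguous M A" "X = accepted_lang M A"
    using assms unfolding class_UP_def by blast
  obtain k where k: "\<And>x ps k'. computation M A x ps \<Longrightarrow> k \<le> k' \<Longrightarrow> length ps \<le> bnd k' (length x)"
    using poly_time_bnd[OF M(2)] by blast
  have "acc M k A x \<longleftrightarrow> x \<in> X" for x
    unfolding M(4) by (rule acc_iff_accepted) (rule k[OF _ order_refl])
  moreover have "\<not> destroyed (CUP M k) A"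
    using M(3) unfolding unambiguous_def destroyed.simps by blast
  ultimately show ?thesis using that M(1) by blast
qed

lemma FP_clocked:
  assumes "h \<in> class_FP A"
  obtains T k where "wf_otm T" "deterministic T" "\<And>x. outputs T k A x (h x)"
proof -
  obtain T where T: "wf_otm T" "deterministic T" "poly_time T A"
    "\<forall>x. \<exists>ps \<in> accepting_paths T A x. tape_word (tape (last ps) 2) (h x)"
    using assms unfolding class_FP_def by blast
  obtain k where k: "\<And>x ps k'. computation T A x ps \<Longrightarrow> k \<le> k' \<Longrightarrow> length ps \<le> bnd k' (length x)"
    using poly_time_bnd[OF T(3)] by blast
  have "outputs T k A x (h x)" for x
  proof -
    obtain ps where ps: "ps \<in> accepting_paths T A x" "tape_word (tape (last ps) 2) (h x)" using T(4) by blast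
    then have "length ps \<le> bnd k (length x)" using k[of x ps k] unfolding accepting_paths_def by simp
    then show ?thesis unfolding outputs_def using ps by blast
  qed
  then show ?thesis using that T(1,2) by blast
qed

lemma class_P_subset_NP: "class_P A \<subseteq> class_NP A"
  unfolding class_P_def class_NP_def by blast

lemma class_UP_subset_NP: "class_UP A \<subseteq> class_NP A"
  unfolding class_UP_def class_NP_def by blast

lemma pp_hard_mono: "pp_hard A Q \<C> \<Longrightarrow> \<D> \<subseteq> \<C> \<Longrightarrow> pp_hard A Q \<D>"
  unfolding pp_hard_def by blast

lemma disj_pairs_mono: "\<C> \<subseteq> \<D> \<Longrightarrow> disj_pairs \<C> \<subseteq> disj_pairs \<D>"
  unfolding disj_pairs_def by blast

theorem theorem4:
  shows "\<exists>Orc :: lang.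
     class_NP Orc \<inter> co (class_NP Orc) = class_P Orc \<and>
     (\<not> (\<exists>Q \<in> DisjNP Orc. pp_hard Orc Q (DisjUP Orc)) \<and>
      \<not> (\<exists>Q. pp_complete Orc Q (DisjNP Orc))) \<and>
     \<not> (\<exists>X \<in> class_UP Orc. m_complete Orc X (class_UP Orc)) \<and>
     (\<not> (\<exists>Q \<in> DisjCoNP Orc. pp_hard Orc Q (DisjCoUP Orc)) \<and>
      \<not> (\<exists>Q. pp_complete Orc Q (DisjCoNP Orc)))"
proof -
  obtain A where gen: "\<And>c. wf_constr c \<Longrightarrow> destroyed c A \<or>
    (\<exists>d. fsat d c A \<and> codes_ok [d \<mapsto> c] A \<and> (\<forall>T k. wf_otm T \<longrightarrow> deterministic T \<longrightarrow> fails T k d c A))"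
    using generic_oracle by blast
  have P: "class_NP A \<inter> co (class_NP A) = class_P A"
  proof (intro equalityI subsetI)
    fix X assume "X \<in> class_NP A \<inter> co (class_NP A)"
    then obtain Y where X: "X \<in> class_NP A" and Y: "Y \<in> class_NP A" "X = - Y" unfolding co_def by blast
    obtain M1 k1 where M1: "wf_otm M1" "\<And>k x. k1 \<le> k \<Longrightarrow> acc M1 k A x \<longleftrightarrow> x \<in> X" using NP_clocked[OF X] by blast
    obtain M2 k2 where M2: "wf_otm M2" "\<And>k x. k2 \<le> k \<Longrightarrow> acc M2 k A x \<longleftrightarrow> x \<in> Y" using NP_clocked[OF Y(1)] by blast
    define k where "k = max k1 k2"
    have a: "acc M1 k A x \<longleftrightarrow> x \<in> X" "acc M2 k A x \<longleftrightarrow> x \<in> Y" for x using M1(2) M2(2) unfolding k_def by auto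
    then have "\<not> destroyed (CPair M1 M2 k) A" using Y(2) by auto
    moreover have "wf_constr (CPair M1 M2 k)" using M1 M2 by simp
    ultimately obtain d where "fsat d (CPair M1 M2 k) A" "codes_ok [d \<mapsto> CPair M1 M2 k] A" using gen by blast
    then have "{x. acc M1 k A x} \<in> class_P A" by (rule coded_pair_in_P)
    then show "X \<in> class_P A" using a(1) by simp
  next
    fix X assume X: "X \<in> class_P A"
    then have "- X \<in> class_NP A" "X = - (- X)" using class_P_complement class_P_subset_NP by auto
    then show "X \<in> class_NP A \<inter> co (class_NP A)" using X class_P_subset_NP unfolding co_def by blast
  qed
  have NP: "\<not> (\<exists>Q \<in> DisjNP A. pp_hard A Q (DisjUP A))"
  proof
    assume "\<exists>Q \<in> DisjNP A. pp_hard A Q (DisjUP A)"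
    then obtain X Y where hard: "pp_hard A (X, Y) (DisjUP A)" and XY: "X \<in> class_NP A" "Y \<in> class_NP A" "X \<inter> Y = {}"
      unfolding DisjNP_def disj_pairs_def by blast
    obtain M1 k1 where M1: "wf_otm M1" "\<And>k x. k1 \<le> k \<Longrightarrow> acc M1 k A x \<longleftrightarrow> x \<in> X" using NP_clocked[OF XY(1)] by blast
    obtain M2 k2 where M2: "wf_otm M2" "\<And>k x. k2 \<le> k \<Longrightarrow> acc M2 k A x \<longleftrightarrow> x \<in> Y" using NP_clocked[OF XY(2)] by blast
    define k where "k = max k1 k2"
    have a: "acc M1 k A x \<longleftrightarrow> x \<in> X" "acc M2 k A x \<longleftrightarrow> x \<in> Y" for x using M1(2) M2(2) unfolding k_def by auto
    have "\<not> destroyed (CNP M1 M2 k) A" using a XY(3) by auto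
    moreover have "wf_constr (CNP M1 M2 k)" using M1 M2 by simp
    ultimately obtain d where d: "fsat d (CNP M1 M2 k) A"
      "\<And>T j. wf_otm T \<Longrightarrow> deterministic T \<Longrightarrow> fails T j d (CNP M1 M2 k) A" using gen by blast
    \<comment> \<open>A level of this cone holds at most one word over both kinds together, which
      yields unambiguity of each language and disjointness of the two.\<close>
    let ?G = "\<lambda>b. guessed (cone d [b]) A"
    have uniq: "v = v'" if "length v = length v'" "cone d v \<in> A" "cone d v' \<in> A" for v v'
      using d(1) that unfolding fsat.simps by blast
    have "?G b \<in> class_UP A" for b
    proof (rule guessed_in_UP)
      show "z = z'" if "length z = length z'" "cone d [b] @ z \<in> A" "cone d [b] @ z' \<in> A" for z z'
        using uniq[of "b # z" "b # z'"] that by simp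
    qed
    moreover have "?G False \<inter> ?G True = {}"
    proof (rule ccontr)
      assume "?G False \<inter> ?G True \<noteq> {}"
      then obtain x z z' :: word where "length z = length x" "cone d (False # z) \<in> A"
          "length z' = length x" "cone d (True # z') \<in> A"
        unfolding guessed_def by auto
      then show False using uniq[of "False # z" "True # z'"] by simp
    qed
    ultimately have "(?G False, ?G True) \<in> DisjUP A" unfolding DisjUP_def disj_pairs_def by simp
    then have "pp_reducible A (?G False, ?G True) (X, Y)" using hard unfolding pp_hard_def by blast
    then obtain h where h: "h \<in> class_FP A" "h ` ?G False \<subseteq> X" "h ` ?G True \<subseteq> Y"
      unfolding pp_reducible_def by auto
    obtain T j where T: "wf_otm T" "deterministic T" "\<And>x. outputs T j A x (h x)" using FP_clocked[OF h(1)] by blast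
    then obtain x where "x \<in> ?G False \<and> \<not> acc M1 k A (h x) \<or> x \<in> ?G True \<and> \<not> acc M2 k A (h x)"
      using d(2)[OF T(1,2), of j] unfolding fails.simps by blast
    then show False using h(2,3) a by blast
  qed
  have UP: "\<not> (\<exists>X \<in> class_UP A. m_complete A X (class_UP A))"
  proof
    assume "\<exists>X \<in> class_UP A. m_complete A X (class_UP A)"
    then obtain X where X: "X \<in> class_UP A" and hard: "\<And>Y. Y \<in> class_UP A \<Longrightarrow> m_reducible A Y X"
      unfolding m_complete_def by blast
    obtain M k where M: "wf_otm M" "\<And>x. acc M k A x \<longleftrightarrow> x \<in> X" "\<not> destroyed (CUP M k) A"
      using UP_clocked[OF X] by blast
    moreover have "wf_constr (CUP M k)" using M by simp
    ultimately obtain d where d: "fsat d (CUP M k) A"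
      "\<And>T j. wf_otm T \<Longrightarrow> deterministic T \<Longrightarrow> fails T j d (CUP M k) A" using gen by blast
    let ?G = "guessed (cone d []) A"
    have "?G \<in> class_UP A"
    proof (rule guessed_in_UP)
      show "z = z'" if "length z = length z'" "cone d [] @ z \<in> A" "cone d [] @ z' \<in> A" for z z'
        using d(1) that by simp
    qed
    then obtain h where h: "h \<in> class_FP A" "\<And>x. x \<in> ?G \<longleftrightarrow> h x \<in> X"
      using hard unfolding m_reducible_def by blast
    obtain T j where T: "wf_otm T" "deterministic T" "\<And>x. outputs T j A x (h x)" using FP_clocked[OF h(1)] by blast
    then obtain x where "(x \<in> ?G) \<noteq> acc M k A (h x)"
      using d(2)[OF T(1,2), of j] unfolding fails.simps by blast
    then show False using h(2) M(2) by blast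
  qed
  have coNP: "\<not> (\<exists>Q \<in> DisjCoNP A. pp_hard A Q (DisjCoUP A))"
  proof
    assume "\<exists>Q \<in> DisjCoNP A. pp_hard A Q (DisjCoUP A)"
    then obtain X Y where hard: "pp_hard A (- X, - Y) (DisjCoUP A)" and
      XY: "X \<in> class_NP A" "Y \<in> class_NP A" "- X \<inter> - Y = {}"
      unfolding DisjCoNP_def disj_pairs_def co_def by blast
    obtain M1 k1 where M1: "wf_otm M1" "\<And>k x. k1 \<le> k \<Longrightarrow> acc M1 k A x \<longleftrightarrow> x \<in> X" using NP_clocked[OF XY(1)] by blast
    obtain M2 k2 where M2: "wf_otm M2" "\<And>k x. k2 \<le> k \<Longrightarrow> acc M2 k A x \<longleftrightarrow> x \<in> Y" using NP_clocked[OF XY(2)] by blast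
    define k where "k = max k1 k2"
    have a: "acc M1 k A x \<longleftrightarrow> x \<in> X" "acc M2 k A x \<longleftrightarrow> x \<in> Y" for x using M1(2) M2(2) unfolding k_def by auto
    have "\<not> destroyed (CCo M1 M2 k) A" using a XY(3) by auto
    moreover have "wf_constr (CCo M1 M2 k)" using M1 M2 by simp
    ultimately obtain d where d: "fsat d (CCo M1 M2 k) A"
      "\<And>T j. wf_otm T \<Longrightarrow> deterministic T \<Longrightarrow> fails T j d (CCo M1 M2 k) A" using gen by blast
    let ?G = "\<lambda>b. guessed (cone d [b]) A"
    have "?G b \<in> class_UP A" for b
    proof (rule guessed_in_UP)
      show "z = z'" if "length z = length z'" "cone d [b] @ z \<in> A" "cone d [b] @ z' \<in> A" for z z'
        using d(1) that unfolding fsat.simps by simp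
    qed
    moreover have "- ?G False \<inter> - ?G True = {}"
    proof -
      have "x \<in> ?G False \<or> x \<in> ?G True" for x
      proof -
        obtain b v where "length v = length x" "cone d (b # v) \<in> A" using d(1) unfolding fsat.simps by blast
        then have "x \<in> ?G b" unfolding guessed_def by auto
        then show ?thesis by (cases b) auto
      qed
      then show ?thesis by blast
    qed
    ultimately have "(- ?G False, - ?G True) \<in> DisjCoUP A" unfolding DisjCoUP_def disj_pairs_def co_def by blast
    then have "pp_reducible A (- ?G False, - ?G True) (- X, - Y)" using hard unfolding pp_hard_def by blast
    then obtain h where h: "h \<in> class_FP A" "h ` (- ?G False) \<subseteq> - X" "h ` (- ?G True) \<subseteq> - Y"
      unfolding pp_reducible_def by auto
    obtain T j where T: "wf_otm T" "deterministic T" "\<And>x. outputs T j A x (h x)" using FP_clocked[OF h(1)] by blast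
    then obtain x where "x \<notin> ?G False \<and> acc M1 k A (h x) \<or> x \<notin> ?G True \<and> acc M2 k A (h x)"
      using d(2)[OF T(1,2), of j] unfolding fails.simps by blast
    then show False using h(2,3) a by blast
  qed
  have sub: "DisjUP A \<subseteq> DisjNP A" "DisjCoUP A \<subseteq> DisjCoNP A"
    unfolding DisjUP_def DisjNP_def DisjCoUP_def DisjCoNP_def
    using class_UP_subset_NP[of A] by (auto intro!: disj_pairs_mono simp: co_def)
  have "\<not> (\<exists>Q. pp_complete A Q (DisjNP A))" "\<not> (\<exists>Q. pp_complete A Q (DisjCoNP A))"
    using NP coNP sub pp_hard_mono unfolding pp_complete_def by blast+
  then show ?thesis using P NP UP coNP by blast
qed

end
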